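(* Let $K\subseteq\mathbb{S}^n$ be a spherically convex set of spherical circumradius $\rho$. Then there is a covering of $\mathbb{S}^n$ by rotated copies of $K$ of density at most $$\inf_{\kappa>0\,:\,K_{-(\kappa\rho)}\neq\emptyset}\left[\frac{\sigma(K)}{\sigma(K)-\Omega(\rho)\left(1-(1-\kappa)^n\right)}\left(2n+n\ln\frac{1}{\kappa\rho}\right)\right].$$
   Context: $\mathbb{S}^n$ is the unit sphere in $\mathbb{R}^{n+1}$ and $\sigma$ is the Haar (rotation invariant) probability measure on $\mathbb{S}^n$. $C(u,\phi)$ denotes the closed spherical cap of spherical (angular) radius $\phi$ centered at $u\in\mathbb{S}^n$, and $\Omega(\phi)=\sigma(C(u,\phi))$ denotes its measure. For $K\subset\mathbb{S}^n$ and $\delta>0$, the $\delta$-inner parallel body of $K$ is $K_{-\delta}=\{u\in K : C(u,\delta)\subseteq K\}$. A set $K\subset\mathbb{S}^n$ is called spherically convex if it is contained in an open hemisphere and, for any two of its points, it contains the shorter great circular arc connecting them. The spherical circumradius of a subset of an open hemisphere of $\mathbb{S}^n$ is the spherical radius of the smallest spherical cap that contains the set. A rotated copy of $K$ is a set $AK$ with $A\in SO(n+1)$. The density of a covering of $\mathbb{S}^n$ by $N$ rotated copies of $K$ is $N\sigma(K)$.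
   Formalization: Values of κ for which the denominator σ(K) − Ω(ρ)(1−(1−κ)^n) is zero or negative are disregarded (the bracket counts as +∞), since for thin K the bracket would otherwise be negative and the claim false; K is nonempty and n ≥ 1. *)

theory Defs
  imports "HOL-Probability.Probability"
begin

text \<open>The sphere \<open>S\<^sup>n\<close> is \<^term>\<open>sphere 0 1 :: (real ^ 'd) set\<close> with \<open>CARD('d) = n + 1\<close>; the rotation
  group \<open>SO(n+1)\<close> consists of the matrices satisfying \<^const>\<open>rotation_matrix\<close>.\<close>

definition spherical_haar :: "(real ^ 'd) measure \<Rightarrow> bool" where
  "spherical_haar \<sigma> \<longleftrightarrow>
     prob_space \<sigma> \<and>
     sets \<sigma> = sets (restrict_space borel (sphere 0 1)) \<and>
     (\<forall>A X. rotation_matrix A \<and> X \<in> sets \<sigma> \<longrightarrow> emeasure \<sigma> ((*v) A ` X) = emeasure \<sigma> X)"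

text \<open>A spherically convex set need not be Borel (an open cap together with any part of its
  boundary), so sets are measured by the completion of the Borel measure \<open>\<sigma>\<close>.\<close>

abbreviation sph_measure :: "(real ^ 'd) measure \<Rightarrow> (real ^ 'd) set \<Rightarrow> real" where
  "sph_measure \<sigma> X \<equiv> measure (completion \<sigma>) X"

definition spherical_cap :: "real ^ 'd \<Rightarrow> real \<Rightarrow> (real ^ 'd) set" where
  "spherical_cap u \<phi> = {v \<in> sphere 0 1. arccos (u \<bullet> v) \<le> \<phi>}"

text \<open>The measure of a cap of radius \<open>\<phi>\<close>; the choice of the centre is immaterial by
  \<open>cap_measure_eq\<close> below.\<close>

definition cap_measure :: "(real ^ 'd) measure \<Rightarrow> real \<Rightarrow> real" where
  "cap_measure \<sigma> \<phi> = sph_measure \<sigma> (spherical_cap (SOME u. u \<in> sphere 0 1) \<phi>)"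

definition inner_parallel_body :: "(real ^ 'd) set \<Rightarrow> real \<Rightarrow> (real ^ 'd) set" where
  "inner_parallel_body K \<delta> = {u \<in> K. spherical_cap u \<delta> \<subseteq> K}"

text \<open>For non-antipodal points \<open>x\<close>, \<open>y\<close> of the sphere, the great circle through them is cut out by
  their span, and its shorter arc from \<open>x\<close> to \<open>y\<close> by the cone they generate.\<close>

definition shorter_arc :: "real ^ 'd \<Rightarrow> real ^ 'd \<Rightarrow> (real ^ 'd) set" where
  "shorter_arc x y = {z \<in> sphere 0 1. \<exists>a\<ge>0. \<exists>b\<ge>0. z = a *\<^sub>R x + b *\<^sub>R y}"

definition spherically_convex :: "(real ^ 'd) set \<Rightarrow> bool" where
  "spherically_convex K \<longleftrightarrow>
     (\<exists>w \<in> sphere 0 1. K \<subseteq> {x \<in> sphere 0 1. 0 < w \<bullet> x}) \<and>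
     (\<forall>x\<in>K. \<forall>y\<in>K. shorter_arc x y \<subseteq> K)"

text \<open>For a nonempty set the infimum is attained, by compactness of the sphere.\<close>

definition spherical_circumradius :: "(real ^ 'd) set \<Rightarrow> real" where
  "spherical_circumradius K = Inf {\<phi>. 0 \<le> \<phi> \<and> (\<exists>u \<in> sphere 0 1. K \<subseteq> spherical_cap u \<phi>)}"

text \<open>The set \<open>R\<close> collects the rotations \<open>A\<close> whose copies \<open>A K\<close> form the covering.\<close>

definition covering_by_rotated_copies :: "(real ^ 'd) set \<Rightarrow> (real ^ 'd ^ 'd) set \<Rightarrow> bool" where
  "covering_by_rotated_copies K R \<longleftrightarrow>
     (\<forall>A\<in>R. rotation_matrix A) \<and> sphere 0 1 \<subseteq> (\<Union>A\<in>R. (*v) A ` K)"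

text \<open>An infinite family has density \<open>\<infinity>\<close>, also if \<open>K\<close> is a null set.\<close>

definition covering_density ::
    "(real ^ 'd) measure \<Rightarrow> (real ^ 'd) set \<Rightarrow> (real ^ 'd ^ 'd) set \<Rightarrow> ereal" where
  "covering_density \<sigma> K R =
     (if finite R then ereal (real (card R) * sph_measure \<sigma> K) else \<infinity>)"

text \<open>The quantity in brackets of the density bound. Its denominator is a lower bound for the
  measure of \<open>inner_parallel_body K (\<kappa> * \<rho>)\<close> and can be zero or negative although this set is nonempty (thin \<open>K\<close>); such
  a \<open>\<kappa>\<close> yields no information, and the value is then \<open>\<infinity>\<close>.\<close>

definition density_bound ::
    "(real ^ 'd) measure \<Rightarrow> nat \<Rightarrow> (real ^ 'd) set \<Rightarrow> real \<Rightarrow> real \<Rightarrow> ereal" where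
  "density_bound \<sigma> n K \<rho> \<kappa> =
     (let D = sph_measure \<sigma> K - cap_measure \<sigma> \<rho> * (1 - (1 - \<kappa>) ^ n) in
      if 0 < D
      then ereal (sph_measure \<sigma> K / D * (2 * real n + real n * ln (1 / (\<kappa> * \<rho>))))
      else \<infinity>)"

lemma rotation_image_spherical_cap:
  fixes A :: "real ^ 'd ^ 'd"
  assumes "rotation_matrix A"
  shows "(*v) A ` spherical_cap u \<phi> = spherical_cap (A *v u) \<phi>"
proof -
  have ot: "orthogonal_transformation ((*v) A)"
    using assms by (simp add: rotation_matrix_def orthogonal_transformation_matrix)
  then have sub: "(A *v v) \<bullet> (A *v w) = v \<bullet> w" "norm (A *v v) = norm v" for v w
    by (auto simp: orthogonal_transformation_def orthogonal_transformation_norm)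
  have "surj ((*v) A)"
    using ot by (rule orthogonal_transformation_surj)
  then show ?thesis
    by (force simp: spherical_cap_def sub surj_def image_iff)
qed

lemma spherical_cap_sets:
  assumes "spherical_haar \<sigma>" "u \<in> sphere 0 1"
  shows "spherical_cap u \<phi> \<in> sets \<sigma>"
proof -
  have "\<bar>u \<bullet> v\<bar> \<le> 1" if "v \<in> sphere 0 1" for v
    using Cauchy_Schwarz_ineq2[of u v] assms(2) that by simp
  then have "continuous_on (sphere 0 1) (\<lambda>v. arccos (u \<bullet> v))"
    by (intro continuous_intros continuous_on_arccos) (auto simp: abs_le_iff)
  then have "closed {v \<in> sphere 0 1. arccos (u \<bullet> v) \<le> \<phi>}"
    by (intro continuous_on_closed_Collect_le continuous_on_const closed_sphere)
  then have "spherical_cap u \<phi> \<in> sets borel"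
    by (simp add: spherical_cap_def)
  then show ?thesis
    using assms(1) by (auto simp: spherical_haar_def sets_restrict_space_iff spherical_cap_def)
qed

lemma cap_measure_eq:
  fixes \<sigma> :: "(real ^ 'd) measure"
  assumes "spherical_haar \<sigma>" "2 \<le> CARD('d)" "u \<in> sphere 0 1"
  shows "cap_measure \<sigma> \<phi> = sph_measure \<sigma> (spherical_cap u \<phi>)"
proof -
  define e where "e = (SOME u :: real ^ 'd. u \<in> sphere 0 1)"
  have e: "e \<in> sphere 0 1"
    unfolding e_def using assms(3) by (rule someI)
  have "norm e = norm u"
    using e assms(3) by simp
  then obtain f where f: "orthogonal_transformation f" "det (matrix f) = 1" "f e = u"
    using rotation_exists[OF assms(2)] by blast
  have A: "rotation_matrix (matrix f)" "matrix f *v e = u"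
    using f by (auto simp: rotation_matrix_def orthogonal_transformation_matrix
        matrix_works orthogonal_transformation_linear)
  have "emeasure \<sigma> (spherical_cap u \<phi>) = emeasure \<sigma> (spherical_cap e \<phi>)"
    using assms(1) spherical_cap_sets[OF assms(1) e, of \<phi>] A
      rotation_image_spherical_cap[OF A(1), of e \<phi>]
    by (metis spherical_haar_def)
  then show ?thesis
    using spherical_cap_sets[OF assms(1)] e assms(3)
    unfolding cap_measure_def e_def[symmetric] measure_def by simp
qed

end

theory Submission
  imports Defs
begin

text \<open>Write \<open>n + 1\<close> for the dimension of the ambient space, \<open>\<delta> = \<kappa> * \<rho>\<close>, and let \<open>L\<close> be the set of all \<open>u\<close> on the
sphere that lie in \<open>K\<close> at angular depth more than \<open>\<delta>\<close>, so that the cap \<open>C(u,\<delta>)\<close> is contained in \<open>K\<close>.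

Covering. If \<open>A L\<close> meets the cap \<open>C(x,\<delta>)\<close>, then \<open>x\<close> lies in \<open>A K\<close>. Averaging over a Haar distributed
rotation \<open>A\<close> gives, for every Borel set \<open>U\<close>, a rotation with \<open>\<sigma>(U \<inter> A L) \<ge> \<sigma>(U) \<sigma>(L)\<close>
(\<open>exists_rotation_intersection\<close>). Greedily, the part of the sphere missed by \<open>N\<close> rotated copies of \<open>L\<close> has
measure at most \<open>(1 - \<sigma>(L))^N\<close> (\<open>greedy_rotations\<close>). As soon as this is less than \<open>\<Omega>(\<delta>)\<close>, the missed part
contains no cap of radius \<open>\<delta>\<close>, and the copies of \<open>K\<close> cover the sphere. This needs about
\<open>ln (1 / \<Omega>(\<delta>)) / \<sigma>(L)\<close> copies, and \<open>\<Omega>(\<delta>) \<ge> (2 \<delta> / \<pi>)^n / 2\<close>; together with \<open>\<sigma>(L) \<le> 1/2\<close> (as \<open>K\<close> lies in a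
hemisphere) this yields \<open>N \<sigma>(L) \<le> 2 n + n ln (1 / \<delta>)\<close> (\<open>economical_covering\<close>).

Measure of the inner body. It remains to see \<open>\<sigma>(L) \<ge> \<sigma>(K) - \<Omega>(\<rho>) (1 - (1 - \<kappa>)^n)\<close>. Let \<open>C(c,\<rho>)\<close> be the
circumscribed cap. The layer of points of \<open>K\<close> at depth at most \<open>\<delta>\<close> has at most the measure of the layer of
points of \<open>C(c,\<rho>)\<close> at depth at most \<open>\<delta>\<close> (\<open>prob_depth_lower\<close>), that is, at most \<open>\<Omega>(\<rho>) - \<Omega>(\<rho> - \<delta>)\<close>; and
\<open>\<Omega>(\<lambda> \<phi>) \<ge> \<lambda>^n \<Omega>(\<phi>)\<close> because \<open>\<Omega>\<close> has a derivative proportional to \<open>sin^(n - 1)\<close> (\<open>prob_cap_scale\<close>).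

The comparison of layers is the statement that perimeter is monotone under inclusion of convex sets, applied
to all inner parallel bodies and integrated. In place of perimeters, consider a pair \<open>(X, Z)\<close> distributed uniformly
in the unit ball of the product of two copies of the ambient space, and the ellipse \<open>X cos t + Z sin t\<close>. Its law
is invariant under shifts of \<open>t\<close>. The vertices \<open>t = j \<pi> / m\<close>, \<open>j < 2 m\<close>, that lie in a convex cone \<open>S\<close> inside an open
half-space are consecutive, so the polygon leaves \<open>S\<close> exactly once if it meets \<open>S\<close> and never otherwise. Hence the
probability that \<open>X\<close> lies in \<open>S\<close> and the next vertex does not is \<open>1 / (2 m)\<close> times the probability that
the polygon meets \<open>S\<close>, and is monotone in \<open>S\<close> (\<open>exit_weight_mono\<close>). Integration over the level sets of
the depth turns this into a comparison of the mean decrease of depth over one step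
(\<open>exit_depth_mono\<close>). To first order in \<open>\<pi> / m\<close> that mean decrease at \<open>X = x\<close> depends on \<open>norm x\<close> only: the depth is
bounded by the angular distance to a supporting hyperplane and agrees with it at \<open>x\<close>, and such a distance
has a gradient of length \<open>1 / norm x\<close>. In the limit both sides become integrals of one rotation invariant density
over the two layers (\<open>layer_comparison\<close>), and every such density induces a multiple of \<open>\<sigma>\<close> on the sphere
(\<open>radial_integral\<close>).\<close>

section \<open>Lebesgue measure and linear isometries\<close>

lemma orthogonal_transformation_borel:
  fixes T :: "'a::euclidean_space \<Rightarrow> 'a"
  assumes "orthogonal_transformation T" shows "T \<in> borel_measurable borel"
  using assms
  by (intro borel_measurable_continuous_onI linear_continuous_on linear_conv_bounded_linear[THEN iffD1])
    (simp add: orthogonal_transformation)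

lemma emeasure_unit_cball:
  "emeasure lborel (cball (0::'a::euclidean_space) 1) \<noteq> 0" "emeasure lborel (cball (0::'a) 1) \<noteq> \<infinity>"
  using content_cball_pos[of 1 "0::'a"]
  by (auto simp: emeasure_lborel_cball_finite[THEN less_imp_neq] measure_def simp flip: less_top)

text \<open>The image of Lebesgue measure under an isometry is translation invariant, and so a multiple of Lebesgue measure;
the unit ball, which is mapped to itself, shows that the factor is 1. The proof carries out the usual uniqueness
argument directly: the double integral of \<open>indicator A (T x) * indicator B (y - T x)\<close>, with \<open>B\<close> the unit ball,
is evaluated in both orders.\<close>

lemma orthogonal_transformation_distr_lborel:
  fixes T :: "'a::euclidean_space \<Rightarrow> 'a"
  assumes T: "orthogonal_transformation T"
  shows "distr lborel borel T = lborel"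
proof (rule measure_eqI)
  have lin: "linear T" and nrm: "\<And>x. norm (T x) = norm x" and "surj T"
    using T by (auto simp: orthogonal_transformation orthogonal_transformation_surj)
  have [measurable]: "T \<in> borel_measurable borel" by (rule orthogonal_transformation_borel[OF T])
  have transl: "(\<integral>\<^sup>+y. f (y + c) \<partial>lborel) = (\<integral>\<^sup>+y. f y \<partial>lborel)"
    if [measurable]: "f \<in> borel_measurable borel" for f :: "'a \<Rightarrow> ennreal" and c
    by (subst (2) lborel_distr_plus[of c, symmetric]) (simp add: nn_integral_distr add.commute)
  fix A assume "A \<in> sets (distr lborel borel T)"
  then have [measurable]: "A \<in> sets borel" by simp
  (* B has positive finite measure and is invariant under T and under negation. *)
  define B where "B = (cball 0 1 :: 'a set)"
  have [measurable]: "B \<in> sets borel" by (simp add: B_def)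
  let ?g = "\<lambda>x y. indicator A (T x) * indicator B (y - T x) :: ennreal"
  have "emeasure lborel (T -` A) * emeasure lborel B = (\<integral>\<^sup>+x. (\<integral>\<^sup>+y. ?g x y \<partial>lborel) \<partial>lborel)"
  proof -
    have "(\<integral>\<^sup>+y. ?g x y \<partial>lborel) = indicator (T -` A) x * emeasure lborel B" for x
      using transl[of "indicator B" "- T x"]
      by (simp add: nn_integral_cmult indicator_vimage)
    moreover have "T -` A \<in> sets lborel"
      using measurable_sets[OF \<open>T \<in> borel_measurable borel\<close> \<open>A \<in> sets borel\<close>] by simp
    ultimately show ?thesis by (simp add: nn_integral_multc)
  qed
  also have "\<dots> = (\<integral>\<^sup>+y. (\<integral>\<^sup>+x. ?g x y \<partial>lborel) \<partial>lborel)"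
    by (rule lborel_pair.Fubini') measurable
  also have "\<dots> = (\<integral>\<^sup>+y. (\<integral>\<^sup>+x. indicator A (y + T x) * indicator B (- T x) \<partial>lborel) \<partial>lborel)"
  proof (rule nn_integral_cong)
    fix y
    obtain w where w: "y = T w" using \<open>surj T\<close> by (metis surjD)
    show "(\<integral>\<^sup>+x. ?g x y \<partial>lborel) = (\<integral>\<^sup>+x. indicator A (y + T x) * indicator B (- T x) \<partial>lborel)"
      using transl[of "\<lambda>x. ?g x y" w] by (simp add: w linear_add[OF lin] algebra_simps)
  qed
  also have "\<dots> = (\<integral>\<^sup>+x. (\<integral>\<^sup>+y. indicator A (y + T x) * indicator B (- T x) \<partial>lborel) \<partial>lborel)"
    by (rule lborel_pair.Fubini'[symmetric]) measurable
  also have "\<dots> = (\<integral>\<^sup>+x. emeasure lborel A * indicator B x \<partial>lborel)"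
  proof (rule nn_integral_cong)
    fix x
    have "indicator B (- T x) = (indicator B x :: ennreal)" by (simp add: B_def indicator_def nrm)
    then show "(\<integral>\<^sup>+y. indicator A (y + T x) * indicator B (- T x) \<partial>lborel) = emeasure lborel A * indicator B x"
      using transl[of "indicator A" "T x"] by (simp add: nn_integral_multc)
  qed
  also have "\<dots> = emeasure lborel A * emeasure lborel B"
    by (simp add: nn_integral_cmult)
  finally have eq: "emeasure lborel (T -` A) * emeasure lborel B = emeasure lborel A * emeasure lborel B" .
  have B: "emeasure lborel B \<noteq> 0" "emeasure lborel B \<noteq> \<infinity>"
    unfolding B_def by (rule emeasure_unit_cball)+
  then have "emeasure lborel (T -` A) = emeasure lborel A"
    using ennreal_mult_cancel_left[of "emeasure lborel B" "emeasure lborel (T -` A)" "emeasure lborel A"] eq by (auto simp: mult.commute)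
  then show "emeasure (distr lborel borel T) A = emeasure lborel A"
    by (simp add: emeasure_distr)
qed simp

lemma nn_integral_orthogonal_transformation:
  fixes T :: "'a::euclidean_space \<Rightarrow> 'a"
  assumes T: "orthogonal_transformation T" and [measurable]: "f \<in> borel_measurable borel"
  shows "(\<integral>\<^sup>+x. f (T x) \<partial>lborel) = (\<integral>\<^sup>+x. f x \<partial>lborel)"
proof -
  have [measurable]: "T \<in> borel_measurable borel" by (rule orthogonal_transformation_borel[OF T])
  show ?thesis
    by (subst (2) orthogonal_transformation_distr_lborel[OF T, symmetric]) (simp add: nn_integral_distr)
qed

section \<open>Haar measure on the rotation group\<close>

text \<open>The function is total: where the vectors are linearly dependent, the residue and with it the
result is \<open>0\<close>, so that orthonormality holds exactly if no residue vanishes.\<close>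

function gram_schmidt :: "(nat \<Rightarrow> 'a::euclidean_space) \<Rightarrow> nat \<Rightarrow> 'a" where
  "gram_schmidt v k =
     (let u = v k - (\<Sum>j<k. (v k \<bullet> gram_schmidt v j) *\<^sub>R gram_schmidt v j) in u /\<^sub>R norm u)"
  by auto
termination by (relation "Wellfounded.measure snd") auto
declare gram_schmidt.simps[simp del]

definition gs_residue :: "(nat \<Rightarrow> 'a::euclidean_space) \<Rightarrow> nat \<Rightarrow> 'a" where
  "gs_residue v k = v k - (\<Sum>j<k. (v k \<bullet> gram_schmidt v j) *\<^sub>R gram_schmidt v j)"

lemma gram_schmidt_residue: "gram_schmidt v k = gs_residue v k /\<^sub>R norm (gs_residue v k)"
  by (subst gram_schmidt.simps) (simp add: gs_residue_def Let_def)

lemma gram_schmidt_cong: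
  "(\<And>j. j \<le> k \<Longrightarrow> v j = w j) \<Longrightarrow> gram_schmidt v k = gram_schmidt w k"
proof (induction k rule: less_induct)
  case (less k)
  have "gram_schmidt v j = gram_schmidt w j" if "j < k" for j
    using less that by simp
  then have "gs_residue v k = gs_residue w k"
    using less.prems[of k] unfolding gs_residue_def by (auto intro!: sum.cong)
  then show ?case by (simp add: gram_schmidt_residue)
qed

text \<open>Orthonormalisation uses inner products only, so it commutes with isometries. This is the source of the
invariance of the random rotation constructed from it.\<close>

lemma gram_schmidt_equivariant:
  assumes T: "orthogonal_transformation T"
  shows "gram_schmidt (\<lambda>j. T (v j)) k = T (gram_schmidt v k)"
proof (induction k rule: less_induct)
  case (less k)
  have lin: "linear T" and inn: "\<And>x y. T x \<bullet> T y = x \<bullet> y" and nrm: "\<And>x. norm (T x) = norm x"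
    using T by (auto simp: orthogonal_transformation_def orthogonal_transformation_norm)
  have "gs_residue (\<lambda>j. T (v j)) k = T (gs_residue v k)"
    unfolding gs_residue_def using less
    by (simp add: linear_diff[OF lin] linear_sum[OF lin] linear_scale[OF lin] inn)
  then show ?case by (simp add: gram_schmidt_residue nrm linear_scale[OF lin])
qed

lemma gram_schmidt_orthogonal:
  assumes "\<And>j. j \<le> k \<Longrightarrow> gs_residue v j \<noteq> 0"
  shows "\<forall>i\<le>k. \<forall>j\<le>k. gram_schmidt v i \<bullet> gram_schmidt v j = (if i = j then 1 else 0)"
  using assms
proof (induction k)
  case 0
  then have "norm (gram_schmidt v 0) = 1" by (simp add: gram_schmidt_residue)
  then show ?case by (simp add: norm_eq_1)
next
  case (Suc k)
  have IH: "gram_schmidt v i \<bullet> gram_schmidt v j = (if i = j then 1 else 0)" if "i < Suc k" "j < Suc k" for i j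
    using Suc that by auto
  have "norm (gram_schmidt v (Suc k)) = 1" using Suc.prems[of "Suc k"] by (simp add: gram_schmidt_residue)
  then have 1: "gram_schmidt v (Suc k) \<bullet> gram_schmidt v (Suc k) = 1" by (simp add: norm_eq_1)
  have 2: "gram_schmidt v (Suc k) \<bullet> gram_schmidt v i = 0" if "i < Suc k" for i
  proof -
    have "(\<Sum>j<Suc k. (v (Suc k) \<bullet> gram_schmidt v j) * (gram_schmidt v j \<bullet> gram_schmidt v i))
       = (\<Sum>j<Suc k. if j = i then v (Suc k) \<bullet> gram_schmidt v i else 0)"
      by (rule sum.cong) (use IH that in auto)
    also have "\<dots> = v (Suc k) \<bullet> gram_schmidt v i" using that by (simp add: sum.delta del: sum.lessThan_Suc)
    finally have "gs_residue v (Suc k) \<bullet> gram_schmidt v i = 0"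
      by (simp add: gs_residue_def inner_diff_left inner_sum_left del: sum.lessThan_Suc)
    then show ?thesis unfolding gram_schmidt_residue[of v "Suc k"] by simp
  qed
  show ?case
    using 1 2 IH by (auto simp: le_Suc_eq less_Suc_eq_le inner_commute)
qed

lemma gram_schmidt_measurable:
  assumes "{..k} \<subseteq> I" "\<And>i. i \<in> I \<Longrightarrow> sets (M i) = sets borel"
  shows "(\<lambda>v. gram_schmidt v k) \<in> borel_measurable (PiM I M)"
    and "(\<lambda>v. gs_residue v k) \<in> borel_measurable (PiM I M)"
proof -
  have comp: "(\<lambda>v. v j) \<in> borel_measurable (PiM I M)" if "j \<in> I" for j
    using measurable_component_singleton[OF that, of M] measurable_cong_sets[OF refl assms(2)[OF that]] by blast
  have res: "(\<lambda>v. gs_residue v k) \<in> borel_measurable (PiM I M)"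
    if "\<And>j. j < k \<Longrightarrow> (\<lambda>v. gram_schmidt v j) \<in> borel_measurable (PiM I M)" "{..k} \<subseteq> I" for k
    unfolding gs_residue_def using that comp[of k]
    by (intro borel_measurable_diff borel_measurable_sum borel_measurable_scaleR borel_measurable_inner) auto
  have gs: "(\<lambda>v. gram_schmidt v k) \<in> borel_measurable (PiM I M)" if "{..k} \<subseteq> I" for k
    using that
  proof (induction k rule: less_induct)
    case (less k)
    have "{..j} \<subseteq> I" if "j < k" for j using less.prems that by force
    then have [measurable]: "(\<lambda>v. gs_residue v k) \<in> borel_measurable (PiM I M)"
      using less by (intro res) auto
    show ?case unfolding gram_schmidt_residue by measurable
  qed
  show "(\<lambda>v. gram_schmidt v k) \<in> borel_measurable (PiM I M)" using gs assms by blast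
  show "(\<lambda>v. gs_residue v k) \<in> borel_measurable (PiM I M)" using assms by (intro res gs) auto
qed

lemma continuous_on_det: "continuous_on S (\<lambda>A :: real ^ 'd ^ 'd. det A)"
  unfolding det_def by (intro continuous_intros linear_continuous_on bounded_linear_intros)

lemma vec_lambda_measurable:
  fixes f :: "'b \<Rightarrow> 'd::finite \<Rightarrow> 'a::euclidean_space"
  assumes "\<And>i. (\<lambda>x. f x i) \<in> borel_measurable M"
  shows "(\<lambda>x. \<chi> i. f x i) \<in> borel_measurable M"
proof (rule borel_measurable_euclidean_space[THEN iffD2], rule ballI)
  fix b :: "'a ^ 'd" assume "b \<in> Basis"
  then obtain i u where b: "b = axis i u" by (auto simp: Basis_vec_def)
  show "(\<lambda>x. (\<chi> i. f x i) \<bullet> b) \<in> borel_measurable M"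
    unfolding b inner_axis using assms by simp
qed

text \<open>Right invariance determines the law of \<open>A *v x\<close> for a fixed unit vector \<open>x\<close>; see \<open>haar_orbit\<close>.\<close>

definition haar_on_rotations :: "(real ^ 'd ^ 'd) measure \<Rightarrow> bool" where
  "haar_on_rotations P \<longleftrightarrow> prob_space P \<and> sets P = sets borel \<and> (AE A in P. rotation_matrix A) \<and>
     (\<forall>T. rotation_matrix T \<longrightarrow> distr P borel (\<lambda>A. A ** T) = P)"

lemma orthogonal_transformation_mult_vec:
  fixes T :: "real ^ 'd ^ 'd"
  shows "rotation_matrix T \<Longrightarrow> orthogonal_transformation ((*v) T)"
  by (simp add: rotation_matrix_def orthogonal_transformation_matrix)

lemma rotation_matrix_transpose: "rotation_matrix T \<Longrightarrow> rotation_matrix (transpose T)"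
  by (simp add: rotation_matrix_def)

text \<open>For fixed earlier vectors, the \<open>k\<close>-th residue vanishes only on the span of \<open>k\<close> vectors, a proper subspace.\<close>

lemma gs_residue_fun_upd_null:
  fixes x :: "nat \<Rightarrow> 'a::euclidean_space"
  assumes "k < DIM('a)"
  shows "{y. gs_residue (x(k := y)) k = 0} \<in> null_sets (completion lborel)"
proof -
  let ?S = "span (gram_schmidt x ` {..<k})"
  have eq: "gram_schmidt (x(k := y)) j = gram_schmidt x j" if "j < k" for j y
    by (rule gram_schmidt_cong) (use that in auto)
  have "{y. gs_residue (x(k := y)) k = 0} \<subseteq> ?S"
  proof clarify
    fix y assume "gs_residue (x(k := y)) k = 0"
    then have "y = (\<Sum>j<k. (y \<bullet> gram_schmidt x j) *\<^sub>R gram_schmidt x j)"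
      by (simp add: gs_residue_def eq)
    also have "\<dots> \<in> ?S" by (intro span_sum span_scale span_base) auto
    finally show "y \<in> ?S" .
  qed
  moreover have "dim ?S < DIM('a)"
    using dim_le_card'[of "gram_schmidt x ` {..<k}"] card_image_le[of "{..<k}" "gram_schmidt x"] assms
    by (simp add: dim_span)
  then have "negligible ?S" by (rule negligible_lowdim)
  ultimately have "negligible {y. gs_residue (x(k := y)) k = 0}" by (rule negligible_subset[rotated])
  then show ?thesis by (simp add: negligible_iff_null_sets)
qed

text \<open>Orthonormalise independent uniform points of the unit ball, use the results as rows, and multiply one row
by the determinant to correct the orientation. A rotation \<open>T\<close> applied to all points preserves their
joint law and multiplies the matrix by \<open>transpose T\<close> from the right.\<close>

lemma ex_haar_on_rotations: "\<exists>P :: (real ^ 'd ^ 'd) measure. haar_on_rotations P"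
proof -
  define d where "d = CARD('d)"
  have d: "0 < d" by (simp add: d_def)
  obtain idx :: "'d \<Rightarrow> nat" where idx: "bij_betw idx UNIV {..<d}"
    using ex_bij_betw_finite_nat[of "UNIV :: 'd set"] by (auto simp: d_def atLeast0LessThan)
  define B where "B = uniform_measure lborel (cball 0 1 :: (real ^ 'd) set)"
  note cb = emeasure_unit_cball[where 'a = "real ^ 'd"]
  have pB: "prob_space B" unfolding B_def using cb by (rule prob_space_uniform_measure)
  have sB[simp, measurable_cong]: "sets B = sets borel" by (simp add: B_def)
  have BT: "distr B B T = B" if T: "orthogonal_transformation T" for T
  proof (rule measure_eqI)
    have [measurable]: "T \<in> borel_measurable borel" by (rule orthogonal_transformation_borel[OF T])
    fix A assume "A \<in> sets (distr B B T)"
    then have [measurable]: "A \<in> sets borel" by simp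
    have m: "T -` A \<in> sets borel" using measurable_sets[OF \<open>T \<in> borel_measurable borel\<close> \<open>A \<in> sets borel\<close>] by simp
    have "emeasure lborel (cball 0 1 \<inter> T -` A) = emeasure (distr lborel borel T) (cball 0 1 \<inter> A)"
    proof -
      have "T -` (cball 0 1 \<inter> A) = cball 0 1 \<inter> T -` A" using T by (auto simp: orthogonal_transformation)
      then show ?thesis by (subst emeasure_distr) auto
    qed
    then have "emeasure lborel (cball 0 1 \<inter> T -` A) = emeasure lborel (cball 0 1 \<inter> A)"
      by (simp add: orthogonal_transformation_distr_lborel[OF T])
    then show "emeasure (distr B B T) A = emeasure B A"
      using m by (simp add: emeasure_distr B_def)
  qed simp
  define P0 where "P0 = PiM {..<d} (\<lambda>_. B)"
  interpret B: prob_space B by fact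
  interpret P0: product_prob_space "\<lambda>_. B" "{..<d}" by standard
  have pP0: "prob_space P0" unfolding P0_def by (rule P0.P.prob_space_axioms)
  have gsm[measurable]: "(\<lambda>v. gram_schmidt v k) \<in> borel_measurable P0"
    and rsm[measurable]: "(\<lambda>v. gs_residue v k) \<in> borel_measurable P0" if "k < d" for k
    unfolding P0_def using that by (intro gram_schmidt_measurable; auto)+
  (* Fubini, integrating over the k-th vector first. *)
  have nz: "AE v in P0. gs_residue v k \<noteq> 0" if k: "k < d" for k
  proof -
    let ?N = "{v \<in> space P0. gs_residue v k = 0}"
    have [measurable]: "?N \<in> sets P0" using rsm[OF k] by measurable
    have ins: "insert k ({..<d} - {k}) = {..<d}" using k by auto
    have "emeasure P0 ?N = (\<integral>\<^sup>+v. indicator ?N v \<partial>PiM (insert k ({..<d} - {k})) (\<lambda>_. B))"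
      unfolding ins P0_def[symmetric] by simp
    also have "\<dots> = (\<integral>\<^sup>+x. (\<integral>\<^sup>+y. indicator ?N (x(k := y)) \<partial>B) \<partial>PiM ({..<d} - {k}) (\<lambda>_. B))"
      by (rule P0.product_nn_integral_insert) (unfold ins, simp_all flip: P0_def)
    also have "\<dots> = (\<integral>\<^sup>+x. 0 \<partial>PiM ({..<d} - {k}) (\<lambda>_. B))"
    proof (rule nn_integral_cong)
      fix x :: "nat \<Rightarrow> real ^ 'd"
      have "AE y in lebesgue. y \<notin> {y. gs_residue (x(k := y)) k = 0}"
        using gs_residue_fun_upd_null[of k x] k by (intro AE_not_in) (simp add: d_def)
      then have "AE y in lborel. gs_residue (x(k := y)) k \<noteq> 0"
        by (simp add: AE_completion_iff)
      then have "AE y in B. gs_residue (x(k := y)) k \<noteq> 0"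
        unfolding B_def using cb by (intro AE_uniform_measureI) auto
      then have "(\<integral>\<^sup>+y. indicator ?N (x(k := y)) \<partial>B) = (\<integral>\<^sup>+y. 0 \<partial>B)"
        by (intro nn_integral_cong_AE) (auto simp: indicator_def)
      then show "(\<integral>\<^sup>+y. indicator ?N (x(k := y)) \<partial>B) = 0" by simp
    qed
    finally have "?N \<in> null_sets P0" by (simp add: null_sets_def)
    from AE_not_in[OF this] show ?thesis by (auto elim!: AE_mp)
  qed
  define C where "C v = (\<chi> i. gram_schmidt v (idx i)) " for v :: "nat \<Rightarrow> real ^ 'd"
  define C' where "C' v = (\<chi> i. (if idx i = 0 then det (C v) else 1) *\<^sub>R gram_schmidt v (idx i))"
    for v :: "nat \<Rightarrow> real ^ 'd"
  have idxd: "idx i < d" for i using idx by (auto simp: bij_betw_def)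
  have Cm: "C \<in> borel_measurable P0"
    unfolding C_def by (intro vec_lambda_measurable gsm idxd)
  have C'm[measurable]: "C' \<in> borel_measurable P0"
  proof -
    have "(\<lambda>v. det (C v)) \<in> borel_measurable P0"
      by (intro measurable_compose[OF Cm] borel_measurable_continuous_onI continuous_intros continuous_on_det)
    then show ?thesis unfolding C'_def
      by (intro vec_lambda_measurable borel_measurable_scaleR measurable_If gsm idxd) auto
  qed
  define P where "P = distr P0 borel C'"
  have pP: "prob_space P" unfolding P_def by (rule prob_space.prob_space_distr[OF pP0 C'm])
  have rot: "rotation_matrix (C' v)" if "\<And>k. k < d \<Longrightarrow> gs_residue v k \<noteq> 0" for v
  proof -
    have orth: "gram_schmidt v (idx i) \<bullet> gram_schmidt v (idx j) = (if i = j then 1 else 0)" for i j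
    proof -
      have "idx i = idx j \<longleftrightarrow> i = j" using idx by (auto simp: bij_betw_def inj_on_def)
      moreover have "gram_schmidt v (idx i) \<bullet> gram_schmidt v (idx j) = (if idx i = idx j then 1 else 0)"
        using gram_schmidt_orthogonal[of "d - 1" v] that idxd[of i] idxd[of j] d by auto
      ultimately show ?thesis by simp
    qed
    have "orthogonal_matrix (C v)"
      using orth by (auto simp: orthogonal_matrix_orthonormal_rows C_def row_def norm_eq_1 orthogonal_def)
    then have dt: "det (C v) = 1 \<or> det (C v) = -1" by (rule det_orthogonal_matrix)
    obtain i0 where i0: "idx i0 = 0" using idx d by (metis bij_betw_def imageE lessThan_iff)
    have C'r: "C' v = (\<chi> i. if i = i0 then det (C v) *s gram_schmidt v (idx i) else gram_schmidt v (idx i))"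
      using idx i0 by (auto simp: C'_def vec_eq_iff bij_betw_def inj_on_def scalar_mult_eq_scaleR)
    have "det (C' v) = det (C v) * det (C v)"
    proof -
      have "(\<chi> i. if i = i0 then gram_schmidt v (idx i) else gram_schmidt v (idx i)) = C v"
        by (simp add: C_def vec_eq_iff)
      then show ?thesis unfolding C'r det_row_mul by simp
    qed
    moreover have "orthogonal_matrix (C' v)"
    proof -
      define s where "s i = (if idx i = 0 then det (C v) else 1)" for i
      have s: "s i * s i = 1" for i using dt by (auto simp: s_def)
      have row: "row i (C' v) = s i *\<^sub>R gram_schmidt v (idx i)" for i
        unfolding C'_def s_def row_def by simp
      show ?thesis
        unfolding orthogonal_matrix_orthonormal_rows row norm_eq_1 orthogonal_def
        using s by (simp add: orth)
    qed
    ultimately show ?thesis using dt by (auto simp: rotation_matrix_def)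
  qed
  have "AE v in P0. \<forall>k\<in>{..<d}. gs_residue v k \<noteq> 0" using nz by (intro AE_finite_allI) auto
  then have "AE v in P0. rotation_matrix (C' v)" by eventually_elim (auto intro: rot)
  moreover have "{A :: real ^ 'd ^ 'd. rotation_matrix A} \<in> sets borel"
  proof -
    have "closed {A :: real ^ 'd ^ 'd. transpose A ** A = mat 1 \<and> det A = 1}"
      by (intro closed_Collect_conj closed_Collect_eq continuous_intros continuous_on_det)
        (auto simp: transpose_def matrix_matrix_mult_def intro!: continuous_intros)
    then show ?thesis by (auto simp: rotation_matrix_def orthogonal_matrix)
  qed
  ultimately have "AE A in P. rotation_matrix A" unfolding P_def by (subst AE_distr_iff) auto
  moreover have "distr P borel (\<lambda>A. A ** T) = P" if T: "rotation_matrix T" for T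
  proof -
    define T' where "T' = (*v) (transpose T)"
    have T': "orthogonal_transformation T'"
      unfolding T'_def using T by (intro orthogonal_transformation_mult_vec rotation_matrix_transpose)
    have [measurable]: "T' \<in> borel_measurable borel" by (rule orthogonal_transformation_borel[OF T'])
    have [measurable]: "(\<lambda>A. A ** T) \<in> borel_measurable borel"
      unfolding matrix_matrix_mult_def by (auto intro!: borel_measurable_continuous_onI continuous_intros)
    have eqv: "gram_schmidt (compose {..<d} T' v) k = T' (gram_schmidt v k)" if "k < d" for k v
    proof -
      have "gram_schmidt (compose {..<d} T' v) k = gram_schmidt (\<lambda>j. T' (v j)) k"
        by (rule gram_schmidt_cong) (use that in \<open>auto simp: compose_def\<close>)
      then show ?thesis by (simp add: gram_schmidt_equivariant[OF T'])
    qed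
    have rowT: "(T' w) $ j = (\<Sum>k\<in>UNIV. w $ k * T $ k $ j)" for w j
      by (simp add: T'_def matrix_vector_mult_def transpose_def mult.commute)
    have "C v ** T = C (compose {..<d} T' v)" for v
      by (simp add: C_def vec_eq_iff matrix_matrix_mult_def eqv idxd rowT)
    then have det: "det (C (compose {..<d} T' v)) = det (C v)" for v
      using T by (metis det_mul mult.right_neutral rotation_matrix_def)
    have "C' v ** T = C' (compose {..<d} T' v)" for v
      by (simp add: C'_def vec_eq_iff matrix_matrix_mult_def eqv idxd rowT det sum_distrib_left mult.assoc)
    moreover have cm: "compose {..<d} T' \<in> P0 \<rightarrow>\<^sub>M P0"
      unfolding P0_def compose_def by measurable
    ultimately have "distr P borel (\<lambda>A. A ** T) = distr (distr P0 P0 (compose {..<d} T')) borel C'"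
      unfolding P_def by (simp add: distr_distr comp_def)
    also have "distr P0 P0 (compose {..<d} T') = P0"
      unfolding P0_def by (subst distr_PiM_finite_prob_space') (auto simp: pB BT[OF T'])
    finally show ?thesis by (simp add: P_def)
  qed
  ultimately have "haar_on_rotations P"
    using pP unfolding haar_on_rotations_def by (auto simp: P_def)
  then show ?thesis by blast
qed

section \<open>The rotation invariant probability measure on the sphere\<close>

text \<open>The measure lives on the whole space and is concentrated on the unit sphere, which avoids restricted
sigma-algebras. Rotations act transitively on the sphere only from dimension 2 on.\<close>

locale sphere_haar = prob_space \<mu> for \<mu> :: "(real ^ 'd) measure" +
  assumes sets_borel[simp, measurable_cong]: "sets \<mu> = sets borel"
    and AE_sphere: "AE x in \<mu>. norm x = 1"
    and rotation_invariant: "rotation_matrix T \<Longrightarrow> distr \<mu> borel ((*v) T) = \<mu>"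
    and dim_ge_2: "2 \<le> CARD('d)"

lemma rotation_exists_matrix:
  fixes x y :: "real ^ 'd"
  assumes "2 \<le> CARD('d)" "norm x = norm y"
  shows "\<exists>T. rotation_matrix T \<and> T *v x = y"
proof -
  obtain f where f: "orthogonal_transformation f" "det (matrix f) = 1" "f x = y"
    using rotation_exists[OF assms] by blast
  then have "rotation_matrix (matrix f)" "matrix f *v x = y"
    by (auto simp: rotation_matrix_def orthogonal_transformation_matrix
        matrix_works orthogonal_transformation_linear)
  then show ?thesis by blast
qed

lemma matrix_vector_mul_measurable[measurable]:
  "((*v) T) \<in> borel_measurable borel" for T :: "real ^ 'd ^ 'd"
  by (intro borel_measurable_continuous_onI linear_continuous_on matrix_vector_mul_bounded_linear)

lemma matrix_vector_mul_measurable_left[measurable]: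
  "(\<lambda>A. A *v y) \<in> borel_measurable borel" for y :: "real ^ 'd"
  unfolding matrix_vector_mult_def by (auto intro!: borel_measurable_continuous_onI continuous_intros)

lemma matrix_vector_mul_measurable2[measurable]:
  "(\<lambda>(A :: real ^ 'd ^ 'd, x). A *v x) \<in> borel_measurable (borel \<Otimes>\<^sub>M borel)"
proof -
  have "continuous_on UNIV (\<lambda>p :: (real ^ 'd ^ 'd) \<times> (real ^ 'd). fst p *v snd p)"
    unfolding matrix_vector_mult_def by (auto intro!: continuous_intros)
  then show ?thesis
    by (auto simp: borel_prod split_beta' intro!: borel_measurable_continuous_onI)
qed

context sphere_haar
begin

lemma space_UNIV[simp]: "space \<mu> = UNIV"
  using sets_eq_imp_space_eq[OF sets_borel] by simp

lemma emeasure_rotation_vimage: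
  assumes "rotation_matrix T" "E \<in> sets borel"
  shows "emeasure \<mu> ((*v) T -` E) = emeasure \<mu> E"
  by (subst (2) rotation_invariant[OF assms(1), symmetric]) (simp add: emeasure_distr assms)

text \<open>Right invariance of \<open>P\<close> and transitivity make the left-hand side independent of \<open>x\<close>; so it equals its
\<open>\<mu>\<close>-average, and after exchanging the integrals the invariance of \<open>\<mu>\<close> under each single rotation applies.\<close>

lemma haar_orbit:
  assumes P: "haar_on_rotations P" and E[measurable]: "E \<in> sets borel" and x: "norm x = 1"
  shows "emeasure P {A. A *v x \<in> E} = emeasure \<mu> E"
proof -
  interpret P: prob_space P using P by (simp add: haar_on_rotations_def)
  have sP[simp, measurable_cong]: "sets P = sets borel" using P by (simp add: haar_on_rotations_def)
  have spP[simp]: "space P = UNIV" using sets_eq_imp_space_eq[OF sP] by simp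
  interpret P\<mu>: pair_sigma_finite P \<mu> ..
  have const: "emeasure P {A. A *v y \<in> E} = emeasure P {A. A *v x \<in> E}" if y: "norm y = 1" for y
  proof -
    obtain T where T: "rotation_matrix T" "T *v x = y"
      using rotation_exists_matrix[OF dim_ge_2, of x y] x y by auto
    have [measurable]: "(\<lambda>A. A ** T) \<in> borel_measurable borel"
      unfolding matrix_matrix_mult_def by (auto intro!: borel_measurable_continuous_onI continuous_intros)
    have "emeasure P {A. A *v x \<in> E} = emeasure (distr P borel (\<lambda>A. A ** T)) {A. A *v x \<in> E}"
      using P T by (simp add: haar_on_rotations_def)
    also have "\<dots> = emeasure P {A. A *v y \<in> E}"
      by (subst emeasure_distr) (auto simp: T(2) simp flip: matrix_vector_mul_assoc)
    finally show ?thesis ..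
  qed
  have "emeasure P {A. A *v x \<in> E} = (\<integral>\<^sup>+y. emeasure P {A. A *v x \<in> E} \<partial>\<mu>)"
    by (simp add: emeasure_space_1[simplified])
  also have "\<dots> = (\<integral>\<^sup>+y. emeasure P {A. A *v y \<in> E} \<partial>\<mu>)"
    using AE_sphere by (intro nn_integral_cong_AE) (auto simp: const)
  also have "\<dots> = (\<integral>\<^sup>+y. (\<integral>\<^sup>+A. indicator E (A *v y) \<partial>P) \<partial>\<mu>)"
    by (intro nn_integral_cong)
      (simp add: indicator_def of_bool_def flip: nn_integral_indicator)
  also have "\<dots> = (\<integral>\<^sup>+A. (\<integral>\<^sup>+y. indicator E (A *v y) \<partial>\<mu>) \<partial>P)"
    by (rule P\<mu>.Fubini'[of "\<lambda>A y. indicator E (A *v y)"]) measurable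
  also have "\<dots> = (\<integral>\<^sup>+A. emeasure \<mu> E \<partial>P)"
  proof (rule nn_integral_cong_AE)
    have "AE A in P. rotation_matrix A" using P by (simp add: haar_on_rotations_def)
    then show "AE A in P. (\<integral>\<^sup>+y. indicator E (A *v y) \<partial>\<mu>) = emeasure \<mu> E"
    proof eventually_elim
      case (elim A)
      have "(\<integral>\<^sup>+y. indicator E (A *v y) \<partial>\<mu>) = (\<integral>\<^sup>+y. indicator ((*v) A -` E) y \<partial>\<mu>)"
        by (simp add: indicator_def)
      also have "\<dots> = emeasure \<mu> ((*v) A -` E)"
        using measurable_sets[OF matrix_vector_mul_measurable E, of A] by (intro nn_integral_indicator) simp
      finally show ?case using emeasure_rotation_vimage[OF elim E] by simp
    qed
  qed
  also have "\<dots> = emeasure \<mu> E" by (simp add: P.emeasure_space_1[simplified])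
  finally show ?thesis .
qed

text \<open>Polar decomposition in a weak form: under a rotation invariant density the direction of a point is
\<open>\<mu>\<close>-distributed. In particular \<open>\<mu>\<close> is unique, and it can be computed from Lebesgue measure of cones.\<close>

lemma radial_integral:
  assumes h[measurable]: "h \<in> borel_measurable borel"
    and inv: "\<And>T x. rotation_matrix T \<Longrightarrow> h (T *v x) = h x"
    and E[measurable]: "E \<in> sets borel"
  shows "(\<integral>\<^sup>+x. h x * indicator E (x /\<^sub>R norm x) * indicator (- {0}) x \<partial>lborel) = emeasure \<mu> E * (\<integral>\<^sup>+x. h x \<partial>lborel)"
proof -
  obtain P :: "(real ^ 'd ^ 'd) measure" where P: "haar_on_rotations P"
    using ex_haar_on_rotations by blast
  interpret P: prob_space P using P by (simp add: haar_on_rotations_def)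
  have sP[simp, measurable_cong]: "sets P = sets borel" using P by (simp add: haar_on_rotations_def)
  have spP[simp]: "space P = UNIV" using sets_eq_imp_space_eq[OF sP] by simp
  interpret Pl: pair_sigma_finite P "lborel :: (real ^ 'd) measure" ..
  let ?f = "\<lambda>x. h x * indicator E (x /\<^sub>R norm x) * indicator (- {0}) x"
  let ?g = "\<lambda>A x. h x * indicator E (A *v (x /\<^sub>R norm x)) * indicator (- {0}) x"
  have [measurable]: "(\<lambda>(A, x). ?g A x) \<in> borel_measurable (P \<Otimes>\<^sub>M lborel)" by measurable
  have "(\<integral>\<^sup>+x. ?f x \<partial>lborel) = (\<integral>\<^sup>+A. (\<integral>\<^sup>+x. ?f x \<partial>lborel) \<partial>P)"
    by (simp add: P.emeasure_space_1[simplified])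
  also have "\<dots> = (\<integral>\<^sup>+A. (\<integral>\<^sup>+x. ?g A x \<partial>lborel) \<partial>P)"
  proof (rule nn_integral_cong_AE)
    have "AE A in P. rotation_matrix A" using P by (simp add: haar_on_rotations_def)
    then show "AE A in P. (\<integral>\<^sup>+x. ?f x \<partial>lborel) = (\<integral>\<^sup>+x. ?g A x \<partial>lborel)"
    proof eventually_elim
      case (elim A)
      have ot: "orthogonal_transformation ((*v) A)" using elim by (rule orthogonal_transformation_mult_vec)
      then have n: "norm (A *v x) = norm x" for x by (rule orthogonal_transformation_norm)
      then have z: "A *v x = 0 \<longleftrightarrow> x = 0" for x by (metis norm_eq_zero)
      have "?f (A *v x) = ?g A x" for x
        by (simp add: n z inv[OF elim] matrix_vector_mult_scaleR indicator_def)
      then show ?case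
        using nn_integral_orthogonal_transformation[OF ot, of ?f] by simp
    qed
  qed
  also have "\<dots> = (\<integral>\<^sup>+x. (\<integral>\<^sup>+A. ?g A x \<partial>P) \<partial>lborel)"
    by (rule Pl.Fubini'[symmetric]) measurable
  also have "\<dots> = (\<integral>\<^sup>+x. h x * emeasure \<mu> E * indicator (- {0}) x \<partial>lborel)"
  proof (rule nn_integral_cong)
    fix x :: "real ^ 'd"
    show "(\<integral>\<^sup>+A. ?g A x \<partial>P) = h x * emeasure \<mu> E * indicator (- {0}) x"
    proof (cases "x = 0")
      case False
      have "(\<integral>\<^sup>+A. ?g A x \<partial>P) = h x * (\<integral>\<^sup>+A. indicator {A. A *v (x /\<^sub>R norm x) \<in> E} A \<partial>P)"
        using False by (simp add: nn_integral_cmult indicator_def)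
      also have "(\<integral>\<^sup>+A. indicator {A. A *v (x /\<^sub>R norm x) \<in> E} A \<partial>P) = emeasure \<mu> E"
        using haar_orbit[OF P E, of "x /\<^sub>R norm x"] False by simp
      finally show ?thesis using False by simp
    qed simp
  qed
  also have "\<dots> = (\<integral>\<^sup>+x. emeasure \<mu> E * h x \<partial>lborel)"
  proof (rule nn_integral_cong_AE)
    show "AE x in lborel. h x * emeasure \<mu> E * indicator (- {0}) x = emeasure \<mu> E * h x"
      using AE_lborel_singleton[of "0 :: real ^ 'd"] by eventually_elim (simp add: mult.commute)
  qed
  finally show ?thesis by (simp add: nn_integral_cmult)
qed

text \<open>The average over all rotations of the right-hand side equals \<open>prob U * prob L\<close>.\<close>

lemma exists_rotation_intersection:
  assumes U[measurable]: "U \<in> sets borel" and L[measurable]: "L \<in> sets borel"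
  shows "\<exists>T. rotation_matrix T \<and> prob U * prob L \<le> prob (U \<inter> (*v) T -` L)"
proof (rule ccontr)
  assume "\<not> ?thesis"
  then have less: "prob (U \<inter> (*v) T -` L) < prob U * prob L" if "rotation_matrix T" for T
    using that by (auto simp: not_le)
  obtain P :: "(real ^ 'd ^ 'd) measure" where P: "haar_on_rotations P"
    using ex_haar_on_rotations by blast
  interpret P: prob_space P using P by (simp add: haar_on_rotations_def)
  have sP[simp, measurable_cong]: "sets P = sets borel" using P by (simp add: haar_on_rotations_def)
  have spP[simp]: "space P = UNIV" using sets_eq_imp_space_eq[OF sP] by simp
  interpret P\<mu>: pair_sigma_finite P \<mu> ..
  have m[measurable]: "U \<inter> (*v) A -` L \<in> sets borel" for A :: "real ^ 'd ^ 'd"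
    using measurable_sets[OF matrix_vector_mul_measurable L, of A] by simp
  let ?g = "\<lambda>A x. indicator U x * indicator L (A *v x) :: ennreal"
  have gA: "(\<integral>\<^sup>+x. ?g A x \<partial>\<mu>) = emeasure \<mu> (U \<inter> (*v) A -` L)" for A
  proof -
    have "?g A = indicator (U \<inter> (*v) A -` L)" by (auto simp: indicator_def)
    then show ?thesis by simp
  qed
  have "(\<integral>\<^sup>+A. (\<integral>\<^sup>+x. ?g A x \<partial>\<mu>) \<partial>P) = (\<integral>\<^sup>+x. (\<integral>\<^sup>+A. ?g A x \<partial>P) \<partial>\<mu>)"
    by (rule P\<mu>.Fubini'[symmetric]) measurable
  also have "\<dots> = (\<integral>\<^sup>+x. indicator U x * emeasure \<mu> L \<partial>\<mu>)"
  proof (rule nn_integral_cong_AE)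
    show "AE x in \<mu>. (\<integral>\<^sup>+A. ?g A x \<partial>P) = indicator U x * emeasure \<mu> L"
      using AE_sphere
    proof eventually_elim
      case (elim x)
      have "(\<integral>\<^sup>+A. ?g A x \<partial>P) = indicator U x * (\<integral>\<^sup>+A. indicator {A. A *v x \<in> L} A \<partial>P)"
        by (simp add: nn_integral_cmult indicator_def)
      also have "(\<integral>\<^sup>+A. indicator {A. A *v x \<in> L} A \<partial>P) = emeasure \<mu> L"
        using haar_orbit[OF P L elim] by simp
      finally show ?case .
    qed
  qed
  also have "\<dots> = emeasure \<mu> U * emeasure \<mu> L" by (simp add: nn_integral_multc)
  finally have eq: "(\<integral>\<^sup>+A. ennreal (prob (U \<inter> (*v) A -` L)) \<partial>P) = ennreal (prob U * prob L)"
    by (simp add: gA emeasure_eq_measure ennreal_mult)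
  have [measurable]: "(\<lambda>A. \<integral>\<^sup>+x. ?g A x \<partial>\<mu>) \<in> borel_measurable P" by measurable
  have int: "(\<lambda>A. prob (U \<inter> (*v) A -` L)) \<in> borel_measurable P"
  proof -
    have "(\<lambda>A. prob (U \<inter> (*v) A -` L)) = (\<lambda>A. enn2real (\<integral>\<^sup>+x. ?g A x \<partial>\<mu>))"
      by (simp add: gA measure_def)
    then show ?thesis by simp
  qed
  have "integrable P (\<lambda>A. prob (U \<inter> (*v) A -` L))"
    by (rule P.integrable_const_bound[where B = 1]) (auto intro: int)
  moreover from this have "(\<integral>A. prob (U \<inter> (*v) A -` L) \<partial>P) = prob U * prob L"
    using eq by (subst (asm) nn_integral_eq_integral) (auto simp: integral_nonneg_AE)
  moreover have "(\<integral>A. prob (U \<inter> (*v) A -` L) \<partial>P) < (\<integral>A. prob U * prob L \<partial>P)"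
    using P less by (intro P.integral_less_AE_space calculation(1))
      (auto simp: haar_on_rotations_def P.emeasure_space_1[simplified] elim!: AE_mp)
  ultimately show False by (simp add: P.prob_space[simplified])
qed

end

section \<open>Random ellipses and Crofton monotonicity\<close>

text \<open>A parametrised great circle, up to the linear map with columns \<open>x\<close> and \<open>z\<close>; membership in a cone depends only
on the direction of its points.\<close>

definition ellipse :: "'a::real_vector \<Rightarrow> 'a \<Rightarrow> real \<Rightarrow> 'a" where
  "ellipse x z t = cos t *\<^sub>R x + sin t *\<^sub>R z"

text \<open>Passing to the conjugate point and direction at time \<open>s\<close> shifts the parameter by \<open>s\<close>.\<close>

lemma ellipse_add:
  "ellipse (ellipse x z s) (cos s *\<^sub>R z - sin s *\<^sub>R x) t = ellipse x z (s + t)"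
  by (simp add: ellipse_def algebra_simps cos_add sin_add)

lemma ellipse_pi: "ellipse x z (t + pi) = - ellipse x z t"
  by (simp add: ellipse_def)

lemma ellipse_2pi: "ellipse x z (t + 2 * pi) = ellipse x z t"
  by (simp add: ellipse_def)

text \<open>The vector identity behind convexity along arcs: a point of an arc shorter than \<open>\<pi>\<close> is a nonnegative combination
of the end points.\<close>

lemma ellipse_between:
  "sin \<theta> *\<^sub>R ellipse x z (s + \<alpha>) = sin (\<theta> - \<alpha>) *\<^sub>R ellipse x z s + sin \<alpha> *\<^sub>R ellipse x z (s + \<theta>)"
proof -
  have 1: "sin \<theta> * cos (s + \<alpha>) = sin (\<theta> - \<alpha>) * cos s + sin \<alpha> * cos (s + \<theta>)"
    by (simp add: cos_add sin_diff algebra_simps)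
  have 2: "sin \<theta> * sin (s + \<alpha>) = sin (\<theta> - \<alpha>) * sin s + sin \<alpha> * sin (s + \<theta>)"
    by (simp add: sin_add sin_diff algebra_simps)
  show ?thesis unfolding ellipse_def scaleR_add_right scaleR_scaleR 1 2
    by (simp add: algebra_simps)
qed

text \<open>Unlike \<^const>\<open>convex_cone\<close>, a blunt cone need not contain the origin, and the ones below do not.\<close>

definition blunt_convex_cone :: "'a::real_vector set \<Rightarrow> bool" where
  "blunt_convex_cone S \<longleftrightarrow> (\<forall>x\<in>S. \<forall>a>0. a *\<^sub>R x \<in> S) \<and> (\<forall>x\<in>S. \<forall>y\<in>S. x + y \<in> S)"

lemma ellipse_between_in_cone:
  assumes S: "blunt_convex_cone S" and "0 < \<alpha>" "\<alpha> \<le> \<theta>" "\<theta> < pi"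
    and "ellipse x z s \<in> S" "ellipse x z (s + \<theta>) \<in> S"
  shows "ellipse x z (s + \<alpha>) \<in> S"
proof (cases "\<alpha> = \<theta>")
  case False
  have pos: "0 < sin \<theta>" "0 < sin \<alpha>" "0 < sin (\<theta> - \<alpha>)"
    using assms False by (auto intro!: sin_gt_zero)
  have "ellipse x z (s + \<alpha>) = (sin (\<theta> - \<alpha>) / sin \<theta>) *\<^sub>R ellipse x z s + (sin \<alpha> / sin \<theta>) *\<^sub>R ellipse x z (s + \<theta>)"
  proof -
    have "ellipse x z (s + \<alpha>) = (1 / sin \<theta>) *\<^sub>R (sin \<theta> *\<^sub>R ellipse x z (s + \<alpha>))" using pos by simp
    then show ?thesis unfolding ellipse_between[of \<theta> x z s \<alpha>] by (simp add: scaleR_add_right)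
  qed
  then show ?thesis using S assms pos by (auto simp: blunt_convex_cone_def)
qed (use assms in simp)

text \<open>Let \<open>\<theta>\<close> be the angle from vertex \<open>j\<close> to vertex \<open>k\<close>. If \<open>\<theta> < \<pi>\<close>, convexity puts vertex \<open>j + 1\<close> into \<open>S\<close>;
if \<open>\<theta> > \<pi>\<close>, the complementary arc from \<open>k\<close> to \<open>j\<close> puts vertex \<open>k + 1\<close> into \<open>S\<close>; and \<open>\<theta> = \<pi>\<close> is
excluded since \<open>S\<close> contains no two opposite vectors.\<close>

lemma exit_unique:
  assumes S: "blunt_convex_cone S" and H: "\<And>x. x \<in> S \<Longrightarrow> 0 < c \<bullet> x"
    and \<alpha>: "\<alpha> = pi / real m" "2 \<le> m" and jk: "j < k" "k < 2 * m"
    and j: "ellipse x z (real j * \<alpha>) \<in> S" "ellipse x z (real (Suc j) * \<alpha>) \<notin> S"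
    and k: "ellipse x z (real k * \<alpha>) \<in> S" "ellipse x z (real (Suc k) * \<alpha>) \<notin> S"
  shows False
proof -
  define \<theta> where "\<theta> = real (k - j) * \<alpha>"
  have a0: "0 < \<alpha>" using \<alpha> by simp
  have m\<alpha>: "real m * \<alpha> = pi" using \<alpha> by simp
  have tj: "real j * \<alpha> + \<theta> = real k * \<alpha>" using jk by (simp add: \<theta>_def of_nat_diff algebra_simps)
  have t1: "\<alpha> \<le> \<theta>" using jk a0 by (simp add: \<theta>_def)
  have t2: "\<theta> + \<alpha> \<le> 2 * pi"
  proof -
    have "(real (k - j) + 1) * \<alpha> \<le> real (2 * m) * \<alpha>"
      using jk a0 by (intro mult_right_mono) auto
    then show ?thesis using m\<alpha> by (simp add: \<theta>_def algebra_simps)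
  qed
  consider "\<theta> < pi" | "\<theta> = pi" | "pi < \<theta>" by linarith
  then show False
  proof cases
    case 1
    have "ellipse x z (real j * \<alpha> + \<alpha>) \<in> S"
      by (rule ellipse_between_in_cone[OF S a0 t1 1]) (use j k tj in auto)
    then show False using j by (simp add: algebra_simps)
  next
    case 2
    then have "ellipse x z (real k * \<alpha>) = - ellipse x z (real j * \<alpha>)"
      using ellipse_pi[of x z "real j * \<alpha>"] tj by simp
    then show False using H[OF j(1)] H[OF k(1)] by simp
  next
    case 3
    have "real k * \<alpha> + (2 * pi - \<theta>) = real j * \<alpha> + 2 * pi" using tj by simp
    then have "ellipse x z (real k * \<alpha> + (2 * pi - \<theta>)) \<in> S"
      using j by (simp only: ellipse_2pi)
    then have "ellipse x z (real k * \<alpha> + \<alpha>) \<in> S"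
      using t2 3 k by (intro ellipse_between_in_cone[OF S a0, of "2 * pi - \<theta>"]) auto
    then show False using k by (simp add: algebra_simps)
  qed
qed

text \<open>Otherwise the vertices would stay in \<open>S\<close> once they are there, and by periodicity all of them, including two
opposite ones, would lie in \<open>S\<close>.\<close>

lemma exit_exists:
  assumes H: "\<And>x. x \<in> S \<Longrightarrow> 0 < c \<bullet> x"
    and \<alpha>: "\<alpha> = pi / real m" "2 \<le> m" and j: "j < 2 * m" "ellipse x z (real j * \<alpha>) \<in> S"
  shows "\<exists>k<2*m. ellipse x z (real k * \<alpha>) \<in> S \<and> ellipse x z (real (Suc k) * \<alpha>) \<notin> S"
proof (rule ccontr)
  assume "\<not> ?thesis"
  then have step: "ellipse x z (real (Suc k) * \<alpha>) \<in> S" if "k < 2 * m" "ellipse x z (real k * \<alpha>) \<in> S" for k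
    using that by blast
  have m\<alpha>: "real m * \<alpha> = pi" using \<alpha> by simp
  have up: "k \<le> 2 * m \<longrightarrow> ellipse x z (real k * \<alpha>) \<in> S" if "j \<le> k" for k
    using that by (induction k rule: dec_induct) (use j step in auto)
  then have "ellipse x z (real (2 * m) * \<alpha>) \<in> S" using up[of "2 * m"] j by simp
  then have 0: "ellipse x z (real 0 * \<alpha>) \<in> S"
    using ellipse_2pi[of x z 0] m\<alpha> by (simp add: mult.assoc)
  have "k \<le> 2 * m \<longrightarrow> ellipse x z (real k * \<alpha>) \<in> S" for k
    by (induction k) (use 0 step in auto)
  then have "ellipse x z (real m * \<alpha>) \<in> S" by simp
  then have "ellipse x z pi \<in> S" by (simp only: m\<alpha>)
  moreover have "ellipse x z pi = - ellipse x z 0" using ellipse_pi[of x z 0] by simp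
  ultimately show False using H[of "ellipse x z pi"] H[of "ellipse x z 0"] 0 by simp
qed

text \<open>Up to normalisation this is the probability that the ellipse of a random pair starts in \<open>S\<close> and is outside \<open>S\<close>
at time \<open>\<alpha>\<close>. The unit ball of the product space is invariant both under isometries acting on
the two vectors and under the shift of the parameter.\<close>

definition exit_weight :: "'a::euclidean_space set \<Rightarrow> real \<Rightarrow> ennreal" where
  "exit_weight S \<alpha> = (\<integral>\<^sup>+p. indicator (cball 0 1) p *
     (indicator S (fst p) * indicator (- S) (ellipse (fst p) (snd p) \<alpha>)) \<partial>lborel)"

text \<open>The rotation by \<open>s\<close> of the plane of coefficients, which carries out the shift of \<open>ellipse_add\<close> on the pair.\<close>

lemma orthogonal_transformation_mix:
  "orthogonal_transformation (\<lambda>p :: 'a::euclidean_space \<times> 'a.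
     (ellipse (fst p) (snd p) s, cos s *\<^sub>R snd p - sin s *\<^sub>R fst p))"
proof -
  have lin: "linear (\<lambda>p :: 'a \<times> 'a. (ellipse (fst p) (snd p) s, cos s *\<^sub>R snd p - sin s *\<^sub>R fst p))"
    by (rule linearI) (auto simp: ellipse_def algebra_simps)
  have "(norm (a *\<^sub>R x + b *\<^sub>R z))\<^sup>2 + (norm (a *\<^sub>R z - b *\<^sub>R x))\<^sup>2 = (a\<^sup>2 + b\<^sup>2) * (x \<bullet> x) + (a\<^sup>2 + b\<^sup>2) * (z \<bullet> z)" for a b and x z :: 'a
    unfolding power2_norm_eq_inner
    by (simp add: inner_add_left inner_add_right inner_diff_left inner_diff_right inner_commute power2_eq_square algebra_simps)
  then have "(norm (ellipse x z s))\<^sup>2 + (norm (cos s *\<^sub>R z - sin s *\<^sub>R x))\<^sup>2 = (norm x)\<^sup>2 + (norm z)\<^sup>2" for x z :: 'a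
    by (simp add: power2_norm_eq_inner ellipse_def)
  then show ?thesis using lin by (auto simp: orthogonal_transformation norm_prod_def)
qed

lemma ellipse_measurable[measurable (raw)]:
  assumes "f \<in> borel_measurable M" "g \<in> borel_measurable M"
  shows "(\<lambda>x. ellipse (f x :: 'a::euclidean_space) (g x) t) \<in> borel_measurable M"
  using assms unfolding ellipse_def by measurable

lemma prod_fst_snd_measurable[measurable]:
  "fst \<in> borel_measurable (borel :: ('a::euclidean_space \<times> 'a) measure)"
  "snd \<in> borel_measurable (borel :: ('a::euclidean_space \<times> 'a) measure)"
  by (auto intro!: borel_measurable_continuous_onI continuous_intros)

lemma cball_sets_borel[measurable]: "cball a r \<in> sets borel"
  by simp

lemma exit_weight_shift:
  assumes [measurable]: "S \<in> sets borel"
  shows "(\<integral>\<^sup>+p. indicator (cball 0 1) p *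
     (indicator S (ellipse (fst p) (snd p) s) * indicator (- S) (ellipse (fst p) (snd p) (s + \<alpha>))) \<partial>lborel)
    = exit_weight (S :: 'a::euclidean_space set) \<alpha>"
proof -
  let ?T = "\<lambda>p :: 'a \<times> 'a. (ellipse (fst p) (snd p) s, cos s *\<^sub>R snd p - sin s *\<^sub>R fst p)"
  have n: "norm (?T p) = norm p" for p
    using orthogonal_transformation_norm[OF orthogonal_transformation_mix[where s = s]] by blast
  have ind: "indicator (cball 0 1) (?T p) = (indicator (cball 0 1) p :: ennreal)" for p
    using n[of p] by (simp add: indicator_def)
  let ?f = "\<lambda>p. indicator (cball 0 1) p * (indicator S (fst p) * indicator (- S) (ellipse (fst p) (snd p) \<alpha>)) :: ennreal"
  have "(\<integral>\<^sup>+p. ?f (?T p) \<partial>lborel) = (\<integral>\<^sup>+p. ?f p \<partial>lborel)"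
    by (rule nn_integral_orthogonal_transformation[OF orthogonal_transformation_mix]) measurable
  then show ?thesis
    unfolding exit_weight_def by (simp only: ind fst_conv snd_conv ellipse_add)
qed

text \<open>By shift invariance, \<open>2 * m\<close> times the exit weight is the mean number of steps on which the polygon leaves
the set. For \<open>S\<close> this number is at most 1, and it is 0 if the polygon misses \<open>S\<close>; for \<open>S'\<close> it is at least 1 if the
polygon meets \<open>S'\<close>.\<close>

lemma exit_weight_mono:
  fixes S S' :: "'a::euclidean_space set"
  assumes S: "blunt_convex_cone S" "S \<subseteq> S'" and H: "\<And>x. x \<in> S' \<Longrightarrow> 0 < c \<bullet> x"
    and m: "2 \<le> m" and [measurable]: "S \<in> sets borel" "S' \<in> sets borel"
  shows "exit_weight S (pi / real m) \<le> exit_weight S' (pi / real m)"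
proof -
  define \<alpha> where "\<alpha> = pi / real m"
  let ?e = "\<lambda>S j p. indicator S (ellipse (fst p) (snd p) (real j * \<alpha>)) *
    indicator (- S) (ellipse (fst p) (snd p) (real (Suc j) * \<alpha>)) :: ennreal"
  let ?J = "{..<2 * m}"
  have total: "(\<integral>\<^sup>+p. indicator (cball 0 1) p * (\<Sum>j\<in>?J. ?e S j p) \<partial>lborel) = of_nat (2 * m) * exit_weight S \<alpha>"
    if [measurable]: "S \<in> sets borel" for S :: "'a set"
  proof -
    have "(\<integral>\<^sup>+p. indicator (cball 0 1) p * (\<Sum>j\<in>?J. ?e S j p) \<partial>lborel)
      = (\<Sum>j\<in>?J. \<integral>\<^sup>+p. indicator (cball 0 1) p * ?e S j p \<partial>lborel)"
      unfolding sum_distrib_left by (rule nn_integral_sum) measurable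
    also have "\<dots> = (\<Sum>j\<in>?J. exit_weight S \<alpha>)"
      using exit_weight_shift[of S "real j * \<alpha>" \<alpha> for j] by (intro sum.cong) (auto simp: algebra_simps)
    finally show ?thesis by simp
  qed
  have "(\<Sum>j\<in>?J. ?e S j p) \<le> (\<Sum>j\<in>?J. ?e S' j p)" for p
  proof (cases "\<exists>j<2*m. ?e S j p \<noteq> 0")
    case True
    then obtain j where j: "j < 2 * m" "?e S j p \<noteq> 0" by blast
    then have ej: "ellipse (fst p) (snd p) (real j * \<alpha>) \<in> S" "ellipse (fst p) (snd p) (real (Suc j) * \<alpha>) \<notin> S"
      by (auto simp: indicator_def split: if_splits)
    have "?e S k p = 0" if "k < 2 * m" "k \<noteq> j" for k
    proof (rule ccontr)
      assume "?e S k p \<noteq> 0"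
      then have ek: "ellipse (fst p) (snd p) (real k * \<alpha>) \<in> S" "ellipse (fst p) (snd p) (real (Suc k) * \<alpha>) \<notin> S"
        by (auto simp: indicator_def split: if_splits)
      have H': "0 < c \<bullet> x" if "x \<in> S" for x using H S that by blast
      show False
        using exit_unique[OF S(1) H' \<alpha>_def m, of j k] exit_unique[OF S(1) H' \<alpha>_def m, of k j] ej ek j that
        by (metis linorder_neqE_nat)
    qed
    then have "(\<Sum>j\<in>?J. ?e S j p) = (\<Sum>i\<in>?J. if i = j then ?e S j p else 0)"
      by (intro sum.cong) auto
    also have "\<dots> = ?e S j p" using j by simp
    also have "\<dots> \<le> 1" by (simp add: indicator_def)
    also have "1 \<le> (\<Sum>j\<in>?J. ?e S' j p)"
    proof -
      obtain k where k: "k < 2 * m" "ellipse (fst p) (snd p) (real k * \<alpha>) \<in> S'"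
          "ellipse (fst p) (snd p) (real (Suc k) * \<alpha>) \<notin> S'"
        using exit_exists[OF H \<alpha>_def m j(1)] ej S(2) by blast
      then have "1 = ?e S' k p" by simp
      also have "\<dots> \<le> (\<Sum>j\<in>?J. ?e S' j p)" using k by (intro member_le_sum) auto
      finally show ?thesis .
    qed
    finally show ?thesis .
  next
    case False
    then have "(\<Sum>j\<in>?J. ?e S j p) = 0" by (intro sum.neutral) auto
    then show ?thesis by simp
  qed
  then have "of_nat (2 * m) * exit_weight S \<alpha> \<le> of_nat (2 * m) * exit_weight S' \<alpha>"
    by (subst (1 2) total[symmetric]) (auto intro!: nn_integral_mono mult_left_mono)
  then show ?thesis
    using m by (subst (asm) ennreal_mult_le_mult_iff) (auto simp: \<alpha>_def ennreal_mult_eq_top_iff)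
qed

text \<open>Layer-cake formula for one step: the levels \<open>s\<close> in \<open>(0, \<delta>)\<close> crossed downwards by a jump from \<open>a\<close> to \<open>b\<close>.\<close>

lemma nn_integral_levels:
  fixes a b \<delta> :: real
  shows "(\<integral>\<^sup>+s. indicator {0<..<\<delta>} s * (indicator {..<a} s * indicator {b..} s) \<partial>lborel) = ennreal (min \<delta> a - max 0 b)"
proof -
  have "(\<integral>\<^sup>+s. indicator {0<..<\<delta>} s * (indicator {..<a} s * indicator {b..} s) \<partial>lborel) =
    (\<integral>\<^sup>+s. indicator {max 0 b..<min \<delta> a} s \<partial>lborel)"
  proof (rule nn_integral_cong_AE)
    show "AE s in lborel. indicator {0<..<\<delta>} s * (indicator {..<a} s * indicator {b..} s) = (indicator {max 0 b..<min \<delta> a} s :: ennreal)"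
      using AE_lborel_singleton[of "0 :: real"]
      by eventually_elim (auto simp: indicator_def)
  qed
  also have "\<dots> = ennreal (min \<delta> a - max 0 b)"
    by (cases "max 0 b \<le> min \<delta> a") (auto simp: ennreal_neg)
  finally show ?thesis .
qed

text \<open>Up to normalisation, the expected decrease of \<open>F\<close>, counted between the levels \<open>0\<close> and \<open>\<delta>\<close>, over a step of length \<open>\<alpha>\<close>
along a random ellipse.\<close>

definition mean_drop :: "('a::euclidean_space \<Rightarrow> real) \<Rightarrow> real \<Rightarrow> real \<Rightarrow> ennreal" where
  "mean_drop F \<delta> \<alpha> = (\<integral>\<^sup>+p. indicator (cball 0 1) p *
     ennreal (min \<delta> (F (fst p)) - max 0 (F (ellipse (fst p) (snd p) \<alpha>))) \<partial>lborel)"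

text \<open>Integrates \<open>exit_weight_mono\<close> over the super-level sets of \<open>F\<close> and \<open>G\<close> for the levels in \<open>(0, \<delta>)\<close>.\<close>

lemma exit_depth_mono:
  fixes F G :: "'a::euclidean_space \<Rightarrow> real"
  assumes [measurable]: "F \<in> borel_measurable borel" "G \<in> borel_measurable borel"
    and cone: "\<And>s. 0 < s \<Longrightarrow> s < \<delta> \<Longrightarrow> blunt_convex_cone {x. s < F x}"
    and sub: "\<And>s x. 0 < s \<Longrightarrow> s < \<delta> \<Longrightarrow> s < F x \<Longrightarrow> s < G x"
    and H: "\<And>x. 0 < G x \<Longrightarrow> 0 < c \<bullet> x" and m: "2 \<le> m"
  shows "mean_drop F \<delta> (pi / real m) \<le> mean_drop G \<delta> (pi / real m)"
proof -
  have lev: "mean_drop F \<delta> (pi / real m) = (\<integral>\<^sup>+s. indicator {0<..<\<delta>} s * exit_weight {x. s < F x} (pi / real m) \<partial>lborel)"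
    if [measurable]: "F \<in> borel_measurable borel" for F :: "'a \<Rightarrow> real"
  proof -
    let ?k = "\<lambda>p s. indicator (cball 0 1) p * (indicator {0<..<\<delta>} s *
       (indicator {..<F (fst p)} s * indicator {F (ellipse (fst p) (snd p) (pi / real m))..} s)) :: ennreal"
    have "mean_drop F \<delta> (pi / real m) = (\<integral>\<^sup>+p. (\<integral>\<^sup>+s. ?k p s \<partial>lborel) \<partial>lborel)"
      unfolding mean_drop_def by (intro nn_integral_cong) (simp add: nn_integral_cmult nn_integral_levels)
    also have "\<dots> = (\<integral>\<^sup>+s. (\<integral>\<^sup>+p. ?k p s \<partial>lborel) \<partial>lborel)"
      by (rule pair_sigma_finite.Fubini'[OF pair_sigma_finite.intro[OF sigma_finite_lborel sigma_finite_lborel]])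
        (unfold indicator_def lessThan_iff atLeast_iff, measurable)
    also have "\<dots> = (\<integral>\<^sup>+s. indicator {0<..<\<delta>} s * exit_weight {x. s < F x} (pi / real m) \<partial>lborel)"
    proof (rule nn_integral_cong)
      fix s
      have "(\<integral>\<^sup>+p. ?k p s \<partial>lborel) = (\<integral>\<^sup>+p. indicator {0<..<\<delta>} s * (indicator (cball 0 1) p *
         (indicator {x. s < F x} (fst p) * indicator (- {x. s < F x}) (ellipse (fst p) (snd p) (pi / real m)))) \<partial>lborel)"
        by (intro nn_integral_cong) (auto simp: indicator_def)
      then show "(\<integral>\<^sup>+p. ?k p s \<partial>lborel) = indicator {0<..<\<delta>} s * exit_weight {x. s < F x} (pi / real m)"
        unfolding exit_weight_def by (subst (asm) nn_integral_cmult) auto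
    qed
    finally show ?thesis .
  qed
  show ?thesis
    unfolding lev[OF assms(1)] lev[OF assms(2)]
  proof (rule nn_integral_mono)
    fix s
    show "indicator {0<..<\<delta>} s * exit_weight {x. s < F x} (pi / real m) \<le> indicator {0<..<\<delta>} s * exit_weight {x. s < G x} (pi / real m)"
    proof (cases "0 < s \<and> s < \<delta>")
      case True
      then have "exit_weight {x. s < F x} (pi / real m) \<le> exit_weight {x. s < G x} (pi / real m)"
        using cone sub H m by (intro exit_weight_mono[of _ _ c]) auto
      then show ?thesis by (simp add: mult_left_mono)
    qed auto
  qed
qed

section \<open>First-order change of latitude along an ellipse\<close>

text \<open>The signed angular distance of \<open>x\<close> from the hyperplane orthogonal to \<open>b\<close>. A cap of radius \<open>\<phi>\<close> around \<open>b\<close> consists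
of the points with latitude at least \<open>pi / 2 - \<phi>\<close>.\<close>

definition latitude :: "'a::real_inner \<Rightarrow> 'a \<Rightarrow> real" where
  "latitude b x = arcsin (b \<bullet> (x /\<^sub>R norm x))"

lemma unit_inner_bounds:
  assumes "norm b = 1"
  shows "- 1 \<le> b \<bullet> (x /\<^sub>R norm x)" "b \<bullet> (x /\<^sub>R norm x) \<le> 1"
proof -
  have "\<bar>b \<bullet> (x /\<^sub>R norm x)\<bar> \<le> norm b * norm (x /\<^sub>R norm x)" by (rule Cauchy_Schwarz_ineq2)
  also have "\<dots> \<le> 1" using assms by (cases "x = 0") auto
  finally show "- 1 \<le> b \<bullet> (x /\<^sub>R norm x)" "b \<bullet> (x /\<^sub>R norm x) \<le> 1" by linarith+
qed

text \<open>The latitude is the distance from a great subsphere, which has unit gradient on the unit sphere, composed with the radial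
projection, whose differential at \<open>x\<close> is \<open>1 / norm x\<close> times an orthogonal projection.\<close>

lemma latitude_derivative:
  fixes x b :: "'a::euclidean_space"
  assumes b: "norm b = 1" and x: "\<bar>b \<bullet> x\<bar> < norm x"
  shows "\<exists>u. norm u = 1 \<and>
    (\<forall>z. ((\<lambda>t. latitude b (ellipse x z t)) has_real_derivative (u \<bullet> z) / norm x) (at 0))"
proof -
  define N where "N = norm x"
  define B where "B = b \<bullet> x"
  have N: "0 < N" using x unfolding N_def by linarith
  have xx: "x \<bullet> x = N\<^sup>2" by (simp add: N_def power2_norm_eq_inner)
  have BN: "B\<^sup>2 < N\<^sup>2" using power_strict_mono[of "\<bar>B\<bar>" N 2] x by (simp add: B_def N_def)
  define Q where "Q = sqrt (1 - (B / N)\<^sup>2)"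
  have "(B / N)\<^sup>2 < 1" using BN N by (simp add: power_divide)
  then have Q: "0 < Q" "Q\<^sup>2 = 1 - (B / N)\<^sup>2" by (auto simp: Q_def)
  have BN1: "- 1 < B / N" "B / N < 1" using \<open>(B / N)\<^sup>2 < 1\<close> unfolding abs_square_less_1 by linarith+
  define u where "u = (b - (B / N\<^sup>2) *\<^sub>R x) /\<^sub>R Q"
  have bb: "b \<bullet> b = 1" using b by (simp add: norm_eq_1)
  have "(b - (B / N\<^sup>2) *\<^sub>R x) \<bullet> (b - (B / N\<^sup>2) *\<^sub>R x) = 1 - 2 * (B / N\<^sup>2) * B + (B / N\<^sup>2)\<^sup>2 * N\<^sup>2"
    by (simp add: inner_diff_left inner_diff_right bb xx inner_commute[of x b] power2_eq_square flip: B_def)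
  also have "\<dots> = 1 - (B / N)\<^sup>2" using N by (simp add: power2_eq_square field_simps)
  also have "\<dots> = Q\<^sup>2" by (simp add: Q)
  finally have "(b - (B / N\<^sup>2) *\<^sub>R x) \<bullet> (b - (B / N\<^sup>2) *\<^sub>R x) = Q\<^sup>2" .
  then have "norm (b - (B / N\<^sup>2) *\<^sub>R x) = Q"
    by (simp only: norm_eq_sqrt_inner real_sqrt_abs abs_of_pos[OF Q(1)])
  then have nu: "norm u = 1" using Q by (simp add: u_def)
  moreover have "((\<lambda>t. latitude b (ellipse x z t)) has_real_derivative (u \<bullet> z) / norm x) (at 0)" for z
  proof -
    define Z where "Z = b \<bullet> z"
    define Y where "Y = x \<bullet> z"
    define W where "W = z \<bullet> z"
    have eq: "(\<lambda>t. latitude b (ellipse x z t)) =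
      (\<lambda>t. arcsin ((cos t * B + sin t * Z) / sqrt ((cos t)\<^sup>2 * N\<^sup>2 + 2 * cos t * sin t * Y + (sin t)\<^sup>2 * W)))"
    proof
      fix t
      have 1: "b \<bullet> ellipse x z t = cos t * B + sin t * Z"
        by (simp add: ellipse_def inner_add_right B_def Z_def)
      have 2: "ellipse x z t \<bullet> ellipse x z t = (cos t)\<^sup>2 * N\<^sup>2 + 2 * cos t * sin t * Y + (sin t)\<^sup>2 * W"
        by (simp add: ellipse_def inner_add_left inner_add_right xx inner_commute[of z x] Y_def[symmetric] W_def[symmetric] power2_eq_square algebra_simps)
      show "latitude b (ellipse x z t) = arcsin ((cos t * B + sin t * Z) / sqrt ((cos t)\<^sup>2 * N\<^sup>2 + 2 * cos t * sin t * Y + (sin t)\<^sup>2 * W))"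
        unfolding latitude_def norm_eq_sqrt_inner 2 inner_scaleR_right 1 by (simp add: divide_inverse mult.commute)
    qed
    have "((\<lambda>t. arcsin ((cos t * B + sin t * Z) / sqrt ((cos t)\<^sup>2 * N\<^sup>2 + 2 * cos t * sin t * Y + (sin t)\<^sup>2 * W)))
      has_real_derivative inverse Q * ((Z * N - B * (Y / N)) / N\<^sup>2)) (at 0)"
      using N BN1
      by (auto intro!: derivative_eq_intros simp: Q_def power2_eq_square field_simps)
    moreover have "inverse Q * ((Z * N - B * (Y / N)) / N\<^sup>2) = (u \<bullet> z) / norm x"
      using N Q by (simp add: u_def inner_diff_left Z_def[symmetric] Y_def[symmetric] N_def[symmetric] field_simps power2_eq_square)
    ultimately show ?thesis by (simp add: eq)
  qed
  ultimately show ?thesis by blast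
qed

lemma step_tendsto_0: "(\<lambda>m. pi / real (m + 3)) \<longlonglongrightarrow> 0"
  by (rule LIMSEQ_ignore_initial_segment[where f = "\<lambda>m. pi / real m"])
    (intro tendsto_divide_0[OF tendsto_const] filterlim_at_top_imp_at_infinity filterlim_real_sequentially)

lemma latitude_decrease_limit:
  fixes x b :: "'a::euclidean_space"
  assumes b: "norm b = 1" and x: "\<bar>b \<bullet> x\<bar> < norm x"
  shows "\<exists>u. norm u = 1 \<and>
    (\<forall>z. (\<lambda>m. real (m + 3) / pi * (latitude b x - latitude b (ellipse x z (pi / real (m + 3))))) \<longlonglongrightarrow> (u \<bullet> z) / norm x)"
proof -
  obtain u where u: "norm u = 1"
    "\<And>z. ((\<lambda>t. latitude b (ellipse x z t)) has_real_derivative (u \<bullet> z) / norm x) (at 0)"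
    using latitude_derivative[OF assms] by blast
  have lim: "filterlim (\<lambda>m. pi / real (m + 3)) (at 0) sequentially"
    unfolding filterlim_at using step_tendsto_0 by simp
  have "(\<lambda>m. real (m + 3) / pi * (latitude b x - latitude b (ellipse x z (pi / real (m + 3))))) \<longlonglongrightarrow> ((- u) \<bullet> z) / norm x" for z
  proof -
    have "((\<lambda>t. (latitude b (ellipse x z t) - latitude b x) / t) \<longlongrightarrow> (u \<bullet> z) / norm x) (at 0)"
      using u(2)[of z] by (simp add: has_field_derivative_iff ellipse_def)
    from tendsto_minus[OF filterlim_compose[OF this lim]] show ?thesis
      by (simp add: divide_inverse algebra_simps)
  qed
  moreover have "norm (- u) = 1" using u by simp
  ultimately show ?thesis by blast
qed

text \<open>Dominates \<open>1 / norm x\<close> by a sum over dyadic balls; the volume \<open>2^(- k d)\<close> beats \<open>2^k\<close> as \<open>d \<ge> 2\<close>.\<close>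

lemma nn_integral_inverse_norm_finite:
  assumes "2 \<le> DIM('a::euclidean_space)"
  shows "(\<integral>\<^sup>+x. indicator (cball 0 1) x * ennreal (1 / norm (x :: 'a)) \<partial>lborel) < \<infinity>"
proof -
  define V where "V = unit_ball_vol (real DIM('a))"
  have V: "0 \<le> V" by (simp add: V_def unit_ball_vol_nonneg)
  let ?t = "\<lambda>k x. ennreal (2 ^ Suc k) * indicator (cball 0 ((1/2) ^ k)) (x :: 'a)"
  have "(\<integral>\<^sup>+x. indicator (cball 0 1) x * ennreal (1 / norm (x :: 'a)) \<partial>lborel) \<le> (\<integral>\<^sup>+x. (\<Sum>k. ?t k x) \<partial>lborel)"
  proof (rule nn_integral_mono)
    fix x :: 'a
    show "indicator (cball 0 1) x * ennreal (1 / norm x) \<le> (\<Sum>k. ?t k x)"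
    proof (cases "x \<noteq> 0 \<and> norm x \<le> 1")
      case True
      define n where "n = (LEAST n. (1/2 :: real) ^ n < norm x)"
      have ex: "\<exists>n. (1/2 :: real) ^ n < norm x" using True by (intro real_arch_pow_inv) auto
      then have n: "(1/2 :: real) ^ n < norm x" unfolding n_def by (rule LeastI_ex)
      then have "n \<noteq> 0" using True by (intro notI) auto
      then obtain k where k: "n = Suc k" using not0_implies_Suc by blast
      then have "\<not> (1/2 :: real) ^ k < norm x" unfolding n_def by (intro not_less_Least) auto
      then have "norm x \<le> (1/2) ^ k" by simp
      moreover have "1 / norm x \<le> 2 ^ Suc k"
        using n True by (simp add: k power_one_over field_simps)
      ultimately have "indicator (cball 0 1) x * ennreal (1 / norm x) \<le> ?t k x"
        using True by (simp add: ennreal_leI del: power_Suc)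
      also have "\<dots> \<le> (\<Sum>k. ?t k x)"
      proof -
        define g where "g = (\<lambda>k. ?t k x)"
        have "g k \<le> suminf g" using sum_le_suminf[of g "{k}"] by simp
        then show ?thesis by (simp only: g_def)
      qed
      finally show ?thesis .
    next
      case False
      then have "indicator (cball 0 1) x * ennreal (1 / norm x) = 0" by (auto simp: indicator_def)
      then show ?thesis by (simp only: zero_le)
    qed
  qed
  also have "\<dots> = (\<Sum>k. \<integral>\<^sup>+x. ?t k x \<partial>lborel)" by (rule nn_integral_suminf) measurable
  also have "\<dots> \<le> (\<Sum>k. ennreal (2 * V * (1/2) ^ k))"
  proof (intro suminf_le allI)
    fix k
    have "(\<integral>\<^sup>+x. ?t k x \<partial>lborel) = ennreal (2 ^ Suc k) * ennreal (V * ((1/2) ^ k) ^ DIM('a))"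
      by (simp add: nn_integral_cmult emeasure_cball V_def del: power_Suc)
    also have "\<dots> = ennreal (2 ^ Suc k * (V * ((1/2) ^ k) ^ DIM('a)))"
      using V by (simp add: ennreal_mult)
    also have "\<dots> \<le> ennreal (2 * V * (1/2) ^ k)"
    proof (rule ennreal_leI)
      have "((1/2 :: real) ^ k) ^ DIM('a) \<le> ((1/2) ^ k) ^ 2"
        using assms by (intro power_decreasing) (auto simp: power_le_one)
      then have "2 ^ Suc k * (V * ((1/2) ^ k) ^ DIM('a)) \<le> 2 ^ Suc k * (V * ((1/2) ^ k) ^ 2)"
        using V by (intro mult_left_mono) auto
      also have "\<dots> = 2 * V * (1/2) ^ k" by (simp add: power2_eq_square power_one_over field_simps)
      finally show "2 ^ Suc k * (V * ((1/2) ^ k) ^ DIM('a)) \<le> 2 * V * (1/2) ^ k" .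
    qed
    finally show "(\<integral>\<^sup>+x. ?t k x \<partial>lborel) \<le> ennreal (2 * V * (1/2) ^ k)" .
  qed auto
  also have "\<dots> < \<infinity>"
  proof -
    have "summable (\<lambda>k. 2 * V * (1/2 :: real) ^ k)" by (intro summable_mult summable_geometric) auto
    then show ?thesis using V by (subst suminf_ennreal2) (auto simp: less_top)
  qed
  finally show ?thesis .
qed

text \<open>The rate at which the latitude with gradient direction \<open>- u\<close> decreases at \<open>x\<close> on average, up to the factor \<open>1 / norm x\<close>; negative
values are cut off by \<^const>\<open>ennreal\<close>.\<close>

definition drift :: "real ^ 'd \<Rightarrow> real ^ 'd \<Rightarrow> ennreal" where
  "drift u x = (\<integral>\<^sup>+z. indicator (cball 0 1) (x, z) * ennreal (u \<bullet> z) \<partial>lborel)"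

lemma indicator_pair_cball: "indicator (cball 0 1) (x, z) = (indicator {p. (fst p)\<^sup>2 + (snd p)\<^sup>2 \<le> (1::real)} (norm x, norm z) :: ennreal)"
  by (simp add: indicator_def norm_prod_def)

lemma drift_orthogonal:
  fixes x y u :: "real ^ 'd"
  assumes T: "orthogonal_transformation T" and that: "norm y = norm x"
  shows "drift (T u) y = drift u x"
proof -
  have [measurable]: "(\<lambda>z :: real ^ 'd. (w, z)) \<in> borel_measurable borel" for w :: "real ^ 'd"
    by (intro borel_measurable_continuous_onI continuous_intros)
  have "drift (T u) y = (\<integral>\<^sup>+z. indicator (cball 0 1) (y, T z) * ennreal (T u \<bullet> T z) \<partial>lborel)"
    unfolding drift_def
    by (rule nn_integral_orthogonal_transformation[OF T, symmetric]) measurable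
  also have "\<dots> = drift u x"
    using T that by (simp add: drift_def indicator_pair_cball orthogonal_transformation_norm orthogonal_transformation_def)
  finally show ?thesis .
qed

text \<open>The common value of \<open>drift u x\<close> for all unit vectors \<open>u\<close>; see \<open>drift_unit\<close>.\<close>

definition drift_axis :: "real ^ 'd \<Rightarrow> ennreal" where
  "drift_axis x = drift (axis (SOME i. True) 1) x"

lemma drift_unit:
  fixes u :: "real ^ 'd"
  assumes "norm u = 1"
  shows "drift u x = drift_axis x"
proof -
  obtain T :: "real ^ 'd \<Rightarrow> real ^ 'd" where T: "orthogonal_transformation T" "T u = axis (SOME i. True) 1"
    using orthogonal_transformation_exists_1[of u "axis (SOME i. True) 1"] assms by auto
  show ?thesis unfolding drift_axis_def
    using drift_orthogonal[OF T(1), of x x u] by (simp add: T(2))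
qed

lemma drift_axis_rotation:
  assumes "rotation_matrix T" shows "drift_axis (T *v x) = drift_axis x"
proof -
  have ot: "orthogonal_transformation ((*v) T)" using assms by (rule orthogonal_transformation_mult_vec)
  have "norm (T *v axis (SOME i. True) 1) = 1" by (simp add: orthogonal_transformation_norm[OF ot])
  then have "drift_axis (T *v x) = drift (T *v axis (SOME i. True) 1) (T *v x)" by (simp add: drift_unit)
  also have "\<dots> = drift_axis x"
    unfolding drift_axis_def by (rule drift_orthogonal[OF ot]) (simp add: orthogonal_transformation_norm[OF ot])
  finally show ?thesis .
qed

lemma drift_axis_measurable[measurable]: "(drift_axis :: real ^ 'd \<Rightarrow> ennreal) \<in> borel_measurable borel"
proof -
  let ?a = "axis (SOME i. True) 1 :: real ^ 'd"
  have "(\<lambda>p :: (real ^ 'd) \<times> (real ^ 'd). indicator (cball 0 1) p * ennreal (?a \<bullet> snd p)) \<in> borel_measurable borel"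
    by (intro borel_measurable_times_ennreal measurable_compose[OF _ measurable_ennreal] borel_measurable_inner
        borel_measurable_const prod_fst_snd_measurable borel_measurable_indicator) simp
  moreover have eq: "sets (borel \<Otimes>\<^sub>M lborel) = sets (borel :: ((real ^ 'd) \<times> (real ^ 'd)) measure)"
    by (subst borel_prod[symmetric]) (rule sets_pair_measure_cong; simp)
  ultimately have "(\<lambda>(x :: real ^ 'd, z). indicator (cball 0 1) (x, z) * ennreal (?a \<bullet> z)) \<in> borel_measurable (borel \<Otimes>\<^sub>M lborel)"
    by (simp only: split_beta' measurable_cong_sets[OF eq refl] prod.collapse)
  then show ?thesis unfolding drift_axis_def drift_def
    by (intro lborel.borel_measurable_nn_integral)
qed

lemma drift_axis_le: "drift_axis (x :: real ^ 'd) \<le> indicator (cball 0 1) x * emeasure lborel (cball 0 1 :: (real ^ 'd) set)"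
proof -
  have "drift_axis x \<le> (\<integral>\<^sup>+z. indicator (cball 0 1) x * indicator (cball 0 1 :: (real ^ 'd) set) z \<partial>lborel)"
    unfolding drift_axis_def drift_def
  proof (rule nn_integral_mono)
    fix z :: "real ^ 'd"
    show "indicator (cball 0 1) (x, z) * ennreal (axis (SOME i. True) 1 \<bullet> z) \<le> indicator (cball 0 1) x * indicator (cball 0 1) z"
    proof (cases "norm (x, z) \<le> 1")
      case True
      then have n: "norm x \<le> 1" "norm z \<le> 1" using norm_fst_le[of x z] norm_snd_le[of z x] by linarith+
      have "axis (SOME i. True) 1 \<bullet> z \<le> norm (axis (SOME i. True) 1 :: real ^ 'd) * norm z" by (rule norm_cauchy_schwarz)
      then have "axis (SOME i. True) 1 \<bullet> z \<le> 1" using n by simp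
      then show ?thesis using n True by (simp add: ennreal_le_1)
    qed (simp add: indicator_def)
  qed
  also have "\<dots> = indicator (cball 0 1) x * emeasure lborel (cball 0 1 :: (real ^ 'd) set)"
    by (simp add: nn_integral_cmult)
  finally show ?thesis .
qed

lemma norm_direction_diff_le:
  fixes x y :: "'a::real_normed_vector"
  assumes "x \<noteq> 0"
  shows "norm (x /\<^sub>R norm x - y /\<^sub>R norm y) \<le> 2 * norm (x - y) / norm x"
proof (cases "y = 0")
  case False
  have "x /\<^sub>R norm x - y /\<^sub>R norm y = (x - y) /\<^sub>R norm x + (1 / norm x - 1 / norm y) *\<^sub>R y"
    by (simp add: algebra_simps divide_inverse)
  also have "norm \<dots> \<le> norm (x - y) / norm x + \<bar>1 / norm x - 1 / norm y\<bar> * norm y"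
    by (rule order.trans[OF norm_triangle_ineq]) (simp add: divide_inverse mult.commute)
  also have "\<bar>1 / norm x - 1 / norm y\<bar> * norm y = \<bar>norm y - norm x\<bar> / norm x"
  proof -
    have "1 / norm x - 1 / norm y = (norm y - norm x) / (norm x * norm y)"
      using assms False by (simp add: field_simps)
    then show ?thesis using assms False by (simp add: abs_mult)
  qed
  also have "\<dots> \<le> norm (x - y) / norm x"
    using norm_triangle_ineq3[of y x] by (simp add: divide_right_mono norm_minus_commute)
  finally show ?thesis by simp
qed (use assms in simp)

text \<open>The mean value theorem, in the direction in which it bounds an angle by a difference of sines.\<close>

lemma sin_diff_lower_bound:
  assumes "0 \<le> b" "b \<le> a" "a \<le> h" "h \<le> pi / 2"
  shows "(a - b) * cos h \<le> sin a - sin b"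
proof (cases "a = b")
  case False
  then obtain t where t: "b < t" "t < a" "sin a - sin b = (a - b) * cos t"
    using MVT2[of b a sin cos] assms by (auto intro: DERIV_sin)
  have "cos h \<le> cos t" using t assms by (intro cos_monotone_0_pi_le) auto
  then show ?thesis using t by (simp add: mult_left_mono)
qed simp

lemma latitude_bounds:
  assumes "norm b = 1" shows "- (pi / 2) \<le> latitude b x" "latitude b x \<le> pi / 2"
    "sin (latitude b x) = b \<bullet> (x /\<^sub>R norm x)"
  using arcsin_bounded[OF unit_inner_bounds[OF assms, of x]] unit_inner_bounds[OF assms, of x]
  by (auto simp: latitude_def)

lemma latitude_scale: "0 < a \<Longrightarrow> latitude b (a *\<^sub>R x) = latitude b x"
  by (simp add: latitude_def divide_simps)

lemma latitude_direction: "x \<noteq> 0 \<Longrightarrow> latitude c (x /\<^sub>R norm x) = latitude c x"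
  using latitude_scale[of "inverse (norm x)" c x] by simp

text \<open>The domination for the passage to the limit \<open>\<alpha> \<rightarrow> 0\<close>. Truncating at \<open>lo + \<delta> < pi / 2\<close> keeps the latitude away from
the pole, where the inverse sine is not Lipschitz.\<close>

lemma latitude_increment_bound:
  fixes x z :: "'a::euclidean_space"
  assumes c: "norm c = 1" and lo: "0 \<le> lo" "0 < \<delta>" "lo + \<delta> < pi / 2"
    and al: "0 < \<alpha>" "\<alpha> \<le> pi / 3" and x: "x \<noteq> 0" and z: "norm z \<le> 1"
  shows "min \<delta> (latitude c x - lo) - max 0 (latitude c (ellipse x z \<alpha>) - lo)
     \<le> \<alpha> * (4 / cos (lo + \<delta>) / norm x)"
proof -
  define y where "y = x + tan \<alpha> *\<^sub>R z"
  have ch: "0 < cos (lo + \<delta>)" using lo by (intro cos_gt_zero_pi) auto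
  have ca: "1 / 2 \<le> cos \<alpha>" using cos_monotone_0_pi_le[of \<alpha> "pi / 3"] al by (simp add: cos_60)
  have "ellipse x z \<alpha> = cos \<alpha> *\<^sub>R y" using ca by (simp add: ellipse_def y_def tan_def algebra_simps)
  then have Ay: "latitude c (ellipse x z \<alpha>) = latitude c y" using ca latitude_scale[of "cos \<alpha>"] by simp
  define a where "a = min (lo + \<delta>) (latitude c x)"
  define b where "b = max lo (latitude c y)"
  have eq: "min \<delta> (latitude c x - lo) - max 0 (latitude c (ellipse x z \<alpha>) - lo) = a - b"
    by (simp add: Ay a_def b_def min_def max_def)
  have rhs: "0 \<le> \<alpha> * (4 / cos (lo + \<delta>) / norm x)" using al ch by simp
  show ?thesis unfolding eq
  proof (cases "b \<le> a")
    case True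
    have ab: "0 \<le> b" "a \<le> lo + \<delta>" "a \<le> latitude c x" "latitude c y \<le> b" using lo by (auto simp: a_def b_def)
    have "(a - b) * cos (lo + \<delta>) \<le> sin a - sin b"
      using ab True lo by (intro sin_diff_lower_bound) auto
    also have "\<dots> \<le> sin (latitude c x) - sin (latitude c y)"
      using ab True lo latitude_bounds(1,2)[OF c, of x] latitude_bounds(1,2)[OF c, of y]
      by (intro diff_mono sin_monotone_2pi_le) auto
    also have "\<dots> = c \<bullet> (x /\<^sub>R norm x - y /\<^sub>R norm y)"
      by (simp add: latitude_bounds(3)[OF c] inner_diff_right)
    also have "\<dots> \<le> norm (x /\<^sub>R norm x - y /\<^sub>R norm y)"
      using norm_cauchy_schwarz[of c "x /\<^sub>R norm x - y /\<^sub>R norm y"] c by simp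
    also have "\<dots> \<le> 2 * norm (x - y) / norm x" by (rule norm_direction_diff_le[OF x])
    also have "norm (x - y) = tan \<alpha> * norm z"
      using al tan_gt_zero[of \<alpha>] by (simp add: y_def)
    also have "2 * (tan \<alpha> * norm z) / norm x \<le> 2 * (2 * \<alpha>) / norm x"
    proof (intro divide_right_mono mult_left_mono)
      have "sin \<alpha> / cos \<alpha> \<le> \<alpha> / (1 / 2)"
        using sin_x_le_x[of \<alpha>] ca al by (intro frac_le) auto
      moreover have "0 \<le> tan \<alpha>" using al tan_gt_zero[of \<alpha>] by simp
      moreover have "tan \<alpha> * norm z \<le> tan \<alpha> * 1" using \<open>0 \<le> tan \<alpha>\<close> z by (rule mult_left_mono[rotated])
      ultimately show "tan \<alpha> * norm z \<le> 2 * \<alpha>" by (simp add: tan_def)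
    qed auto
    finally have "(a - b) * cos (lo + \<delta>) \<le> 2 * (2 * \<alpha>) / norm x" .
    then show "a - b \<le> \<alpha> * (4 / cos (lo + \<delta>) / norm x)"
      using ch x by (simp add: field_simps)
  qed (use rhs in linarith)
qed

lemma latitude_interior:
  assumes b: "norm b = 1" and "0 < latitude b x" "latitude b x < pi / 2"
  shows "x \<noteq> 0" "\<bar>b \<bullet> x\<bar> < norm x"
proof -
  show x: "x \<noteq> 0" using assms by (auto simp: latitude_def)
  have "b \<bullet> (x /\<^sub>R norm x) < sin (pi / 2)" "sin 0 < b \<bullet> (x /\<^sub>R norm x)"
    unfolding latitude_bounds(3)[OF b, symmetric] using assms by (intro sin_monotone_2pi; simp)+
  then have "b \<bullet> (x /\<^sub>R norm x) < 1" "0 < b \<bullet> (x /\<^sub>R norm x)" by auto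
  then show "\<bar>b \<bullet> x\<bar> < norm x" using x by (simp add: field_simps zero_less_mult_iff abs_if)
qed

lemma latitude_ellipse_tendsto:
  fixes x z :: "'a::euclidean_space"
  assumes b: "norm b = 1" and x: "x \<noteq> 0" and t: "t \<longlonglongrightarrow> 0"
  shows "(\<lambda>m. latitude b (ellipse x z (t m))) \<longlonglongrightarrow> latitude b x"
proof -
  have e: "(\<lambda>m. ellipse x z (t m)) \<longlonglongrightarrow> x"
  proof -
    have "(\<lambda>m. ellipse x z (t m)) \<longlonglongrightarrow> cos 0 *\<^sub>R x + sin 0 *\<^sub>R z"
      unfolding ellipse_def by (intro tendsto_intros t)
    then show ?thesis by simp
  qed
  have "(\<lambda>m. b \<bullet> (ellipse x z (t m) /\<^sub>R norm (ellipse x z (t m)))) \<longlonglongrightarrow> b \<bullet> (x /\<^sub>R norm x)"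
    using x by (intro tendsto_intros e) auto
  then show ?thesis unfolding latitude_def
    by (rule continuous_on_tendsto_compose[OF continuous_on_arcsin']) (use unit_inner_bounds[OF b] in auto)
qed

lemma borel_measurable_arcsin:
  assumes f: "f \<in> borel_measurable M" and bounds: "\<And>x. - 1 \<le> f x" "\<And>x. f x \<le> (1 :: real)"
  shows "(\<lambda>x. arcsin (f x)) \<in> borel_measurable M"
proof -
  have "(\<lambda>r. if r \<in> {-1..1} then arcsin r else 0) \<in> borel_measurable borel"
    by (intro borel_measurable_continuous_on_if continuous_on_arcsin') auto
  from measurable_compose[OF f this] show ?thesis using bounds by simp
qed

lemma latitude_measurable[measurable]:
  assumes "norm b = 1" shows "latitude (b :: 'a::euclidean_space) \<in> borel_measurable borel"
  unfolding latitude_def[abs_def] by (intro borel_measurable_arcsin unit_inner_bounds assms) measurable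

section \<open>Comparison of inner layers in the limit\<close>

lemma pair_integral:
  fixes f :: "(real ^ 'd) \<times> (real ^ 'd) \<Rightarrow> ennreal"
  assumes "f \<in> borel_measurable borel"
  shows "(\<integral>\<^sup>+p. f p \<partial>lborel) = (\<integral>\<^sup>+x. (\<integral>\<^sup>+z. f (x, z) \<partial>lborel) \<partial>lborel)"
    and "(\<lambda>x. \<integral>\<^sup>+z. f (x, z) \<partial>lborel) \<in> borel_measurable borel"
proof -
  have f: "f \<in> borel_measurable (lborel \<Otimes>\<^sub>M lborel)" using assms by (simp add: lborel_prod)
  show "(\<integral>\<^sup>+p. f p \<partial>lborel) = (\<integral>\<^sup>+x. (\<integral>\<^sup>+z. f (x, z) \<partial>lborel) \<partial>lborel)"
    using lborel.nn_integral_fst[OF f] by (simp add: lborel_prod)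
  show "(\<lambda>x. \<integral>\<^sup>+z. f (x, z) \<partial>lborel) \<in> borel_measurable borel"
    using lborel.borel_measurable_nn_integral_fst[OF f] by simp
qed

lemma Pair_measurable_right[measurable]:
  "(\<lambda>z :: 'a::euclidean_space. (x :: 'a, z)) \<in> borel_measurable borel"
  by (intro borel_measurable_continuous_onI continuous_intros)

text \<open>The mean decrease per unit of time at \<open>x\<close>, over all directions \<open>z\<close> admissible at \<open>x\<close>, of a function whose gradient at
\<open>x\<close> has length \<open>1 / norm x\<close>.\<close>

definition drift_density :: "real ^ 'd \<Rightarrow> ennreal" where
  "drift_density x = drift_axis x * ennreal (1 / norm x)"

definition drift_mass :: "(real ^ 'd) set \<Rightarrow> ennreal" where
  "drift_mass A = (\<integral>\<^sup>+x. indicator A x * drift_density x \<partial>lborel)"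

lemma drift_integral:
  fixes u x :: "real ^ 'd"
  assumes "norm u = 1"
  shows "(\<integral>\<^sup>+z. indicator (cball 0 1) (x, z) * ennreal ((u \<bullet> z) / norm x) \<partial>lborel) = drift_density x"
proof -
  have "ennreal ((u \<bullet> z) / norm x) = ennreal (u \<bullet> z) * ennreal (1 / norm x)" for z
    by (cases "0 \<le> u \<bullet> z")
      (auto simp: ennreal_neg divide_nonpos_nonneg mult_nonpos_nonneg simp flip: ennreal_mult)
  then show ?thesis
    using drift_unit[OF assms, of x, symmetric]
    by (simp add: drift_density_def drift_def nn_integral_multc mult.assoc[symmetric])
qed

text \<open>Fatou's lemma, first in \<open>z\<close> and then in \<open>x\<close>; in this order the supporting vector \<open>b\<close> may depend on \<open>x\<close> in an
arbitrary way. The index starts at 3, where \<open>pi / m\<close> is at most \<open>pi / 3\<close>, to match the next lemma.\<close>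

lemma layer_lower_limit:
  fixes F :: "real ^ 'd \<Rightarrow> real"
  assumes [measurable]: "F \<in> borel_measurable borel"
    and \<delta>: "\<delta> < pi / 2"
    and support: "\<And>x. 0 < F x \<Longrightarrow> F x \<le> \<delta> \<Longrightarrow>
      \<exists>b. norm b = 1 \<and> F x = latitude b x \<and> (\<forall>y. F y \<le> max 0 (latitude b y))"
  shows "drift_mass {x. 0 < F x \<and> F x \<le> \<delta>}
    \<le> liminf (\<lambda>m. ennreal (real (m + 3) / pi) * mean_drop F \<delta> (pi / real (m + 3)))"
proof -
  define f where "f m p = ennreal (real (m + 3) / pi) * (indicator (cball 0 1) p *
     ennreal (min \<delta> (F (fst p)) - max 0 (F (ellipse (fst p) (snd p) (pi / real (m + 3))))))"
    for m and p :: "(real ^ 'd) \<times> (real ^ 'd)"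
  have fm[measurable]: "f m \<in> borel_measurable borel" for m unfolding f_def by measurable
  have fint: "(\<integral>\<^sup>+p. f m p \<partial>lborel) = ennreal (real (m + 3) / pi) * mean_drop F \<delta> (pi / real (m + 3))" for m
    unfolding f_def mean_drop_def by (rule nn_integral_cmult) measurable
  have "indicator {x. 0 < F x \<and> F x \<le> \<delta>} x * drift_density x
    \<le> liminf (\<lambda>m. \<integral>\<^sup>+z. f m (x, z) \<partial>lborel)" for x
  proof (cases "0 < F x \<and> F x \<le> \<delta>")
    case True
    then obtain b where b: "norm b = 1" "F x = latitude b x" "\<And>y. F y \<le> max 0 (latitude b y)"
      using support by blast
    have x: "x \<noteq> 0" "\<bar>b \<bullet> x\<bar> < norm x" using True \<delta> b latitude_interior[of b x] by auto
    obtain u where u: "norm u = 1"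
      "\<And>z. (\<lambda>m. real (m + 3) / pi * (latitude b x - latitude b (ellipse x z (pi / real (m + 3))))) \<longlonglongrightarrow> (u \<bullet> z) / norm x"
      using latitude_decrease_limit[OF b(1) x(2)] by blast
    have "indicator (cball 0 1) (x, z) * ennreal ((u \<bullet> z) / norm x) \<le> liminf (\<lambda>m. f m (x, z))" for z
    proof -
      define g where "g m = indicator (cball 0 1) (x, z) *
        ennreal (real (m + 3) / pi * (latitude b x - latitude b (ellipse x z (pi / real (m + 3)))))" for m
      have "g \<longlonglongrightarrow> indicator (cball 0 1) (x, z) * ennreal ((u \<bullet> z) / norm x)"
        unfolding g_def by (intro tendsto_mult_ennreal tendsto_const tendsto_ennrealI u(2)) (auto simp: indicator_def)
      then have "indicator (cball 0 1) (x, z) * ennreal ((u \<bullet> z) / norm x) = liminf g"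
        by (simp add: lim_imp_Liminf)
      also have "\<dots> \<le> liminf (\<lambda>m. f m (x, z))"
      proof (rule Liminf_mono)
        have "(\<lambda>m. latitude b (ellipse x z (pi / real (m + 3)))) \<longlonglongrightarrow> latitude b x"
          by (rule latitude_ellipse_tendsto[OF b(1) x(1) step_tendsto_0])
        then have "\<forall>\<^sub>F m in sequentially. 0 < latitude b (ellipse x z (pi / real (m + 3)))"
          using True b(2) by (intro order_tendstoD) auto
        then show "\<forall>\<^sub>F m in sequentially. g m \<le> f m (x, z)"
        proof eventually_elim
          case (elim m)
          let ?y = "ellipse x z (pi / real (m + 3))"
          have "latitude b x - latitude b ?y \<le> min \<delta> (F x) - max 0 (F ?y)"
            using b(3)[of ?y] elim True b(2) by auto
          then have "real (m + 3) / pi * (latitude b x - latitude b ?y) \<le> real (m + 3) / pi * (min \<delta> (F x) - max 0 (F ?y))"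
            by (intro mult_left_mono) auto
          then have "ennreal (real (m + 3) / pi * (latitude b x - latitude b ?y)) \<le> ennreal (real (m + 3) / pi) * ennreal (min \<delta> (F x) - max 0 (F ?y))"
            by (subst ennreal_mult'[of "real (m + 3) / pi", symmetric]) (auto intro: ennreal_leI simp del: of_nat_add)
          then show ?case
            by (auto simp: g_def f_def indicator_def)
        qed
      qed
      finally show ?thesis .
    qed
    then have "(\<integral>\<^sup>+z. indicator (cball 0 1) (x, z) * ennreal ((u \<bullet> z) / norm x) \<partial>lborel)
      \<le> (\<integral>\<^sup>+z. liminf (\<lambda>m. f m (x, z)) \<partial>lborel)" by (intro nn_integral_mono)
    also have "\<dots> \<le> liminf (\<lambda>m. \<integral>\<^sup>+z. f m (x, z) \<partial>lborel)"
      by (rule nn_integral_liminf) measurable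
    finally show ?thesis using True by (simp add: drift_integral[OF u(1)])
  qed simp
  then have "drift_mass {x. 0 < F x \<and> F x \<le> \<delta>}
    \<le> (\<integral>\<^sup>+x. liminf (\<lambda>m. \<integral>\<^sup>+z. f m (x, z) \<partial>lborel) \<partial>lborel)" unfolding drift_mass_def by (intro nn_integral_mono)
  also have "\<dots> \<le> liminf (\<lambda>m. \<integral>\<^sup>+x. (\<integral>\<^sup>+z. f m (x, z) \<partial>lborel) \<partial>lborel)"
    by (rule nn_integral_liminf) (use pair_integral(2) in simp)
  also have "\<dots> = liminf (\<lambda>m. \<integral>\<^sup>+p. f m p \<partial>lborel)"
    by (simp only: pair_integral(1)[OF fm])
  also have "\<dots> = liminf (\<lambda>m. ennreal (real (m + 3) / pi) * mean_drop F \<delta> (pi / real (m + 3)))"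
    by (simp only: fint)
  finally show ?thesis .
qed

text \<open>For a cap the depth is itself a latitude up to a constant, so that the limit exists pointwise; the convergence is dominated by
\<open>latitude_increment_bound\<close>.\<close>

lemma layer_upper_limit:
  fixes c :: "real ^ 'd"
  assumes c: "norm c = 1" and lo: "0 \<le> lo" "0 < \<delta>" "lo + \<delta> < pi / 2" and d: "2 \<le> CARD('d)"
  defines "G \<equiv> \<lambda>x. latitude c x - lo"
  shows "(\<lambda>m. ennreal (real (m + 3) / pi) * mean_drop G \<delta> (pi / real (m + 3)))
    \<longlonglongrightarrow> drift_mass {x. 0 < G x \<and> G x \<le> \<delta>}"
proof -
  have [measurable]: "latitude c \<in> borel_measurable borel" by (rule latitude_measurable[OF c])
  have [measurable]: "G \<in> borel_measurable borel" unfolding G_def by measurable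
  define f where "f m p = ennreal (real (m + 3) / pi) * (indicator (cball 0 1) p *
     ennreal (min \<delta> (G (fst p)) - max 0 (G (ellipse (fst p) (snd p) (pi / real (m + 3))))))"
    for m and p :: "(real ^ 'd) \<times> (real ^ 'd)"
  have [measurable]: "f m \<in> borel_measurable borel" for m unfolding f_def by measurable
  have fint: "(\<integral>\<^sup>+p. f m p \<partial>lborel) = ennreal (real (m + 3) / pi) * mean_drop G \<delta> (pi / real (m + 3))" for m
    unfolding f_def mean_drop_def by (rule nn_integral_cmult) measurable
  define C where "C = 4 / cos (lo + \<delta>)"
  have C: "0 \<le> C" using lo by (auto simp: C_def intro!: divide_nonneg_nonneg cos_ge_zero)
  define w where "w p = indicator (cball 0 1) p * ennreal (C / norm (fst p))" for p :: "(real ^ 'd) \<times> (real ^ 'd)"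
  have [measurable]: "w \<in> borel_measurable borel" unfolding w_def by measurable
  define v where "v p = liminf (\<lambda>m. f m p)" for p
  have [measurable]: "v \<in> borel_measurable borel" unfolding v_def by measurable
  have G0: "G 0 \<le> 0" using lo by (simp add: G_def latitude_def)
  have f_le: "f m p \<le> w p" for m p
  proof (cases "0 < G (fst p) \<and> norm p \<le> 1")
    case True
    obtain x z where p: "p = (x, z)" by (cases p)
    have x: "x \<noteq> 0" using True G0 by (auto simp: p)
    have z: "norm z \<le> 1" using True norm_snd_le[of z x] by (simp add: p)
    have "min \<delta> (G x) - max 0 (G (ellipse x z (pi / real (m + 3)))) \<le> pi / real (m + 3) * (C / norm x)"
    proof -
      have "pi / real (m + 3) \<le> pi / 3" by (rule divide_left_mono) auto
      then show ?thesis unfolding G_def C_def by (intro latitude_increment_bound[OF c lo _ _ x z]) auto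
    qed
    then have "real (m + 3) / pi * (min \<delta> (G x) - max 0 (G (ellipse x z (pi / real (m + 3)))))
      \<le> real (m + 3) / pi * (pi / real (m + 3) * (C / norm x))"
      by (intro mult_left_mono) auto
    also have "\<dots> = C / norm x" by simp
    finally have "ennreal (real (m + 3) / pi * (min \<delta> (G x) - max 0 (G (ellipse x z (pi / real (m + 3)))))) \<le> ennreal (C / norm x)"
      by (rule ennreal_leI)
    moreover have "0 \<le> real (m + 3) / pi" by simp
    ultimately have "ennreal (real (m + 3) / pi) * ennreal (min \<delta> (G x) - max 0 (G (ellipse x z (pi / real (m + 3))))) \<le> ennreal (C / norm x)"
      by (simp only: ennreal_mult')
    then show ?thesis using True by (simp add: f_def w_def p del: of_nat_add)
  next
    case False
    then have "f m p = 0" using lo by (auto simp: f_def indicator_def ennreal_neg)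
    then show ?thesis by simp
  qed
  have "(\<integral>\<^sup>+p. w p \<partial>lborel) \<le> (\<integral>\<^sup>+p. ennreal C * (indicator (cball 0 1) (fst p) * ennreal (1 / norm (fst p)) * indicator (cball 0 1) (snd p)) \<partial>(lborel :: ((real ^ 'd) \<times> (real ^ 'd)) measure))"
  proof (rule nn_integral_mono)
    fix p :: "(real ^ 'd) \<times> (real ^ 'd)"
    show "w p \<le> ennreal C * (indicator (cball 0 1) (fst p) * ennreal (1 / norm (fst p)) * indicator (cball 0 1) (snd p))"
      using C norm_fst_le[of "fst p" "snd p"] norm_snd_le[of "snd p" "fst p"]
      by (auto simp: w_def indicator_def ennreal_mult[symmetric])
  qed
  also have "\<dots> = (\<integral>\<^sup>+x. (\<integral>\<^sup>+z. ennreal C * (indicator (cball 0 1) x * ennreal (1 / norm x) * indicator (cball 0 1 :: (real ^ 'd) set) z) \<partial>lborel) \<partial>(lborel :: (real ^ 'd) measure))"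
    by (subst pair_integral) auto
  also have "\<dots> = ennreal C * ((\<integral>\<^sup>+x. indicator (cball 0 1) x * ennreal (1 / norm x) \<partial>(lborel :: (real ^ 'd) measure)) * emeasure lborel (cball 0 1 :: (real ^ 'd) set))"
    by (simp add: nn_integral_cmult nn_integral_multc)
  also have "\<dots> < \<infinity>"
    using nn_integral_inverse_norm_finite[where 'a = "real ^ 'd"] d emeasure_lborel_cball_finite[of "0 :: real ^ 'd" 1]
    by (auto simp: ennreal_mult_less_top)
  finally have w_fin: "(\<integral>\<^sup>+p. w p \<partial>lborel) < \<infinity>" .
  have lims: "\<exists>u. norm u = 1 \<and> (\<forall>z. (\<lambda>m. f m (x, z)) \<longlonglongrightarrow>
      indicator {x. 0 < G x \<and> G x \<le> \<delta>} x * (indicator (cball 0 1) (x, z) * ennreal ((u \<bullet> z) / norm x)))" for x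
  proof -
    consider "G x \<le> 0" | "0 < G x" "G x \<le> \<delta>" | "\<delta> < G x" by linarith
    then show ?thesis
    proof cases
      case 1
      then have "f m (x, z) = 0" for m z using lo by (auto simp: f_def ennreal_neg)
      then show ?thesis using 1 c by (intro exI[of _ c]) simp
    next
      case 2
      have x: "x \<noteq> 0" "\<bar>c \<bullet> x\<bar> < norm x" using 2 lo c latitude_interior[of c x] by (auto simp: G_def)
      obtain u where u: "norm u = 1"
        "\<And>z. (\<lambda>m. real (m + 3) / pi * (latitude c x - latitude c (ellipse x z (pi / real (m + 3))))) \<longlonglongrightarrow> (u \<bullet> z) / norm x"
        using latitude_decrease_limit[OF c x(2)] by blast
      have "(\<lambda>m. f m (x, z)) \<longlonglongrightarrow> indicator (cball 0 1) (x, z) * ennreal ((u \<bullet> z) / norm x)" for z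
      proof -
        define g where "g m = indicator (cball 0 1) (x, z) *
          ennreal (real (m + 3) / pi * (latitude c x - latitude c (ellipse x z (pi / real (m + 3)))))" for m
        have g: "g \<longlonglongrightarrow> indicator (cball 0 1) (x, z) * ennreal ((u \<bullet> z) / norm x)"
          unfolding g_def by (intro tendsto_mult_ennreal tendsto_const tendsto_ennrealI u(2)) (auto simp: indicator_def)
        have "(\<lambda>m. latitude c (ellipse x z (pi / real (m + 3)))) \<longlonglongrightarrow> latitude c x"
          by (rule latitude_ellipse_tendsto[OF c x(1) step_tendsto_0])
        then have "\<forall>\<^sub>F m in sequentially. lo < latitude c (ellipse x z (pi / real (m + 3)))"
          using 2 by (intro order_tendstoD) (auto simp: G_def)
        then have "\<forall>\<^sub>F m in sequentially. g m = f m (x, z)"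
        proof eventually_elim
          case (elim m)
          have "min \<delta> (G x) - max 0 (G (ellipse x z (pi / real (m + 3)))) = latitude c x - latitude c (ellipse x z (pi / real (m + 3)))"
            using 2 elim by (simp add: G_def)
          moreover have "0 \<le> real (m + 3) / pi" by simp
          ultimately show ?case unfolding g_def f_def fst_conv snd_conv by (simp only: ennreal_mult' ac_simps)
        qed
        with g show ?thesis by (rule Lim_transform_eventually)
      qed
      then show ?thesis using u(1) 2 by auto
    next
      case 3
      have "(\<lambda>m. f m (x, z)) \<longlonglongrightarrow> 0" for z
      proof -
        have x: "x \<noteq> 0" using 3 G0 lo by auto
        have "\<forall>\<^sub>F m in sequentially. lo + \<delta> < latitude c (ellipse x z (pi / real (m + 3)))"
          using 3 by (intro order_tendstoD(1)[OF latitude_ellipse_tendsto[OF c x step_tendsto_0]]) (auto simp: G_def)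
        then have "\<forall>\<^sub>F m in sequentially. f m (x, z) = 0"
          by eventually_elim (auto simp: f_def G_def ennreal_neg)
        then show ?thesis by (rule tendsto_eventually)
      qed
      then show ?thesis using 3 c by (intro exI[of _ c]) auto
    qed
  qed
  have lim: "(\<lambda>m. f m p) \<longlonglongrightarrow> v p" for p
  proof -
    obtain x z where p: "p = (x, z)" by (cases p)
    obtain l where "(\<lambda>m. f m p) \<longlonglongrightarrow> l" using lims[of x] unfolding p by blast
    then show ?thesis by (simp add: v_def lim_imp_Liminf)
  qed
  have "(\<lambda>m. \<integral>\<^sup>+p. f m p \<partial>lborel) \<longlonglongrightarrow> (\<integral>\<^sup>+p. v p \<partial>lborel)"
    by (rule nn_integral_dominated_convergence[where w = w]) (use f_le lim w_fin in auto)
  also have "(\<lambda>m. \<integral>\<^sup>+p. f m p \<partial>lborel) = (\<lambda>m. ennreal (real (m + 3) / pi) * mean_drop G \<delta> (pi / real (m + 3)))"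
    by (simp only: fint)
  also have "(\<integral>\<^sup>+p. v p \<partial>lborel) = (\<integral>\<^sup>+x. (\<integral>\<^sup>+z. v (x, z) \<partial>lborel) \<partial>lborel)"
    by (rule pair_integral) measurable
  also have "\<dots> = drift_mass {x. 0 < G x \<and> G x \<le> \<delta>}"
    unfolding drift_mass_def
  proof (rule nn_integral_cong)
    fix x
    obtain u where u: "norm u = 1" "\<And>z. (\<lambda>m. f m (x, z)) \<longlonglongrightarrow>
      indicator {x. 0 < G x \<and> G x \<le> \<delta>} x * (indicator (cball 0 1) (x, z) * ennreal ((u \<bullet> z) / norm x))"
      using lims by blast
    have "v (x, z) = indicator {x. 0 < G x \<and> G x \<le> \<delta>} x * (indicator (cball 0 1) (x, z) * ennreal ((u \<bullet> z) / norm x))" for z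
      using LIMSEQ_unique[OF lim u(2)] .
    then have "(\<integral>\<^sup>+z. v (x, z) \<partial>lborel) = indicator {x. 0 < G x \<and> G x \<le> \<delta>} x *
        (\<integral>\<^sup>+z. indicator (cball 0 1) (x, z) * ennreal ((u \<bullet> z) / norm x) \<partial>lborel)"
      by (simp add: nn_integral_cmult)
    then show "(\<integral>\<^sup>+z. v (x, z) \<partial>lborel) = indicator {x. 0 < G x \<and> G x \<le> \<delta>} x * drift_density x"
      by (simp only: drift_integral[OF u(1)])
  qed
  finally show ?thesis .
qed

text \<open>Perimeter monotonicity in integrated form. Read \<open>F\<close> as the depth in a convex cone that is contained in the cone
over the cap with latitude at least \<open>lo\<close>; the depth in the latter is \<open>latitude c x - lo\<close>.\<close>

lemma layer_comparison:
  fixes F :: "real ^ 'd \<Rightarrow> real" and c :: "real ^ 'd"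
  assumes Fm: "F \<in> borel_measurable borel"
    and c: "norm c = 1" and lo: "0 \<le> lo" "0 < \<delta>" "lo + \<delta> < pi / 2" and d: "2 \<le> CARD('d)"
    and cone: "\<And>s. 0 < s \<Longrightarrow> s < \<delta> \<Longrightarrow> blunt_convex_cone {x. s < F x}"
    and sub: "\<And>s x. 0 < s \<Longrightarrow> s < \<delta> \<Longrightarrow> s < F x \<Longrightarrow> s < latitude c x - lo"
    and support: "\<And>x. 0 < F x \<Longrightarrow> F x \<le> \<delta> \<Longrightarrow>
      \<exists>b. norm b = 1 \<and> F x = latitude b x \<and> (\<forall>y. F y \<le> max 0 (latitude b y))"
  shows "drift_mass {x. 0 < F x \<and> F x \<le> \<delta>}
    \<le> drift_mass {x. 0 < latitude c x - lo \<and> latitude c x - lo \<le> \<delta>}"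
proof -
  let ?I = "\<lambda>F m. ennreal (real (m + 3) / pi) * mean_drop F \<delta> (pi / real (m + 3))"
  have "0 < c \<bullet> x" if "0 < latitude c x - lo" for x
  proof -
    have "x \<noteq> 0" using that lo by (auto simp: latitude_def)
    have "sin 0 < sin (latitude c x)"
      using that lo latitude_bounds[OF c, of x] by (intro sin_monotone_2pi) auto
    then show ?thesis using \<open>x \<noteq> 0\<close> by (simp add: latitude_bounds(3)[OF c] zero_less_mult_iff)
  qed
  then have "?I F m \<le> ?I (\<lambda>x. latitude c x - lo) m" for m
    using latitude_measurable[OF c]
    by (intro mult_left_mono exit_depth_mono[OF Fm _ cone sub, where c = c]) auto
  then have "liminf (?I F) \<le> liminf (?I (\<lambda>x. latitude c x - lo))" by (intro Liminf_mono always_eventually) auto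
  also have "\<dots> = drift_mass {x. 0 < latitude c x - lo \<and> latitude c x - lo \<le> \<delta>}"
    by (rule lim_imp_Liminf[OF trivial_limit_sequentially layer_upper_limit[OF c lo d]])
  finally have "liminf (?I F) \<le> drift_mass {x. 0 < latitude c x - lo \<and> latitude c x - lo \<le> \<delta>}" .
  moreover have "\<delta> < pi / 2" using lo by linarith
  then have "drift_mass {x. 0 < F x \<and> F x \<le> \<delta>} \<le> liminf (?I F)"
    by (rule layer_lower_limit[OF Fm _ support])
  ultimately show ?thesis by (rule order.trans[rotated])
qed

section \<open>Volume of spherical caps\<close>

text \<open>A truncated circular cone with axis \<open>c\<close>, height \<open>r\<close> and slope \<open>t\<close>. Truncation by a hyperplane instead of a sphere makes
the pieces linear images of each other.\<close>

definition cone_piece :: "'a::euclidean_space \<Rightarrow> real \<Rightarrow> real \<Rightarrow> 'a set" where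
  "cone_piece c r t = {x. 0 < c \<bullet> x \<and> c \<bullet> x \<le> r \<and> norm (x - (c \<bullet> x) *\<^sub>R c) < t * (c \<bullet> x)}"

lemma cone_piece_borel[measurable]: "cone_piece c r t \<in> sets borel"
  unfolding cone_piece_def by measurable

lemma emeasure_cone_piece:
  fixes c :: "'a::euclidean_space"
  assumes c: "c \<in> Basis" and r: "0 < r" and t: "0 < t"
  shows "emeasure lborel (cone_piece c r t) = ennreal (r ^ DIM('a) * t ^ (DIM('a) - 1)) * emeasure lborel (cone_piece c 1 1)"
proof -
  define a where "a j = (if j = c then r else r * t)" for j
  define T where "T x = 0 + (\<Sum>j\<in>Basis. (a j * (x \<bullet> j)) *\<^sub>R j)" for x :: 'a
  have a: "a j \<noteq> 0" for j using r t by (simp add: a_def)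
  have lb: "lborel = density (distr lborel borel T) (\<lambda>_. \<Prod>j\<in>Basis. \<bar>a j\<bar>)"
    unfolding T_def by (rule lborel_affine_euclidean) (rule a)
  have Tj: "T x \<bullet> j = a j * (x \<bullet> j)" if "j \<in> Basis" for x j
    using that by (simp add: T_def inner_sum_left inner_Basis if_distrib sum.delta cong: if_cong)
  have [measurable]: "T \<in> borel_measurable borel" unfolding T_def[abs_def] by measurable
  have T: "T x = (r * t) *\<^sub>R x + (r * (1 - t) * (c \<bullet> x)) *\<^sub>R c" for x
  proof (rule euclidean_eqI)
    fix j :: 'a assume j: "j \<in> Basis"
    show "T x \<bullet> j = ((r * t) *\<^sub>R x + (r * (1 - t) * (c \<bullet> x)) *\<^sub>R c) \<bullet> j"
      using j c by (auto simp: Tj a_def inner_add_left inner_Basis inner_commute[of c x] algebra_simps)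
  qed
  have cc: "c \<bullet> c = 1" using c by (simp add: inner_Basis)
  have cT: "c \<bullet> T x = r * (c \<bullet> x)" for x by (simp add: T inner_add_right cc algebra_simps)
  have pT: "T x - (r * (c \<bullet> x)) *\<^sub>R c = (r * t) *\<^sub>R (x - (c \<bullet> x) *\<^sub>R c)" for x
    by (simp add: T algebra_simps)
  have vim: "T -` cone_piece c r t = cone_piece c 1 1"
    unfolding cone_piece_def vimage_def mem_Collect_eq cT pT norm_scaleR using r t
    by (auto simp: zero_less_mult_iff abs_mult)
  have prod: "(\<Prod>j\<in>Basis. \<bar>a j\<bar>) = r ^ DIM('a) * t ^ (DIM('a) - 1)"
  proof -
    have "(\<Prod>j\<in>Basis. \<bar>a j\<bar>) = \<bar>a c\<bar> * (\<Prod>j\<in>Basis - {c}. \<bar>a j\<bar>)"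
      using c by (simp add: prod.remove)
    also have "(\<Prod>j\<in>Basis - {c}. \<bar>a j\<bar>) = (\<Prod>j\<in>(Basis :: 'a set) - {c}. r * t)"
      using r t by (intro prod.cong) (auto simp: a_def abs_mult)
    also have "\<dots> = (r * t) ^ (DIM('a) - 1)" using c by simp
    also have "\<bar>a c\<bar> * (r * t) ^ (DIM('a) - 1) = r ^ DIM('a) * t ^ (DIM('a) - 1)"
      using r DIM_positive[where 'a = 'a]
      by (cases "DIM('a)") (auto simp: a_def power_mult_distrib)
    finally show ?thesis .
  qed
  have "emeasure lborel (cone_piece c r t) = emeasure (density (distr lborel borel T) (\<lambda>_. \<Prod>j\<in>Basis. \<bar>a j\<bar>)) (cone_piece c r t)"
    using lb by simp
  also have "\<dots> = ennreal (\<Prod>j\<in>Basis. \<bar>a j\<bar>) * emeasure lborel (cone_piece c 1 1)"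
    by (subst emeasure_density_const) (auto simp: emeasure_distr vim)
  finally show ?thesis by (simp add: prod)
qed

lemma latitude_cone_iff:
  assumes c: "norm c = 1" and \<phi>: "0 < \<phi>" "\<phi> < pi / 2"
  shows "pi / 2 - \<phi> < latitude c x \<longleftrightarrow> 0 < c \<bullet> x \<and> norm (x - (c \<bullet> x) *\<^sub>R c) < tan \<phi> * (c \<bullet> x)"
proof -
  have s: "0 < sin \<phi>" "0 < cos \<phi>" using \<phi> by (auto intro!: sin_gt_zero cos_gt_zero_pi)
  have "pi / 2 - \<phi> < latitude c x \<longleftrightarrow> sin (pi / 2 - \<phi>) < sin (latitude c x)"
    using \<phi> latitude_bounds[OF c, of x] by (intro sin_mono_less_eq[symmetric]) auto
  also have "\<dots> \<longleftrightarrow> cos \<phi> < c \<bullet> (x /\<^sub>R norm x)" by (simp add: latitude_bounds(3)[OF c] sin_diff)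
  also have "\<dots> \<longleftrightarrow> cos \<phi> * norm x < c \<bullet> x"
    using s by (cases "x = 0") (auto simp: field_simps)
  also have "\<dots> \<longleftrightarrow> 0 < c \<bullet> x \<and> norm (x - (c \<bullet> x) *\<^sub>R c) < tan \<phi> * (c \<bullet> x)"
  proof (cases "0 < c \<bullet> x")
    case True
    define p where "p = norm (x - (c \<bullet> x) *\<^sub>R c)"
    have cc: "c \<bullet> c = 1" using c by (simp add: norm_eq_1)
    have sq: "a < b \<longleftrightarrow> a\<^sup>2 < b\<^sup>2" if "0 \<le> a" "0 \<le> b" for a b :: real
      using that by (meson power2_less_imp_less power_strict_mono zero_less_numeral)
    have p2: "p\<^sup>2 = (norm x)\<^sup>2 - (c \<bullet> x)\<^sup>2"
      unfolding p_def power2_norm_eq_inner power2_eq_square[of "c \<bullet> x"]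
      by (simp add: inner_diff_left inner_diff_right cc inner_commute[of x c] algebra_simps)
    have "cos \<phi> * norm x < c \<bullet> x \<longleftrightarrow> (cos \<phi> * norm x)\<^sup>2 < (c \<bullet> x)\<^sup>2"
      using s True by (intro sq) auto
    also have "\<dots> \<longleftrightarrow> (cos \<phi>)\<^sup>2 * p\<^sup>2 < (sin \<phi>)\<^sup>2 * (c \<bullet> x)\<^sup>2"
      by (simp add: p2 power_mult_distrib sin_squared_eq algebra_simps)
    also have "\<dots> \<longleftrightarrow> cos \<phi> * p < sin \<phi> * (c \<bullet> x)"
      unfolding power_mult_distrib[symmetric]
      using s True by (intro sq[symmetric]) (auto simp: p_def)
    also have "\<dots> \<longleftrightarrow> p < tan \<phi> * (c \<bullet> x)" using s by (simp add: tan_def field_simps)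
    finally show ?thesis using True by (simp add: p_def)
  next
    case False
    moreover have "0 \<le> cos \<phi> * norm x" using s by simp
    ultimately show ?thesis by linarith
  qed
  finally show ?thesis .
qed

text \<open>The volume of the sector of the unit ball over an open cap of radius \<open>\<phi>\<close>; a multiple of the measure of the cap.\<close>

definition cap_volume :: "'a::euclidean_space \<Rightarrow> real \<Rightarrow> real" where
  "cap_volume c \<phi> = measure lborel {x \<in> cball 0 1. pi / 2 - \<phi> < latitude c x}"

lemma cap_sets[measurable]: "norm c = 1 \<Longrightarrow> {x. r < latitude (c :: 'a::euclidean_space) x} \<in> sets borel"
  "norm c = 1 \<Longrightarrow> {x \<in> cball 0 1. r < latitude (c :: 'a::euclidean_space) x} \<in> sets lborel"
proof -
  assume c: "norm c = 1"
  have [measurable]: "latitude c \<in> borel_measurable borel" by (rule latitude_measurable[OF c])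
  show "{x. r < latitude c x} \<in> sets borel" "{x \<in> cball 0 1. r < latitude c x} \<in> sets lborel" by measurable
qed

lemma cap_fmeasurable: "norm c = 1 \<Longrightarrow> {x \<in> cball 0 1. r < latitude (c :: 'a::euclidean_space) x} \<in> fmeasurable lborel"
proof -
  assume c: "norm c = 1"
  have "cball (0 :: 'a) 1 \<in> fmeasurable lborel"
    using emeasure_lborel_cball_finite[of "0::'a" 1] by (simp add: fmeasurable_def)
  then show "{x \<in> cball 0 1. r < latitude c x} \<in> fmeasurable lborel"
    by (rule fmeasurableI2[OF _ _ cap_sets(2)[OF c]]) (rule Collect_subset)
qed

lemma cap_volume_mono: "norm c = 1 \<Longrightarrow> \<phi> \<le> \<psi> \<Longrightarrow> cap_volume (c :: 'a::euclidean_space) \<phi> \<le> cap_volume c \<psi>"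
  unfolding cap_volume_def by (intro measure_mono_fmeasurable cap_fmeasurable cap_sets(2)) auto

context
  fixes c :: "'a::euclidean_space" and n :: nat
  assumes c: "c \<in> Basis" and n: "DIM('a) = Suc n" "1 \<le> n"
begin

lemma c1: "norm c = 1" using c by simp

lemma cone_piece_measure:
  assumes "0 < r" "0 < t"
  shows "cone_piece c r t \<in> fmeasurable lborel"
    "measure lborel (cone_piece c r t) = r ^ Suc n * t ^ n * measure lborel (cone_piece c 1 1)"
proof -
  have "cone_piece c 1 1 \<subseteq> cball 0 2"
  proof
    fix x assume x: "x \<in> cone_piece c 1 1"
    have "norm x \<le> norm (x - (c \<bullet> x) *\<^sub>R c) + norm ((c \<bullet> x) *\<^sub>R c)"
      using norm_triangle_ineq[of "x - (c \<bullet> x) *\<^sub>R c" "(c \<bullet> x) *\<^sub>R c"] by simp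
    then show "x \<in> cball 0 2" using x c by (auto simp: cone_piece_def)
  qed
  then have "emeasure lborel (cone_piece c 1 1) \<le> emeasure lborel (cball (0::'a) 2)"
    by (intro emeasure_mono) auto
  then have fin: "emeasure lborel (cone_piece c 1 1) < \<infinity>"
    using emeasure_lborel_cball_finite[of "0::'a" 2] by (simp add: order.strict_trans1)
  then show "cone_piece c r t \<in> fmeasurable lborel"
    by (auto simp: fmeasurable_def emeasure_cone_piece[OF c assms] ennreal_mult_less_top)
  show "measure lborel (cone_piece c r t) = r ^ Suc n * t ^ n * measure lborel (cone_piece c 1 1)"
    using assms by (simp add: measure_def emeasure_cone_piece[OF c assms] n enn2real_mult)
qed

text \<open>On the annulus between the angles \<open>\<phi>\<close> and \<open>\<psi>\<close>, truncation of the cone by the unit sphere lies between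
truncation by the hyperplanes at heights \<open>cos \<psi>\<close> and \<open>cos \<phi>\<close>.\<close>

lemma cap_volume_increment:
  assumes "0 < \<phi>" "\<phi> < \<psi>" "\<psi> < pi / 2"
  defines "G \<equiv> measure lborel (cone_piece c 1 1)"
  shows "cos \<psi> ^ Suc n * G * (tan \<psi> ^ n - tan \<phi> ^ n) \<le> cap_volume c \<psi> - cap_volume c \<phi>"
    and "cap_volume c \<psi> - cap_volume c \<phi> \<le> cos \<phi> ^ Suc n * G * (tan \<psi> ^ n - tan \<phi> ^ n)"
proof -
  let ?C = "\<lambda>\<phi>. {x \<in> cball 0 1. pi / 2 - \<phi> < latitude c x}"
  have pos: "0 < cos \<phi>" "0 < cos \<psi>" "0 < tan \<phi>" "0 < tan \<psi>" "tan \<phi> < tan \<psi>"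
    using assms by (auto intro!: cos_gt_zero_pi tan_gt_zero tan_monotone)
  have piece: "measure lborel (cone_piece c r (tan \<psi>) - cone_piece c r (tan \<phi>)) = r ^ Suc n * G * (tan \<psi> ^ n - tan \<phi> ^ n)"
    if "0 < r" for r
  proof -
    have "cone_piece c r (tan \<phi>) \<subseteq> cone_piece c r (tan \<psi>)"
      using pos by (auto simp: cone_piece_def intro: order.strict_trans2 mult_right_mono)
    then have "measure lborel (cone_piece c r (tan \<psi>) - cone_piece c r (tan \<phi>)) = measure lborel (cone_piece c r (tan \<psi>)) - measure lborel (cone_piece c r (tan \<phi>))"
      using cone_piece_measure(1)[OF that pos(3)] cone_piece_measure(1)[OF that pos(4)]
      by (intro measure_Diff) (auto simp: fmeasurable_def)
    then show ?thesis
      by (simp only: cone_piece_measure(2)[OF that pos(3)] cone_piece_measure(2)[OF that pos(4)] G_def) (simp add: algebra_simps)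
  qed
  have diff: "measure lborel (?C \<psi> - ?C \<phi>) = cap_volume c \<psi> - cap_volume c \<phi>"
    unfolding cap_volume_def
  proof (rule measure_Diff)
    show "emeasure lborel (?C \<psi>) \<noteq> \<infinity>"
      using fmeasurableD2[OF cap_fmeasurable[OF c1, of "pi / 2 - \<psi>"]] unfolding infinity_ennreal_def .
  qed (use assms cap_sets(2)[OF c1] in auto)
  have cx: "c \<bullet> x = norm x * sin (latitude c x)" for x
    by (cases "x = 0") (simp_all add: latitude_bounds(3)[OF c1])
  have cap_iff: "pi / 2 - \<phi> < latitude c x \<longleftrightarrow> 0 < c \<bullet> x \<and> norm (x - (c \<bullet> x) *\<^sub>R c) < tan \<phi> * (c \<bullet> x)"
    "pi / 2 - \<psi> < latitude c x \<longleftrightarrow> 0 < c \<bullet> x \<and> norm (x - (c \<bullet> x) *\<^sub>R c) < tan \<psi> * (c \<bullet> x)" for x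
    using assms by (intro latitude_cone_iff[OF c1]; simp)+
  have lower: "cos \<psi> * norm x \<le> c \<bullet> x" if "pi / 2 - \<psi> < latitude c x" for x
  proof -
    have "sin (pi / 2 - \<psi>) \<le> sin (latitude c x)"
      using that assms latitude_bounds[OF c1, of x] by (intro sin_monotone_2pi_le) auto
    then have "norm x * cos \<psi> \<le> norm x * sin (latitude c x)" by (intro mult_left_mono) (auto simp: sin_diff)
    then show ?thesis by (simp add: cx[of x] mult.commute)
  qed
  have upper: "c \<bullet> x \<le> cos \<phi> * norm x" if "\<not> pi / 2 - \<phi> < latitude c x" for x
  proof -
    have "sin (latitude c x) \<le> sin (pi / 2 - \<phi>)"
      using that assms latitude_bounds[OF c1, of x] by (intro sin_monotone_2pi_le) auto
    then have "norm x * sin (latitude c x) \<le> norm x * cos \<phi>" by (intro mult_left_mono) (auto simp: sin_diff)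
    then show ?thesis by (simp add: cx[of x] mult.commute)
  qed
  have "cone_piece c (cos \<psi>) (tan \<psi>) - cone_piece c (cos \<psi>) (tan \<phi>) \<subseteq> ?C \<psi> - ?C \<phi>"
  proof
    fix x assume x: "x \<in> cone_piece c (cos \<psi>) (tan \<psi>) - cone_piece c (cos \<psi>) (tan \<phi>)"
    then have 1: "pi / 2 - \<psi> < latitude c x" "\<not> pi / 2 - \<phi> < latitude c x" "c \<bullet> x \<le> cos \<psi>"
      unfolding cap_iff by (auto simp: cone_piece_def)
    have "cos \<psi> * norm x \<le> cos \<psi> * 1" using lower[OF 1(1)] 1(3) by simp
    then have "norm x \<le> 1" using pos by (simp only: mult_le_cancel_left_pos)
    then show "x \<in> ?C \<psi> - ?C \<phi>" using 1 by simp
  qed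
  then have "measure lborel (cone_piece c (cos \<psi>) (tan \<psi>) - cone_piece c (cos \<psi>) (tan \<phi>)) \<le> measure lborel (?C \<psi> - ?C \<phi>)"
    by (intro measure_mono_fmeasurable fmeasurable_Diff cap_fmeasurable c1 cap_sets(2) sets.Diff) simp_all
  then show "cos \<psi> ^ Suc n * G * (tan \<psi> ^ n - tan \<phi> ^ n) \<le> cap_volume c \<psi> - cap_volume c \<phi>"
    by (simp only: piece[OF pos(2)] diff)
  have "?C \<psi> - ?C \<phi> \<subseteq> cone_piece c (cos \<phi>) (tan \<psi>) - cone_piece c (cos \<phi>) (tan \<phi>)"
  proof
    fix x assume x: "x \<in> ?C \<psi> - ?C \<phi>"
    then have 1: "pi / 2 - \<psi> < latitude c x" "\<not> pi / 2 - \<phi> < latitude c x" "norm x \<le> 1" by auto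
    have "c \<bullet> x \<le> cos \<phi> * 1" using upper[OF 1(2)] mult_left_mono[OF 1(3), of "cos \<phi>"] pos by linarith
    then show "x \<in> cone_piece c (cos \<phi>) (tan \<psi>) - cone_piece c (cos \<phi>) (tan \<phi>)"
      using 1(1,2) unfolding cap_iff by (auto simp: cone_piece_def)
  qed
  then have "measure lborel (?C \<psi> - ?C \<phi>) \<le> measure lborel (cone_piece c (cos \<phi>) (tan \<psi>) - cone_piece c (cos \<phi>) (tan \<phi>))"
    using cone_piece_measure(1)[OF pos(1) pos(4)]
    by (intro measure_mono_fmeasurable fmeasurable_Diff sets.Diff cap_sets(2) c1) simp_all
  then show "cap_volume c \<psi> - cap_volume c \<phi> \<le> cos \<phi> ^ Suc n * G * (tan \<psi> ^ n - tan \<phi> ^ n)"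
    by (simp only: piece[OF pos(1)] diff)
qed

text \<open>The two bounds of \<open>cap_volume_increment\<close> have the same first-order behaviour, and
\<open>cos^(n+1) * (tan^n)' = n * sin^(n-1)\<close>.\<close>

lemma cap_volume_derivative:
  assumes "0 < \<phi>" "\<phi> < pi / 2"
  shows "(cap_volume c has_real_derivative measure lborel (cone_piece c 1 1) * n * sin \<phi> ^ (n - 1)) (at \<phi>)"
proof -
  define G where "G = measure lborel (cone_piece c 1 1)"
  define q where "q \<psi> = (tan \<psi> ^ n - tan \<phi> ^ n) / (\<psi> - \<phi>)" for \<psi>
  define D where "D = real n * tan \<phi> ^ (n - 1) * inverse ((cos \<phi>)\<^sup>2)"
  have c0: "cos \<phi> \<noteq> 0" using assms cos_gt_zero_pi[of \<phi>] by auto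
  have "((\<lambda>x. tan x ^ n) has_real_derivative D) (at \<phi>)"
    unfolding D_def using c0 by (auto intro!: derivative_eq_intros)
  then have q: "(q \<longlongrightarrow> D) (at \<phi>)" by (simp add: has_field_derivative_iff q_def[abs_def])
  have near: "\<forall>\<^sub>F \<psi> in at \<phi>. 0 < \<psi> \<and> \<psi> < pi / 2 \<and> \<psi> \<noteq> \<phi>"
    using assms by (intro eventually_conj order_tendstoD[OF tendsto_ident_at] eventually_neq_at_within) auto
  have bound: "\<bar>(cap_volume c \<psi> - cap_volume c \<phi>) / (\<psi> - \<phi>) - cos \<phi> ^ Suc n * G * q \<psi>\<bar>
     \<le> \<bar>(cos \<psi> ^ Suc n - cos \<phi> ^ Suc n) * G * q \<psi>\<bar>" if \<psi>: "0 < \<psi> \<and> \<psi> < pi / 2 \<and> \<psi> \<noteq> \<phi>" for \<psi>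
  proof -
    define A where "A = cap_volume c \<psi> - cap_volume c \<phi>"
    define B where "B = G * (tan \<psi> ^ n - tan \<phi> ^ n)"
    have "\<bar>A - cos \<phi> ^ Suc n * B\<bar> \<le> \<bar>cos \<psi> ^ Suc n * B - cos \<phi> ^ Suc n * B\<bar>"
    proof (cases "\<phi> < \<psi>")
      case True
      then show ?thesis using cap_volume_increment[of \<phi> \<psi>] assms \<psi> by (simp add: A_def B_def G_def mult.assoc)
    next
      case False
      then have "\<psi> < \<phi>" using \<psi> by auto
      then show ?thesis using cap_volume_increment[of \<psi> \<phi>] assms \<psi> by (simp add: A_def B_def G_def algebra_simps)
    qed
    then have "\<bar>A - cos \<phi> ^ Suc n * B\<bar> / \<bar>\<psi> - \<phi>\<bar> \<le> \<bar>cos \<psi> ^ Suc n * B - cos \<phi> ^ Suc n * B\<bar> / \<bar>\<psi> - \<phi>\<bar>"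
      by (rule divide_right_mono) simp
    moreover have "A' / e - k * G * (t / e) = (A' - k * (G * t)) / e"
        "(k - k') * G * (t / e) = (k * (G * t) - k' * (G * t)) / e" for A' e k k' t
      by (simp_all add: diff_divide_distrib left_diff_distrib mult.assoc)
    then have "A / (\<psi> - \<phi>) - cos \<phi> ^ Suc n * G * q \<psi> = (A - cos \<phi> ^ Suc n * B) / (\<psi> - \<phi>)"
      "(cos \<psi> ^ Suc n - cos \<phi> ^ Suc n) * G * q \<psi> = (cos \<psi> ^ Suc n * B - cos \<phi> ^ Suc n * B) / (\<psi> - \<phi>)"
      unfolding q_def B_def by blast+
    ultimately show ?thesis by (simp only: A_def abs_divide)
  qed
  have "((\<lambda>\<psi>. (cos \<psi> ^ Suc n - cos \<phi> ^ Suc n) * G * q \<psi>) \<longlongrightarrow> (cos \<phi> ^ Suc n - cos \<phi> ^ Suc n) * G * D) (at \<phi>)"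
    by (intro tendsto_intros q)
  then have "((\<lambda>\<psi>. \<bar>(cos \<psi> ^ Suc n - cos \<phi> ^ Suc n) * G * q \<psi>\<bar>) \<longlongrightarrow> 0) (at \<phi>)"
    by (simp add: tendsto_rabs_zero_iff)
  then have "((\<lambda>\<psi>. (cap_volume c \<psi> - cap_volume c \<phi>) / (\<psi> - \<phi>) - cos \<phi> ^ Suc n * G * q \<psi>) \<longlongrightarrow> 0) (at \<phi>)"
    by (rule Lim_null_comparison[rotated]) (use near bound in \<open>auto elim: eventually_mono\<close>)
  moreover have "((\<lambda>\<psi>. cos \<phi> ^ Suc n * G * q \<psi>) \<longlongrightarrow> cos \<phi> ^ Suc n * G * D) (at \<phi>)" by (intro tendsto_intros q)
  ultimately have "((\<lambda>\<psi>. (cap_volume c \<psi> - cap_volume c \<phi>) / (\<psi> - \<phi>)) \<longlongrightarrow> cos \<phi> ^ Suc n * G * D) (at \<phi>)"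
    using tendsto_add by fastforce
  moreover have "cos \<phi> ^ Suc n * G * D = G * n * sin \<phi> ^ (n - 1)"
  proof -
    obtain k where k: "n = Suc k" using n(2) by (cases n) auto
    show ?thesis using c0 by (simp add: D_def k tan_def power_divide power2_eq_square field_simps)
  qed
  ultimately show ?thesis by (simp only: has_field_derivative_iff G_def)
qed

text \<open>The difference of the two sides has derivative proportional to \<open>l * sin (l \<phi>)^(n-1) - l^n * sin \<phi>^(n-1)\<close>,
which is nonnegative since \<open>sin\<close> is concave, and it tends to a nonnegative limit at 0.\<close>

lemma cap_volume_scale_open:
  assumes l: "0 < l" "l \<le> 1" and \<phi>: "0 < \<phi>" "\<phi> < pi / 2"
  shows "l ^ n * cap_volume c \<phi> \<le> cap_volume c (l * \<phi>)"
proof -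
  define G where "G = measure lborel (cone_piece c 1 1)"
  define k where "k \<psi> = cap_volume c (l * \<psi>) - l ^ n * cap_volume c \<psi>" for \<psi>
  have l_le: "l * \<psi> \<le> \<psi>" if "0 < \<psi>" for \<psi> using l that by (simp add: mult_le_cancel_right1)
  have k': "(k has_real_derivative G * n * (sin (l * \<psi>) ^ (n - 1) * l - l ^ n * sin \<psi> ^ (n - 1))) (at \<psi>)"
    if "0 < \<psi>" "\<psi> < pi / 2" for \<psi>
  proof -
    have "((\<lambda>\<psi>. cap_volume c (l * \<psi>)) has_real_derivative (G * n * sin (l * \<psi>) ^ (n - 1)) * l) (at \<psi>)"
    proof -
      have "0 < l * \<psi>" "l * \<psi> < pi / 2" using l that l_le[OF that(1)] by (simp, linarith)
      then show ?thesis unfolding G_def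
        by (intro DERIV_chain2[OF cap_volume_derivative]) (auto intro!: derivative_eq_intros)
    qed
    moreover have "((\<lambda>\<psi>. l ^ n * cap_volume c \<psi>) has_real_derivative l ^ n * (G * n * sin \<psi> ^ (n - 1))) (at \<psi>)"
      unfolding G_def using that by (intro DERIV_cmult cap_volume_derivative)
    ultimately have "(k has_real_derivative (G * n * sin (l * \<psi>) ^ (n - 1)) * l - l ^ n * (G * n * sin \<psi> ^ (n - 1))) (at \<psi>)"
      unfolding k_def by (rule DERIV_diff)
    then show ?thesis by (simp add: algebra_simps)
  qed
  have sin_l: "l * sin \<psi> \<le> sin (l * \<psi>)" if "0 < \<psi>" "\<psi> < pi / 2" for \<psi>
  proof -
    have "sin (l * 0) - l * sin 0 \<le> sin (l * \<psi>) - l * sin \<psi>"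
    proof (rule DERIV_nonneg_imp_nondecreasing[of 0 \<psi>])
      fix x assume x: "0 \<le> x" "x \<le> \<psi>"
      have "cos x \<le> cos (l * x)" using x that l mult_right_mono[of l 1 x] by (intro cos_monotone_0_pi_le) auto
      then show "\<exists>y. ((\<lambda>x. sin (l * x) - l * sin x) has_real_derivative y) (at x) \<and> 0 \<le> y"
        using l by (intro exI[of _ "cos (l * x) * l - l * cos x"]) (auto intro!: derivative_eq_intros)
    qed (use that in simp)
    then show ?thesis by simp
  qed
  have mono: "k \<epsilon> \<le> k \<phi>" if "0 < \<epsilon>" "\<epsilon> \<le> \<phi>" for \<epsilon>
  proof (rule DERIV_nonneg_imp_nondecreasing[OF that(2)])
    fix x assume x: "\<epsilon> \<le> x" "x \<le> \<phi>"
    have x': "0 < x" "x < pi / 2" using x that \<phi> by auto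
    have "(l * sin x) ^ (n - 1) \<le> sin (l * x) ^ (n - 1)"
      using x' l sin_gt_zero[of x] by (intro power_mono sin_l) auto
    then have "(l * sin x) ^ (n - 1) * l \<le> sin (l * x) ^ (n - 1) * l" using l by (intro mult_right_mono) auto
    moreover have "(l * sin x) ^ (n - 1) * l = l ^ n * sin x ^ (n - 1)"
      using n(2) by (cases n) (auto simp: power_mult_distrib)
    ultimately have "0 \<le> G * n * (sin (l * x) ^ (n - 1) * l - l ^ n * sin x ^ (n - 1))" by (simp add: G_def)
    then show "\<exists>y. (k has_real_derivative y) (at x) \<and> 0 \<le> y" using k'[OF x'] by blast
  qed
  have small: "cap_volume c \<epsilon> \<le> G * tan \<epsilon> ^ n" if "0 < \<epsilon>" "\<epsilon> < pi / 2" for \<epsilon>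
  proof -
    have t: "0 < tan \<epsilon>" using that by (rule tan_gt_zero)
    have "{x \<in> cball 0 1. pi / 2 - \<epsilon> < latitude c x} \<subseteq> cone_piece c 1 (tan \<epsilon>)"
    proof
      fix x assume x: "x \<in> {x \<in> cball 0 1. pi / 2 - \<epsilon> < latitude c x}"
      have "c \<bullet> x \<le> 1" using x norm_cauchy_schwarz[of c x] c1 by simp
      then show "x \<in> cone_piece c 1 (tan \<epsilon>)" using x latitude_cone_iff[OF c1 that, of x] by (auto simp: cone_piece_def)
    qed
    then have "cap_volume c \<epsilon> \<le> measure lborel (cone_piece c 1 (tan \<epsilon>))"
      unfolding cap_volume_def using cone_piece_measure(1)[of 1 "tan \<epsilon>"] t
      by (intro measure_mono_fmeasurable cap_sets(2) c1) simp_all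
    then show ?thesis using cone_piece_measure(2)[of 1 "tan \<epsilon>"] t by (simp add: G_def mult.commute)
  qed
  have "(\<lambda>\<epsilon>. - (G * tan \<epsilon> ^ n)) \<midarrow>0\<rightarrow> - (G * tan 0 ^ n)" by (intro tendsto_intros) auto
  then have "(\<lambda>\<epsilon>. - (G * tan \<epsilon> ^ n)) \<midarrow>0\<rightarrow> 0" using n(2) by (simp add: power_0_left)
  then have "((\<lambda>\<epsilon>. - (G * tan \<epsilon> ^ n)) \<longlongrightarrow> 0) (at_right 0)"
    by (rule tendsto_mono[OF at_le[OF subset_UNIV]])
  moreover have "\<forall>\<^sub>F \<epsilon> in at_right 0. - (G * tan \<epsilon> ^ n) \<le> k \<phi>"
  proof -
    have "\<forall>\<^sub>F \<epsilon> in at_right (0::real). \<epsilon> \<in> {0<..<\<phi>}" by (rule eventually_at_right_real[OF \<phi>(1)])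
    then show ?thesis
    proof eventually_elim
      case (elim \<epsilon>)
      have "l ^ n * cap_volume c \<epsilon> \<le> 1 * cap_volume c \<epsilon>"
        using l by (intro mult_right_mono power_le_one) (auto simp: cap_volume_def)
      moreover have "0 \<le> cap_volume c (l * \<epsilon>)" by (simp add: cap_volume_def)
      ultimately have "- cap_volume c \<epsilon> \<le> k \<epsilon>" unfolding k_def by linarith
      then show ?case using small[of \<epsilon>] mono[of \<epsilon>] elim \<phi> by auto
    qed
  qed
  ultimately have "0 \<le> k \<phi>" by (intro tendsto_upperbound[where F = "at_right (0::real)"]) auto
  then show ?thesis by (simp add: k_def)
qed

lemma cap_volume_scale:
  assumes l: "0 \<le> l" "l \<le> 1" and \<phi>: "0 < \<phi>" "\<phi> \<le> pi / 2"
  shows "l ^ n * cap_volume c \<phi> \<le> cap_volume c (l * \<phi>)"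
proof (cases "l = 0")
  case True
  then show ?thesis using n by (simp add: cap_volume_def power_0_left)
next
  case False
  then have l0: "0 < l" using l by simp
  (* The case \<phi> = pi / 2 is reached from below by continuity of the measure. *)
  define \<theta> where "\<theta> m = \<phi> - \<phi> / real (m + 2)" for m
  have \<theta>: "0 < \<theta> m" "\<theta> m < \<phi>" for m
  proof -
    have "\<phi> / real (m + 2) < \<phi> / 1" "0 < \<phi> / real (m + 2)"
      using \<phi> by (auto intro!: divide_strict_left_mono simp del: of_nat_add div_by_1)
    then show "0 < \<theta> m" "\<theta> m < \<phi>" by (auto simp: \<theta>_def simp del: of_nat_add)
  qed
  let ?C = "\<lambda>\<phi>. {x \<in> cball 0 1. pi / 2 - \<phi> < latitude c x}"
  have "(\<lambda>m. \<theta> m) \<longlonglongrightarrow> \<phi> - 0"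
    unfolding \<theta>_def by (intro tendsto_intros LIMSEQ_ignore_initial_segment[where f = "\<lambda>m. \<phi> / real m"] lim_const_over_n)
  then have th: "\<theta> \<longlonglongrightarrow> \<phi>" by simp
  have inc: "incseq \<theta>" using \<phi> by (auto simp: incseq_def \<theta>_def intro!: divide_left_mono)
  have "(\<lambda>m. measure lborel (?C (\<theta> m))) \<longlonglongrightarrow> measure lborel (\<Union>m. ?C (\<theta> m))"
  proof (rule Lim_measure_incseq)
    show "range (\<lambda>m. ?C (\<theta> m)) \<subseteq> sets lborel" using cap_sets(2)[OF c1] by auto
    show "incseq (\<lambda>m. ?C (\<theta> m))"
      using inc by (force simp: incseq_def intro: order.strict_trans1[rotated])
    have "emeasure lborel (\<Union>m. ?C (\<theta> m)) \<le> emeasure lborel (cball (0::'a) 1)" by (intro emeasure_mono) auto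
    then show "emeasure lborel (\<Union>m. ?C (\<theta> m)) \<noteq> \<infinity>"
      using emeasure_lborel_cball_finite[of "0::'a" 1] by auto
  qed
  also have "(\<Union>m. ?C (\<theta> m)) = ?C \<phi>"
  proof (intro set_eqI iffI)
    fix x assume "x \<in> ?C \<phi>"
    then have "pi / 2 - latitude c x < \<phi>" "norm x \<le> 1" by auto
    moreover have "\<forall>\<^sub>F m in sequentially. pi / 2 - latitude c x < \<theta> m" using order_tendstoD(1)[OF th] calculation by blast
    then obtain m where "pi / 2 - latitude c x < \<theta> m" by (metis eventually_False_sequentially eventually_mono)
    then have "pi / 2 - \<theta> m < latitude c x" by linarith
    ultimately show "x \<in> (\<Union>m. ?C (\<theta> m))" by auto
  next
    fix x assume "x \<in> (\<Union>m. ?C (\<theta> m))"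
    then obtain m where "x \<in> ?C (\<theta> m)" by blast
    then show "x \<in> ?C \<phi>" using \<theta>(2)[of m] by auto
  qed
  finally have lim: "(\<lambda>m. cap_volume c (\<theta> m)) \<longlonglongrightarrow> cap_volume c \<phi>" by (simp add: cap_volume_def)
  have "(\<lambda>m. l ^ n * cap_volume c (\<theta> m)) \<longlonglongrightarrow> l ^ n * cap_volume c \<phi>" by (intro tendsto_intros lim)
  moreover have "l ^ n * cap_volume c (\<theta> m) \<le> cap_volume c (l * \<phi>)" for m
  proof -
    have "l ^ n * cap_volume c (\<theta> m) \<le> cap_volume c (l * \<theta> m)"
      using \<theta>[of m] \<phi> l0 l by (intro cap_volume_scale_open) auto
    also have "\<dots> \<le> cap_volume c (l * \<phi>)" using \<theta>[of m] l0 by (intro cap_volume_mono c1) auto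
    finally show ?thesis .
  qed
  ultimately show ?thesis by (intro LIMSEQ_le_const2) auto
qed

end

section \<open>Angular depth in convex cones\<close>

definition cone_over :: "'a::real_vector set \<Rightarrow> 'a set" where
  "cone_over K = {t *\<^sub>R x | t x. 0 < t \<and> x \<in> K}"

lemma cone_over_convex:
  assumes "spherically_convex K"
  shows "blunt_convex_cone (cone_over K)"
proof -
  obtain w where w: "\<And>x. x \<in> K \<Longrightarrow> norm x = 1 \<and> 0 < w \<bullet> x"
    using assms by (force simp: spherically_convex_def)
  have "a *\<^sub>R x \<in> cone_over K" if x: "x \<in> cone_over K" and a: "0 < a" for x a
  proof -
    obtain t k where "x = t *\<^sub>R k" "0 < t" "k \<in> K" using x by (auto simp: cone_over_def)
    then show ?thesis using a by (auto simp: cone_over_def intro!: exI[of _ "a * t"] exI[of _ k])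
  qed
  moreover have "x + y \<in> cone_over K" if x: "x \<in> cone_over K" and y: "y \<in> cone_over K" for x y
  proof -
    obtain s k where k: "x = s *\<^sub>R k" "0 < s" "k \<in> K" using x by (auto simp: cone_over_def)
    obtain t l where l: "y = t *\<^sub>R l" "0 < t" "l \<in> K" using y by (auto simp: cone_over_def)
    have "0 < w \<bullet> (x + y)" using k l w[of k] w[of l] by (simp add: inner_add_right add_pos_pos)
    then have nz: "x + y \<noteq> 0" by auto
    define z where "z = (x + y) /\<^sub>R norm (x + y)"
    have "norm z = 1" using nz by (simp add: z_def)
    moreover have "z = (s / norm (x + y)) *\<^sub>R k + (t / norm (x + y)) *\<^sub>R l"
      by (simp add: z_def k l divide_inverse scaleR_add_right mult.commute)
    moreover have "0 \<le> s / norm (x + y)" "0 \<le> t / norm (x + y)" using k l by simp_all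
    ultimately have "z \<in> shorter_arc k l"
      unfolding shorter_arc_def mem_Collect_eq mem_sphere_0 by blast
    then have "z \<in> K" using assms k l by (auto simp: spherically_convex_def)
    moreover have "x + y = norm (x + y) *\<^sub>R z" using nz by (simp add: z_def)
    moreover have "0 < norm (x + y)" using nz by simp
    ultimately show ?thesis unfolding cone_over_def mem_Collect_eq by blast
  qed
  ultimately show ?thesis by (simp add: blunt_convex_cone_def)
qed

lemma blunt_convex_cone_convex:
  fixes C :: "'a::real_vector set"
  assumes "blunt_convex_cone C" shows "convex C"
proof (rule convexI)
  fix x y and u v :: real assume *: "x \<in> C" "y \<in> C" "0 \<le> u" "0 \<le> v" "u + v = 1"
  show "u *\<^sub>R x + v *\<^sub>R y \<in> C"
  proof (cases "u = 0 \<or> v = 0")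
    case True then show ?thesis using * by auto
  next
    case False then show ?thesis using * assms by (simp add: blunt_convex_cone_def)
  qed
qed

lemma interior_blunt_convex_cone:
  fixes C :: "'a::real_normed_vector set"
  assumes C: "blunt_convex_cone C"
  shows "blunt_convex_cone (interior C)"
  unfolding blunt_convex_cone_def
proof (intro conjI ballI allI impI)
  fix x and a :: real assume x: "x \<in> interior C" and a: "0 < a"
  have "open ((*\<^sub>R) a ` interior C)" using a by (intro open_scaling) auto
  moreover have "a *\<^sub>R z \<in> C" if "z \<in> interior C" for z
    using C a that interior_subset[of C] unfolding blunt_convex_cone_def by blast
  then have "(*\<^sub>R) a ` interior C \<subseteq> C" by blast
  ultimately show "a *\<^sub>R x \<in> interior C" using x interior_maximal by blast
next
  fix x y assume x: "x \<in> interior C" and y: "y \<in> interior C"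
  have "open ((+) x ` interior C)" by (intro open_translation) auto
  moreover have "x + z \<in> C" if "z \<in> interior C" for z
    using C x that interior_subset[of C] unfolding blunt_convex_cone_def by blast
  then have "(+) x ` interior C \<subseteq> C" by blast
  ultimately show "x + y \<in> interior C" using y interior_maximal by blast
qed

text \<open>For \<open>x\<close> in a cone \<open>V\<close>, the Euclidean ball of radius \<open>infdist x (- V)\<close> around \<open>x\<close> is inscribed in the circular cone with
axis \<open>x\<close> and half-angle \<open>angular_depth V x\<close>; so this is the radius of the largest cap around the
direction of \<open>x\<close> whose interior lies in \<open>V\<close>.\<close>

definition angular_depth :: "'a::euclidean_space set \<Rightarrow> 'a \<Rightarrow> real" where
  "angular_depth V x = arcsin (infdist x (- V) / norm x)"

lemma split_vector:
  fixes v :: "'a::real_normed_vector"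
  assumes "0 < a" "0 < b" "norm v < a + b"
  shows "\<exists>p q. v = p + q \<and> norm p < a \<and> norm q < b"
proof -
  have "v = (a / (a + b)) *\<^sub>R v + (b / (a + b)) *\<^sub>R v"
    using assms by (simp add: scaleR_add_left[symmetric] add_divide_distrib[symmetric])
  moreover have "norm ((a / (a + b)) *\<^sub>R v) < a" "norm ((b / (a + b)) *\<^sub>R v) < b"
    using assms mult_strict_left_mono[OF assms(3) assms(1)] mult_strict_left_mono[OF assms(3) assms(2)]
    by (simp_all add: field_simps)
  ultimately show ?thesis by blast
qed

context
  fixes V :: "'a::euclidean_space set"
  assumes V: "blunt_convex_cone V" "open V" "0 \<notin> V"
begin

lemma cone_scale: "x \<in> V \<Longrightarrow> 0 < a \<Longrightarrow> a *\<^sub>R x \<in> V"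
  using V(1) unfolding blunt_convex_cone_def by blast

lemma compl_ne: "- V \<noteq> {}" using V(3) by blast

lemma ball_infdist: "ball x (infdist x (- V)) \<subseteq> V"
proof
  fix y assume y: "y \<in> ball x (infdist x (- V))"
  show "y \<in> V"
  proof (rule ccontr)
    assume "y \<notin> V"
    then have "infdist x (- V) \<le> dist x y" by (intro infdist_le) simp
    then show False using y by simp
  qed
qed

lemma infdist_pos: "x \<in> V \<longleftrightarrow> 0 < infdist x (- V)"
proof
  assume "x \<in> V"
  then have "x \<notin> closure (- V)" using V(2) closure_closed[of "- V"] by (simp add: closed_def)
  then show "0 < infdist x (- V)" using in_closure_iff_infdist_zero[OF compl_ne] infdist_nonneg[of x "- V"] by (metis less_eq_real_def)
next
  assume "0 < infdist x (- V)" then show "x \<in> V" using infdist_zero[of x "- V"] by (cases "x \<in> V") auto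
qed

lemma infdist_le_norm: "infdist x (- V) \<le> norm x"
  using infdist_le[of 0 "- V" x] V(3) by simp

lemma infdist_scale:
  assumes "0 < a" shows "infdist (a *\<^sub>R x) (- V) = a * infdist x (- V)"
proof -
  have le: "b * infdist x (- V) \<le> infdist (b *\<^sub>R x) (- V)" if b: "0 < b" for b x
    unfolding infdist_notempty[OF compl_ne, of "b *\<^sub>R x"]
  proof (rule cINF_greatest[OF compl_ne])
    fix p assume p: "p \<in> - V"
    have "p /\<^sub>R b \<in> - V"
    proof
      assume "p /\<^sub>R b \<in> V"
      then have "b *\<^sub>R (p /\<^sub>R b) \<in> V" by (rule cone_scale[OF _ b])
      then show False using b p by simp
    qed
    then have "infdist x (- V) \<le> dist x (p /\<^sub>R b)" by (rule infdist_le)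
    then have "b * infdist x (- V) \<le> b * dist x (p /\<^sub>R b)" using b by simp
    also have "b * dist x (p /\<^sub>R b) = norm (b *\<^sub>R (x - p /\<^sub>R b))" using b by (simp add: dist_norm)
    also have "b *\<^sub>R (x - p /\<^sub>R b) = b *\<^sub>R x - p" using b by (simp add: algebra_simps)
    finally show "b * infdist x (- V) \<le> dist (b *\<^sub>R x) p" by (simp add: dist_norm)
  qed
  have "inverse a * infdist (a *\<^sub>R x) (- V) \<le> infdist (inverse a *\<^sub>R (a *\<^sub>R x)) (- V)"
    using assms by (intro le) simp
  then show ?thesis using le[OF assms, of x] assms by (simp add: field_simps)
qed

text \<open>Two balls in \<open>V\<close> have their Minkowski sum in \<open>V\<close>.\<close>

lemma infdist_superadditive:
  assumes "x \<in> V" "y \<in> V"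
  shows "infdist x (- V) + infdist y (- V) \<le> infdist (x + y) (- V)"
  unfolding infdist_notempty[OF compl_ne, of "x + y"]
proof (rule cINF_greatest[OF compl_ne], rule ccontr)
  fix p assume p: "p \<in> - V" and "\<not> infdist x (- V) + infdist y (- V) \<le> dist (x + y) p"
  then have "norm (p - (x + y)) < infdist x (- V) + infdist y (- V)" by (simp add: dist_norm norm_minus_commute)
  from split_vector[OF infdist_pos[THEN iffD1, OF assms(1)] infdist_pos[THEN iffD1, OF assms(2)] this]
  obtain q r where qr: "p - (x + y) = q + r" "norm q < infdist x (- V)" "norm r < infdist y (- V)"
    by (elim exE conjE)
  have "x + q \<in> ball x (infdist x (- V))" "y + r \<in> ball y (infdist y (- V))"
    using qr(2,3) by (simp_all add: dist_norm)
  then have "x + q \<in> V" "y + r \<in> V" using ball_infdist by blast+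
  then have "(x + q) + (y + r) \<in> V" using V(1) by (simp add: blunt_convex_cone_def)
  moreover have "(x + q) + (y + r) = p" using qr(1) by (simp add: algebra_simps)
  ultimately show False using p by simp
qed

lemma depth_ratio: "0 \<le> infdist x (- V) / norm x" "infdist x (- V) / norm x \<le> 1"
proof -
  show "0 \<le> infdist x (- V) / norm x" by (intro divide_nonneg_nonneg infdist_nonneg norm_ge_zero)
  show "infdist x (- V) / norm x \<le> 1"
    using divide_right_mono[OF infdist_le_norm[of x] norm_ge_zero[of x]] by (cases "x = 0") auto
qed

lemma depth_bounds: "0 \<le> angular_depth V x" "angular_depth V x \<le> pi / 2"
    "sin (angular_depth V x) = infdist x (- V) / norm x"
proof -
  have "- 1 \<le> infdist x (- V) / norm x" using depth_ratio(1)[of x] by linarith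
  note r = this depth_ratio[of x]
  show "0 \<le> angular_depth V x" unfolding angular_depth_def using r by (simp add: arcsin_nonneg)
  show "angular_depth V x \<le> pi / 2" unfolding angular_depth_def using arcsin_bounded[OF r(1,3)] by simp
  show "sin (angular_depth V x) = infdist x (- V) / norm x" unfolding angular_depth_def using r by simp
qed

lemma depth_less_iff:
  assumes s: "0 \<le> s" "s < pi / 2"
  shows "s < angular_depth V x \<longleftrightarrow> x \<noteq> 0 \<and> sin s * norm x < infdist x (- V)"
proof -
  have "s < angular_depth V x \<longleftrightarrow> sin s < sin (angular_depth V x)"
    using s depth_bounds[of x] by (intro sin_mono_less_eq[symmetric]) auto
  also have "\<dots> \<longleftrightarrow> sin s < infdist x (- V) / norm x" by (simp add: depth_bounds(3))
  also have "\<dots> \<longleftrightarrow> x \<noteq> 0 \<and> sin s * norm x < infdist x (- V)"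
    using s sin_ge_zero[of s] by (cases "x = 0") (auto simp: field_simps)
  finally show ?thesis .
qed

lemma depth_pos_iff: "0 < angular_depth V x \<longleftrightarrow> x \<in> V"
proof -
  have "0 < angular_depth V x \<longleftrightarrow> x \<noteq> 0 \<and> 0 < infdist x (- V)" using depth_less_iff[of 0 x] by simp
  also have "\<dots> \<longleftrightarrow> x \<in> V" unfolding infdist_pos[symmetric] using V(3) by blast
  finally show ?thesis .
qed

text \<open>The inner parallel bodies of a convex set are convex. In the linear picture the level set is given by
\<open>sin s * norm x < infdist x (- V)\<close>, with a subadditive left-hand and a superadditive right-hand side.\<close>

lemma depth_level_cone:
  assumes s: "0 \<le> s" "s < pi / 2"
  shows "blunt_convex_cone {x. s < angular_depth V x}"
  unfolding blunt_convex_cone_def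
proof (intro conjI ballI allI impI)
  have s0: "0 \<le> sin s" using s by (intro sin_ge_zero) auto
  fix x and a :: real assume "x \<in> {x. s < angular_depth V x}" and "0 < a"
  then show "a *\<^sub>R x \<in> {x. s < angular_depth V x}"
    by (simp add: depth_less_iff[OF s] infdist_scale)
next
  have s0: "0 \<le> sin s" using s by (intro sin_ge_zero) auto
  fix x y assume "x \<in> {x. s < angular_depth V x}" "y \<in> {x. s < angular_depth V x}"
  then have *: "sin s * norm x < infdist x (- V)" "sin s * norm y < infdist y (- V)"
    by (auto simp: depth_less_iff[OF s])
  have xV: "x \<in> V" "y \<in> V"
    unfolding infdist_pos using * mult_nonneg_nonneg[OF s0 norm_ge_zero, of x] mult_nonneg_nonneg[OF s0 norm_ge_zero, of y]
    by linarith+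
  have "sin s * norm (x + y) \<le> sin s * (norm x + norm y)" using s0 by (intro mult_left_mono norm_triangle_ineq)
  also have "\<dots> < infdist x (- V) + infdist y (- V)" using * by (simp add: algebra_simps)
  also have "\<dots> \<le> infdist (x + y) (- V)" by (rule infdist_superadditive[OF xV])
  finally have "sin s * norm (x + y) < infdist (x + y) (- V)" .
  moreover have "x + y \<in> V" using V(1) xV by (simp add: blunt_convex_cone_def)
  then have "x + y \<noteq> 0" using V(3) by auto
  ultimately show "x + y \<in> {x. s < angular_depth V x}" by (simp add: depth_less_iff[OF s])
qed

text \<open>Separate \<open>V\<close> from a point of the complement nearest to \<open>x\<close>. The distance to the separating hyperplane bounds
the distance to the complement from above everywhere in \<open>V\<close> and is attained at \<open>x\<close>.\<close>

lemma depth_support: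
  assumes x: "x \<in> V"
  shows "\<exists>b. norm b = 1 \<and> angular_depth V x = latitude b x \<and> (\<forall>y. angular_depth V y \<le> max 0 (latitude b y))"
proof -
  have "closed (- V)" using V(2) by (rule closed_Compl)
  then obtain p where p: "p \<in> - V" "infdist x (- V) = dist x p"
    using infdist_attains_inf[OF _ compl_ne, of x] by blast
  have "convex V" by (rule blunt_convex_cone_convex[OF V(1)])
  moreover have "V \<noteq> {}" using x by auto
  ultimately obtain a r where a: "a \<noteq> 0" "\<And>y. y \<in> V \<Longrightarrow> a \<bullet> y \<le> r" "r \<le> a \<bullet> p"
    using separating_hyperplane_sets[of V "{p}"] p(1) by (auto simp: inner_commute)
  (* Since V is a cone, the separating hyperplane can be moved to the origin. *)
  have a_le0: "a \<bullet> y \<le> 0" if "y \<in> V" for y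
  proof (rule ccontr)
    assume "\<not> a \<bullet> y \<le> 0"
    then have pos: "0 < a \<bullet> y" by simp
    define k where "k = (\<bar>r\<bar> + 1) / (a \<bullet> y)"
    have "0 < k" using pos by (simp add: k_def)
    then have "a \<bullet> (k *\<^sub>R y) \<le> r" using that V(1) by (intro a(2) cone_scale)
    then show False using pos by (simp add: k_def)
  qed
  have r0: "0 \<le> r"
  proof (rule ccontr)
    assume r: "\<not> 0 \<le> r"
    have "a \<bullet> x \<noteq> 0" using a(2)[OF x] r by auto
    then have neg: "a \<bullet> x < 0" using a_le0[OF x] by simp
    define k where "k = r / (2 * (a \<bullet> x))"
    have "0 < k" using r neg by (auto simp: k_def intro!: divide_neg_neg)
    then have "a \<bullet> (k *\<^sub>R x) \<le> r" using x by (intro a(2) cone_scale)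
    then show False using neg r by (simp add: k_def)
  qed
  define b where "b = - (a /\<^sub>R norm a)"
  have b: "norm b = 1" using a by (simp add: b_def)
  have le: "infdist y (- V) \<le> b \<bullet> y" if y: "y \<in> V" for y
  proof (rule field_le_epsilon)
    fix e :: real assume e: "0 < e"
    define t where "t = max 0 (infdist y (- V) - e)"
    have t: "0 \<le> t" "t < infdist y (- V)" using y infdist_pos e by (auto simp: t_def)
    have "y - t *\<^sub>R b \<in> ball y (infdist y (- V))" using b t by (simp add: dist_norm)
    then have "y - t *\<^sub>R b \<in> V" using ball_infdist by blast
    then have "a \<bullet> (y - t *\<^sub>R b) \<le> 0" by (rule a_le0)
    moreover have "b \<bullet> z = - (a \<bullet> z) / norm a" for z by (simp add: b_def divide_inverse mult.commute)
    ultimately have "0 \<le> b \<bullet> (y - t *\<^sub>R b)" using a(1) by (simp add: divide_nonpos_pos)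
    then have "t \<le> b \<bullet> y" using b by (simp add: inner_diff_right norm_eq_1)
    then show "infdist y (- V) \<le> b \<bullet> y + e" by (simp add: t_def)
  qed
  have "b \<bullet> x \<le> infdist x (- V)"
  proof -
    have "b \<bullet> p \<le> 0" using a r0 by (simp add: b_def)
    then have "b \<bullet> x \<le> b \<bullet> (x - p)" by (simp add: inner_diff_right)
    also have "\<dots> \<le> norm (x - p)" using norm_cauchy_schwarz[of b "x - p"] b by simp
    finally show ?thesis by (simp add: p dist_norm)
  qed
  then have eq: "infdist x (- V) = b \<bullet> x" using le[OF x] by simp
  have "angular_depth V x = latitude b x" by (simp add: angular_depth_def latitude_def eq divide_inverse mult.commute)
  moreover have "angular_depth V y \<le> max 0 (latitude b y)" for y
  proof (cases "y \<in> V")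
    case True
    have "infdist y (- V) / norm y \<le> (b \<bullet> y) / norm y" using le[OF True] by (rule divide_right_mono) simp
    then have "infdist y (- V) / norm y \<le> b \<bullet> (y /\<^sub>R norm y)" by (simp add: divide_inverse mult.commute)
    moreover have "- 1 \<le> infdist y (- V) / norm y" using depth_ratio(1)[of y] by linarith
    ultimately have "angular_depth V y \<le> latitude b y"
      unfolding angular_depth_def latitude_def using unit_inner_bounds[OF b] by (intro arcsin_le_arcsin) auto
    then show ?thesis by simp
  next
    case False
    then have "\<not> 0 < angular_depth V y" by (simp add: depth_pos_iff)
    then show ?thesis by simp
  qed
  ultimately show ?thesis using b by (intro exI[of _ b] conjI allI)
qed

lemma depth_measurable: "angular_depth V \<in> borel_measurable borel"
  unfolding angular_depth_def[abs_def]
proof (rule borel_measurable_arcsin)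
  have "(\<lambda>x. infdist x (- V)) \<in> borel_measurable borel"
    by (intro borel_measurable_continuous_onI continuous_intros)
  then show "(\<lambda>x. infdist x (- V) / norm x) \<in> borel_measurable borel" by measurable
  show "- 1 \<le> infdist x (- V) / norm x" for x using depth_ratio(1)[of x] by linarith
qed (rule depth_ratio(2))

end

lemma tilt_direction:
  fixes u c :: "'a::euclidean_space"
  assumes "norm u = 1" "norm c = 1" "2 \<le> DIM('a)"
  shows "\<exists>e. norm e = 1 \<and> u \<bullet> e = 0 \<and> c = sin (latitude c u) *\<^sub>R u + cos (latitude c u) *\<^sub>R e"
proof -
  define \<theta> where "\<theta> = latitude c u"
  have s: "sin \<theta> = c \<bullet> u" using latitude_bounds(3)[OF assms(2), of u] assms by (simp add: \<theta>_def)
  have uu: "u \<bullet> u = 1" "c \<bullet> c = 1" using assms by (auto simp: norm_eq_1)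
  have "(c - sin \<theta> *\<^sub>R u) \<bullet> (c - sin \<theta> *\<^sub>R u) = 1 - (sin \<theta>)\<^sup>2"
    by (simp add: inner_diff_left inner_diff_right uu s inner_commute[of u c] power2_eq_square)
  also have "\<dots> = (cos \<theta>)\<^sup>2" by (simp add: cos_squared_eq)
  finally have "(c - sin \<theta> *\<^sub>R u) \<bullet> (c - sin \<theta> *\<^sub>R u) = (cos \<theta>)\<^sup>2" .
  moreover have c0: "0 \<le> cos \<theta>" using latitude_bounds[OF assms(2), of u] by (intro cos_ge_zero) (auto simp: \<theta>_def)
  ultimately have n: "norm (c - sin \<theta> *\<^sub>R u) = cos \<theta>" by (simp add: norm_eq_sqrt_inner)
  show ?thesis
  proof (cases "cos \<theta> = 0")
    case True
    obtain y where y: "y \<noteq> 0" "orthogonal u y" using orthogonal_to_vector_exists[OF assms(3)] by blast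
    have "c = sin \<theta> *\<^sub>R u + cos \<theta> *\<^sub>R (y /\<^sub>R norm y)" using n True by simp
    moreover have "norm (y /\<^sub>R norm y) = 1" "u \<bullet> (y /\<^sub>R norm y) = 0" using y by (auto simp: orthogonal_def)
    ultimately show ?thesis unfolding \<theta>_def by blast
  next
    case False
    define e where "e = (c - sin \<theta> *\<^sub>R u) /\<^sub>R cos \<theta>"
    have "norm e = 1" using n False c0 by (simp add: e_def)
    moreover have "u \<bullet> e = 0" by (simp add: e_def inner_diff_right uu s inner_commute)
    moreover have "c = sin \<theta> *\<^sub>R u + cos \<theta> *\<^sub>R e" using False by (simp add: e_def)
    ultimately show ?thesis unfolding \<theta>_def by blast
  qed
qed

text \<open>The point reached from \<open>u\<close> by moving through the angle \<open>s\<close> along the great circle through \<open>c\<close>, away from \<open>c\<close>.\<close>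

lemma tilt_point:
  fixes u c :: "'a::euclidean_space"
  assumes "norm u = 1" "norm c = 1" "2 \<le> DIM('a)"
  shows "\<exists>p. norm p = 1 \<and> u \<bullet> p = cos s \<and> c \<bullet> p = sin (latitude c u - s)"
proof -
  define \<theta> where "\<theta> = latitude c u"
  obtain e where e: "norm e = 1" "u \<bullet> e = 0" "c = sin \<theta> *\<^sub>R u + cos \<theta> *\<^sub>R e"
    using tilt_direction[OF assms] unfolding \<theta>_def by blast
  define p where "p = cos s *\<^sub>R u - sin s *\<^sub>R e"
  have ii: "u \<bullet> u = 1" "e \<bullet> e = 1" "e \<bullet> u = 0" using assms e by (auto simp: norm_eq_1 inner_commute)
  have "p \<bullet> p = (cos s)\<^sup>2 + (sin s)\<^sup>2"
    by (simp add: p_def inner_diff_left inner_diff_right ii e power2_eq_square)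
  then have "norm p = 1" by (simp add: norm_eq_1)
  moreover have "u \<bullet> p = cos s" by (simp add: p_def inner_diff_right ii e)
  moreover have "c \<bullet> p = sin (\<theta> - s)"
    by (simp add: e(3) p_def inner_diff_right inner_add_left ii e(2) sin_diff)
  ultimately show ?thesis unfolding \<theta>_def by blast
qed

section \<open>Caps, hemispheres and layers in the spherical measure\<close>

text \<open>Transfers \<open>\<sigma>\<close> from the sphere to the whole space. The images in \<^const>\<open>spherical_haar\<close> turn into
preimages because rotations are bijective on the sphere.\<close>

lemma sphere_haar_of_spherical_haar:
  fixes \<sigma> :: "(real ^ 'd) measure"
  assumes \<sigma>: "spherical_haar \<sigma>" and d: "2 \<le> CARD('d)"
  defines "\<mu> \<equiv> distr \<sigma> borel (\<lambda>x. x)"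
  shows "sphere_haar \<mu>"
    and "E \<in> sets borel \<Longrightarrow> E \<inter> sphere 0 1 \<in> sets \<sigma> \<and> measure \<sigma> (E \<inter> sphere 0 1) = measure \<mu> E"
proof -
  have sets: "sets \<sigma> = sets (restrict_space borel (sphere 0 1))" using \<sigma> by (simp add: spherical_haar_def)
  have space: "space \<sigma> = sphere 0 1" using sets_eq_imp_space_eq[OF sets] by (simp add: space_restrict_space)
  have [measurable]: "(\<lambda>x. x) \<in> borel_measurable \<sigma>"
    unfolding measurable_cong_sets[OF sets refl] by (rule measurable_restrict_space1) simp
  have sect: "E \<inter> sphere 0 1 \<in> sets \<sigma>" if "E \<in> sets borel" for E
    using that unfolding sets sets_restrict_space by blast
  have em: "emeasure \<mu> E = emeasure \<sigma> (E \<inter> sphere 0 1)" if "E \<in> sets borel" for E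
    using that by (simp add: \<mu>_def emeasure_distr space vimage_def Int_def)
  then show "E \<in> sets borel \<Longrightarrow> E \<inter> sphere 0 1 \<in> sets \<sigma> \<and> measure \<sigma> (E \<inter> sphere 0 1) = measure \<mu> E"
    using sect by (simp add: measure_def)
  interpret S: prob_space \<sigma> using \<sigma> by (simp add: spherical_haar_def)
  interpret M: prob_space \<mu> unfolding \<mu>_def by (rule S.prob_space_distr) measurable
  have sb: "sets \<mu> = sets borel" by (simp add: \<mu>_def)
  have "AE x in \<sigma>. norm x = 1" by (rule AE_I2) (simp add: space)
  then have ae: "AE x in \<mu>. norm x = 1" unfolding \<mu>_def by (subst AE_distr_iff) auto
  have inv: "distr \<mu> borel ((*v) T) = \<mu>" if T: "rotation_matrix T" for T
  proof (rule measure_eqI)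
    have ot: "orthogonal_transformation ((*v) T)" using T by (rule orthogonal_transformation_mult_vec)
    have n: "norm (T *v x) = norm x" for x using ot by (rule orthogonal_transformation_norm)
    have surj: "surj ((*v) T)" using ot by (rule orthogonal_transformation_surj)
    fix E assume "E \<in> sets (distr \<mu> borel ((*v) T))"
    then have E[measurable]: "E \<in> sets borel" by simp
    have E': "(*v) T -` E \<in> sets borel" using measurable_sets[OF matrix_vector_mul_measurable E, of T] by simp
    have "emeasure (distr \<mu> borel ((*v) T)) E = emeasure \<sigma> ((*v) T -` E \<inter> sphere 0 1)"
      using em[OF E'] sets_eq_imp_space_eq[OF sb] matrix_vector_mul_measurable[of T]
      by (subst emeasure_distr) (auto simp: measurable_cong_sets[OF sb refl])
    also have "\<dots> = emeasure \<sigma> ((*v) T ` ((*v) T -` E \<inter> sphere 0 1))"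
      using \<sigma> T sect[OF E'] by (simp add: spherical_haar_def)
    also have "(*v) T ` ((*v) T -` E \<inter> sphere 0 1) = E \<inter> sphere 0 1"
    proof (intro set_eqI iffI)
      fix y assume y: "y \<in> E \<inter> sphere 0 1"
      obtain x where "y = T *v x" using surj by (metis surjD)
      then show "y \<in> (*v) T ` ((*v) T -` E \<inter> sphere 0 1)" using y n by auto
    qed (use n in auto)
    finally show "emeasure (distr \<mu> borel ((*v) T)) E = emeasure \<mu> E" by (simp add: em)
  qed (simp add: sb)
  show "sphere_haar \<mu>"
    by (intro sphere_haar.intro sphere_haar_axioms.intro M.prob_space_axioms sb ae inv d)
qed

lemma open_not_AE:
  fixes U :: "'a::euclidean_space set"
  assumes "open U" "U \<noteq> {}" "AE x in lborel. x \<notin> U"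
  shows False
proof -
  have "AE x in lebesgue. x \<notin> U" using assms(3) by (rule AE_completion)
  then have "negligible U" using assms(1) by (simp add: negligible_iff_null_sets AE_iff_null_sets)
  then show False using open_not_negligible assms by blast
qed

lemma drift_axis_pos:
  fixes x :: "real ^ 'd"
  assumes "norm x < 1 / 2"
  shows "drift_axis x \<noteq> 0"
proof
  let ?e = "axis (SOME i. True) 1 :: real ^ 'd"
  assume "drift_axis x = 0"
  then have "AE z in lborel. indicator (cball 0 1) (x, z) * ennreal (?e \<bullet> z) = 0"
    unfolding drift_axis_def drift_def by (subst (asm) nn_integral_0_iff_AE) measurable
  then have "AE z in lborel. z \<notin> ball 0 (1/2) \<inter> {z. 0 < ?e \<bullet> z}"
  proof eventually_elim
    case (elim z)
    show ?case
    proof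
      assume z: "z \<in> ball 0 (1/2) \<inter> {z. 0 < ?e \<bullet> z}"
      then have "norm (x, z) \<le> 1" using norm_triangle_ineq[of "(x, 0)" "(0, z)"] assms by (simp add: norm_Pair1 norm_Pair2)
      then show False using elim z by (simp add: ennreal_eq_0_iff)
    qed
  qed
  moreover have "open (ball 0 (1/2) \<inter> {z. 0 < ?e \<bullet> z})" by (intro open_Int open_ball open_halfspace_gt)
  moreover have "(1/3) *\<^sub>R ?e \<in> ball 0 (1/2) \<inter> {z. 0 < ?e \<bullet> z}" by (simp add: inner_axis')
  ultimately show False using open_not_AE by blast
qed

context sphere_haar
begin

definition ball_volume :: real where "ball_volume = measure lborel (cball 0 1 :: (real ^ 'd) set)"

lemma ball_volume_pos: "0 < ball_volume" "emeasure lborel (cball 0 1 :: (real ^ 'd) set) = ennreal ball_volume"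
proof -
  show "0 < ball_volume" unfolding ball_volume_def by (rule content_cball_pos) simp
  show "emeasure lborel (cball 0 1 :: (real ^ 'd) set) = ennreal ball_volume"
    unfolding ball_volume_def measure_def using emeasure_unit_cball(2)
    by (intro ennreal_enn2real[symmetric]) (simp add: top.not_eq_extremum)
qed

text \<open>The case of \<open>radial_integral\<close> for the uniform density on the unit ball: spherical measure is the volume of
sectors, in units of the volume of the ball.\<close>

lemma prob_cone:
  assumes E[measurable]: "E \<in> sets borel" and hom: "\<And>x. x \<noteq> 0 \<Longrightarrow> x /\<^sub>R norm x \<in> E \<longleftrightarrow> x \<in> E"
  shows "prob E * ball_volume = measure lborel (cball 0 1 \<inter> E)"
proof -
  have "emeasure \<mu> E * emeasure lborel (cball 0 1 :: (real ^ 'd) set)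
    = emeasure \<mu> E * (\<integral>\<^sup>+x. indicator (cball 0 1) x \<partial>(lborel :: (real ^ 'd) measure))" by simp
  also have "\<dots> = (\<integral>\<^sup>+x. indicator (cball 0 1) x * indicator E (x /\<^sub>R norm x) * indicator (- {0}) x \<partial>lborel)"
  proof (rule radial_integral[symmetric])
    fix T :: "real ^ 'd ^ 'd" and x :: "real ^ 'd" assume "rotation_matrix T"
    then have "norm (T *v x) = norm x" by (intro orthogonal_transformation_norm orthogonal_transformation_mult_vec)
    then show "indicator (cball 0 1) (T *v x) = (indicator (cball 0 1) x :: ennreal)" by (simp add: indicator_def)
  qed auto
  also have "\<dots> = (\<integral>\<^sup>+x. indicator (cball 0 1 \<inter> E) x \<partial>lborel)"
  proof (rule nn_integral_cong_AE)
    show "AE x in lborel. indicator (cball 0 1) x * indicator E (x /\<^sub>R norm x) * indicator (- {0}) x = (indicator (cball 0 1 \<inter> E) x :: ennreal)"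
      using AE_lborel_singleton[of "0 :: real ^ 'd"]
    proof eventually_elim
      case (elim x)
      then show ?case using hom[of x] by (simp add: indicator_def)
    qed
  qed
  also have "\<dots> = emeasure lborel (cball 0 1 \<inter> E)" by simp
  finally have "emeasure lborel (cball 0 1 \<inter> E) = ennreal (prob E * ball_volume)"
    by (simp add: emeasure_eq_measure ball_volume_pos(2) ennreal_mult ball_volume_pos(1)[THEN less_imp_le])
  then show ?thesis using ball_volume_pos(1) by (simp add: measure_def)
qed

lemma prob_negligible_cone:
  assumes E: "E \<in> sets borel" and "\<And>x. x \<noteq> 0 \<Longrightarrow> x /\<^sub>R norm x \<in> E \<longleftrightarrow> x \<in> E" "negligible E"
  shows "prob E = 0"
proof -
  have "measure lborel (cball 0 1 \<inter> E) \<le> 0"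
  proof -
    have "negligible (cball 0 1 \<inter> E)" using assms(3) by (rule negligible_subset) auto
    then have "cball 0 1 \<inter> E \<in> null_sets lborel"
      using E by (simp add: negligible_iff_null_sets null_sets_completion_iff)
    then show ?thesis by (simp add: null_sets_def measure_def)
  qed
  moreover have "prob E * ball_volume = measure lborel (cball 0 1 \<inter> E)"
    using assms by (intro prob_cone) auto
  ultimately show ?thesis using ball_volume_pos(1) by (simp add: measure_le_0_iff mult_le_0_iff)
qed

lemma prob_hyperplane:
  assumes "norm c = 1" shows "prob {x. c \<bullet> x = 0} = 0"
proof (rule prob_negligible_cone)
  show "negligible {x. c \<bullet> x = 0}" using assms by (intro negligible_hyperplane) auto
qed (auto simp: closed_hyperplane borel_closed)

lemma prob_hemisphere:
  assumes c: "norm c = 1" shows "prob {x. 0 < c \<bullet> x} = 1 / 2"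
proof -
  have m[measurable]: "{x. 0 < c \<bullet> x} \<in> sets borel" "{x. c \<bullet> x < 0} \<in> sets borel" "{x. c \<bullet> x = 0} \<in> sets borel"
    by (auto intro: borel_open borel_closed open_halfspace_gt open_halfspace_lt closed_hyperplane)
  obtain T where T: "rotation_matrix T" "T *v c = - c"
    using rotation_exists_matrix[OF dim_ge_2, of c "- c"] by auto
  have ot: "orthogonal_transformation ((*v) T)" using T(1) by (rule orthogonal_transformation_mult_vec)
  have "c \<bullet> (T *v x) = - (c \<bullet> x)" for x
  proof -
    have "(T *v c) \<bullet> (T *v x) = c \<bullet> x" using ot by (simp add: orthogonal_transformation_def)
    then show ?thesis by (simp add: T(2))
  qed
  then have "(*v) T -` {x. 0 < c \<bullet> x} = {x. c \<bullet> x < 0}" by auto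
  then have eq: "prob {x. c \<bullet> x < 0} = prob {x. 0 < c \<bullet> x}"
    using emeasure_rotation_vimage[OF T(1) m(1)] by (simp add: measure_def)
  have "prob ({x. 0 < c \<bullet> x} \<union> ({x. c \<bullet> x < 0} \<union> {x. c \<bullet> x = 0})) = prob {x. 0 < c \<bullet> x} + (prob {x. c \<bullet> x < 0} + prob {x. c \<bullet> x = 0})"
  proof -
    have "prob ({x. c \<bullet> x < 0} \<union> {x. c \<bullet> x = 0}) = prob {x. c \<bullet> x < 0} + prob {x. c \<bullet> x = 0}"
      by (rule finite_measure_Union) auto
    moreover have "prob ({x. 0 < c \<bullet> x} \<union> ({x. c \<bullet> x < 0} \<union> {x. c \<bullet> x = 0}))
        = prob {x. 0 < c \<bullet> x} + prob ({x. c \<bullet> x < 0} \<union> {x. c \<bullet> x = 0})"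
      by (rule finite_measure_Union) auto
    ultimately show ?thesis by simp
  qed
  moreover have "{x. 0 < c \<bullet> x} \<union> ({x. c \<bullet> x < 0} \<union> {x. c \<bullet> x = 0}) = space \<mu>" by auto
  ultimately show ?thesis using eq prob_hyperplane[OF c] prob_space by simp
qed

text \<open>A rotation moves the centre to a coordinate axis, where \<open>cap_volume_scale\<close> applies.\<close>

lemma prob_cap_scale:
  assumes c: "norm c = 1" and l: "0 \<le> l" "l \<le> 1" and \<phi>: "0 < \<phi>" "\<phi> \<le> pi / 2"
  shows "l ^ (CARD('d) - 1) * prob {x. pi / 2 - \<phi> < latitude c x} \<le> prob {x. pi / 2 - l * \<phi> < latitude c x}"
proof -
  define b where "b = (axis (SOME i. True) 1 :: real ^ 'd)"
  have b: "b \<in> Basis" "norm b = 1" by (auto simp: b_def)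
  obtain T where T: "rotation_matrix T" "T *v c = b"
    using rotation_exists_matrix[OF dim_ge_2, of c b] c b by auto
  have ot: "orthogonal_transformation ((*v) T)" using T(1) by (rule orthogonal_transformation_mult_vec)
  have "latitude b (T *v x) = latitude c x" for x
  proof -
    have "(T *v c) \<bullet> (T *v x) = c \<bullet> x" using ot by (simp add: orthogonal_transformation_def)
    then show ?thesis using orthogonal_transformation_norm[OF ot] by (simp add: latitude_def T(2))
  qed
  then have vim: "(*v) T -` {x. r < latitude b x} = {x. r < latitude c x}" for r by auto
  have pc: "prob {x. r < latitude c x} = prob {x. r < latitude b x}" for r
    using emeasure_rotation_vimage[OF T(1) cap_sets(1)[OF b(2)], of r] unfolding vim measure_def by simp
  have "prob {x. r < latitude b x} * ball_volume = measure lborel (cball 0 1 \<inter> {x. r < latitude b x})" for r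
    by (rule prob_cone) (auto simp: latitude_direction cap_sets b)
  then have pv: "prob {x. pi / 2 - \<phi> < latitude c x} * ball_volume = cap_volume b \<phi>" for \<phi>
    by (simp add: pc cap_volume_def Int_def)
  have "l ^ (CARD('d) - 1) * cap_volume b \<phi> \<le> cap_volume b (l * \<phi>)"
    using dim_ge_2 by (intro cap_volume_scale b l \<phi>) auto
  then have "(l ^ (CARD('d) - 1) * prob {x. pi / 2 - \<phi> < latitude c x}) * ball_volume \<le> prob {x. pi / 2 - l * \<phi> < latitude c x} * ball_volume"
    by (simp only: pv mult.assoc)
  then show ?thesis using ball_volume_pos(1) by simp
qed

lemma prob_cap_lower:
  assumes c: "norm c = 1" and \<delta>: "0 < \<delta>" "\<delta> \<le> pi / 2"
  shows "(2 * \<delta> / pi) ^ (CARD('d) - 1) / 2 \<le> prob {x. pi / 2 - \<delta> < latitude c x}"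
proof -
  have "{x. pi / 2 - pi / 2 < latitude c x} = {x. 0 < c \<bullet> x}"
  proof (intro set_eqI)
    fix x
    have "0 < latitude c x \<longleftrightarrow> sin 0 < sin (latitude c x)"
      using latitude_bounds[OF c, of x] by (intro sin_mono_less_eq[symmetric]) auto
    also have "\<dots> \<longleftrightarrow> 0 < c \<bullet> x"
      by (cases "x = 0") (auto simp: latitude_bounds(3)[OF c] zero_less_mult_iff)
    finally show "x \<in> {x. pi / 2 - pi / 2 < latitude c x} \<longleftrightarrow> x \<in> {x. 0 < c \<bullet> x}" by simp
  qed
  then show ?thesis
    using prob_cap_scale[OF c, of "2 * \<delta> / pi" "pi / 2"] \<delta> prob_hemisphere[OF c] by (simp add: field_simps)
qed

text \<open>The density \<open>drift_axis x / norm x\<close> is rotation invariant with finite and positive total mass, so it induces a positive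
multiple of \<open>\<mu>\<close> on directions.\<close>

lemma prob_layer_le:
  assumes FE[measurable]: "A \<in> sets borel" "B \<in> sets borel"
    and homA: "\<And>x. x \<noteq> 0 \<Longrightarrow> x /\<^sub>R norm x \<in> A \<longleftrightarrow> x \<in> A" and homB: "\<And>x. x \<noteq> 0 \<Longrightarrow> x /\<^sub>R norm x \<in> B \<longleftrightarrow> x \<in> B"
    and le: "drift_mass A \<le> drift_mass B"
  shows "prob A \<le> prob B"
proof -
  have [measurable]: "(drift_density :: real ^ 'd \<Rightarrow> ennreal) \<in> borel_measurable borel"
    unfolding drift_density_def[abs_def] by measurable
  have hT: "drift_density (T *v x) = drift_density x" if "rotation_matrix T" for T :: "real ^ 'd ^ 'd" and x
    using that orthogonal_transformation_norm[OF orthogonal_transformation_mult_vec[OF that]]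
    by (simp add: drift_density_def drift_axis_rotation)
  define H where "H = (\<integral>\<^sup>+x. drift_density x \<partial>(lborel :: (real ^ 'd) measure))"
  have rad: "drift_mass E = emeasure \<mu> E * H"
    if [measurable]: "E \<in> sets borel" and hom: "\<And>x. x \<noteq> 0 \<Longrightarrow> x /\<^sub>R norm x \<in> E \<longleftrightarrow> x \<in> E" for E
  proof -
    have "drift_mass E = (\<integral>\<^sup>+x. drift_density x * indicator E (x /\<^sub>R norm x) * indicator (- {0}) x \<partial>lborel)"
      unfolding drift_mass_def
    proof (rule nn_integral_cong_AE)
      show "AE x in lborel. indicator E x * drift_density x = drift_density x * indicator E (x /\<^sub>R norm x) * indicator (- {0}) x"
        using AE_lborel_singleton[of "0 :: real ^ 'd"]
        by eventually_elim (simp add: hom indicator_def)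
    qed
    also have "\<dots> = emeasure \<mu> E * H" unfolding H_def by (rule radial_integral[where h = drift_density]) (auto simp: hT)
    finally show ?thesis .
  qed
  have "H \<le> (\<integral>\<^sup>+x. ennreal ball_volume * (indicator (cball 0 1) x * ennreal (1 / norm x)) \<partial>(lborel :: (real ^ 'd) measure))"
    unfolding H_def
  proof (rule nn_integral_mono)
    fix x :: "real ^ 'd"
    have "drift_density x \<le> indicator (cball 0 1) x * ennreal ball_volume * ennreal (1 / norm x)"
      unfolding drift_density_def using drift_axis_le[of x] by (intro mult_right_mono) (simp_all add: ball_volume_pos(2))
    then show "drift_density x \<le> ennreal ball_volume * (indicator (cball 0 1) x * ennreal (1 / norm x))" by (simp only: ac_simps)
  qed
  also have "\<dots> < \<infinity>"
    using nn_integral_inverse_norm_finite[where 'a = "real ^ 'd"] dim_ge_2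
    by (simp add: nn_integral_cmult ennreal_mult_less_top)
  finally have Hfin: "H \<noteq> \<top>" by simp
  have H0: "H \<noteq> 0"
  proof
    assume "H = 0"
    then have "AE x :: real ^ 'd in lborel. drift_density x = 0" unfolding H_def by (subst (asm) nn_integral_0_iff_AE) auto
    then have "AE x in lborel. x \<notin> ball 0 (1/2) - {0 :: real ^ 'd}"
      by eventually_elim (use drift_axis_pos in \<open>auto simp: drift_density_def ennreal_eq_0_iff\<close>)
    moreover have "open (ball 0 (1/2) - {0 :: real ^ 'd})" by (intro open_Diff) auto
    moreover have "(1/3) *\<^sub>R axis (SOME i. True) 1 \<in> ball 0 (1/2) - {0 :: real ^ 'd}" by (simp add: axis_eq_0_iff)
    ultimately show False using open_not_AE by blast
  qed
  have "emeasure \<mu> A * H \<le> emeasure \<mu> B * H"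
    using le by (simp add: rad[OF FE(1) homA] rad[OF FE(2) homB])
  then have "emeasure \<mu> A \<le> emeasure \<mu> B"
    using Hfin H0 by (simp add: mult.commute[of _ H] ennreal_mult_le_mult_iff)
  then show ?thesis by (simp add: emeasure_eq_measure)
qed

text \<open>Each step of the greedy choice reduces the measure of the set missed so far by the factor \<open>1 - prob L\<close>.\<close>

lemma greedy_rotations:
  assumes L[measurable]: "L \<in> sets borel"
  shows "\<exists>R. finite R \<and> card R \<le> N \<and> (\<forall>T\<in>R. rotation_matrix T) \<and>
    {x. \<forall>T\<in>R. T *v x \<notin> L} \<in> sets borel \<and> prob {x. \<forall>T\<in>R. T *v x \<notin> L} \<le> (1 - prob L) ^ N"
proof (induction N)
  case 0
  show ?case by (rule exI[of _ "{}"]) auto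
next
  case (Suc N)
  then obtain R where R: "finite R" "card R \<le> N" "\<forall>T\<in>R. rotation_matrix T"
    "{x. \<forall>T\<in>R. T *v x \<notin> L} \<in> sets borel" "prob {x. \<forall>T\<in>R. T *v x \<notin> L} \<le> (1 - prob L) ^ N" by blast
  define U where "U = {x. \<forall>T\<in>R. T *v x \<notin> L}"
  have U[measurable]: "U \<in> sets borel" using R by (simp add: U_def)
  obtain T where T: "rotation_matrix T" "prob U * prob L \<le> prob (U \<inter> (*v) T -` L)"
    using exists_rotation_intersection[OF U L] by blast
  have TL: "(*v) T -` L \<in> sets borel" using measurable_sets[OF matrix_vector_mul_measurable L, of T] by simp
  have eq: "{x. \<forall>T\<in>insert T R. T *v x \<notin> L} = U - (U \<inter> (*v) T -` L)" by (auto simp: U_def)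
  have "prob (U - (U \<inter> (*v) T -` L)) = prob U - prob (U \<inter> (*v) T -` L)"
    using TL by (intro finite_measure_Diff) auto
  also have "\<dots> \<le> prob U * (1 - prob L)" using T by (simp add: algebra_simps)
  also have "\<dots> \<le> (1 - prob L) ^ N * (1 - prob L)" using R by (intro mult_right_mono) (auto simp: U_def)
  finally have "prob {x. \<forall>T\<in>insert T R. T *v x \<notin> L} \<le> (1 - prob L) ^ Suc N" by (simp only: eq power_Suc mult.commute)
  moreover have "card (insert T R) \<le> Suc N" using R card_insert_le_m1[of "Suc N" R T] by simp
  ultimately show ?case
    using R T TL by (intro exI[of _ "insert T R"]) (simp only: eq, auto)
qed

end

section \<open>Spherically convex sets and their cones\<close>

lemma arcsin_eq_arccos:
  assumes "- 1 \<le> t" "t \<le> 1" shows "arcsin t = pi / 2 - arccos t"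
proof -
  have "sin (pi / 2 - arccos t) = t" using assms by (simp add: sin_diff)
  moreover have "0 \<le> arccos t" "arccos t \<le> pi" using assms arccos_bounded by auto
  ultimately show ?thesis using arcsin_unique[of "pi / 2 - arccos t" t] by simp
qed

lemma unit_latitude:
  assumes "norm c = 1" "norm x = 1"
  shows "latitude c x = pi / 2 - arccos (c \<bullet> x)"
proof -
  have "latitude c x = arcsin (c \<bullet> x)" using assms by (simp add: latitude_def)
  then show ?thesis using arcsin_eq_arccos unit_inner_bounds[OF assms(1), of x] assms by simp
qed

lemma cone_over_unit:
  assumes "K \<subseteq> sphere 0 1" "v \<in> cone_over K" "norm v = 1"
  shows "v \<in> K"
proof -
  obtain t k where t: "v = t *\<^sub>R k" "0 < t" "k \<in> K" using assms by (auto simp: cone_over_def)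
  have "norm k = 1" using t assms by auto
  then have "t = 1" using t assms by simp
  then show ?thesis using t by simp
qed

lemma spherically_convex_subset_sphere: "spherically_convex K \<Longrightarrow> K \<subseteq> sphere 0 1"
  by (auto simp: spherically_convex_def)

lemma open_hemisphere:
  fixes K :: "(real ^ 'd) set"
  assumes "spherically_convex K"
  shows "\<exists>w. norm w = 1 \<and> (\<forall>x\<in>K. 0 < w \<bullet> x)"
proof -
  obtain w where "w \<in> sphere 0 1" "K \<subseteq> {x \<in> sphere 0 1. 0 < w \<bullet> x}"
    using assms unfolding spherically_convex_def by blast
  then show ?thesis by (intro exI[of _ w]) auto
qed

lemma zero_notin_cone_over:
  fixes K :: "(real ^ 'd) set"
  assumes "spherically_convex K" shows "0 \<notin> cone_over K"
proof
  assume "0 \<in> cone_over K"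
  then obtain t k where "0 = t *\<^sub>R k" "0 < t" "k \<in> K" by (auto simp: cone_over_def)
  then have "0 \<in> K" by auto
  then show False using spherically_convex_subset_sphere[OF assms] by auto
qed

lemma interior_cone_over:
  fixes K :: "(real ^ 'd) set"
  assumes K: "spherically_convex K"
  shows "blunt_convex_cone (interior (cone_over K))" "open (interior (cone_over K))" "0 \<notin> interior (cone_over K)"
  using interior_blunt_convex_cone[OF cone_over_convex[OF K]] zero_notin_cone_over[OF K] interior_subset by auto

text \<open>The infimum defining the circumradius is attained: centres of almost optimal caps have a convergent
subsequence.\<close>

lemma circumcentre_exists:
  fixes K :: "(real ^ 'd) set"
  assumes K: "spherically_convex K" "K \<noteq> {}"
  defines "\<rho> \<equiv> spherical_circumradius K"
  shows "0 \<le> \<rho>" "\<rho> \<le> pi / 2" "\<exists>c. norm c = 1 \<and> K \<subseteq> spherical_cap c \<rho>"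
proof -
  define \<Phi> where "\<Phi> = {\<phi>. 0 \<le> \<phi> \<and> (\<exists>u \<in> sphere 0 1. K \<subseteq> spherical_cap u \<phi>)}"
  have \<rho>: "\<rho> = Inf \<Phi>" by (simp add: \<rho>_def spherical_circumradius_def \<Phi>_def)
  have Ks: "\<And>x. x \<in> K \<Longrightarrow> norm x = 1" using spherically_convex_subset_sphere[OF K(1)] by auto
  obtain w where w: "norm w = 1" "\<And>x. x \<in> K \<Longrightarrow> 0 < w \<bullet> x"
    using open_hemisphere[OF K(1)] by blast
  have bnd: "\<bar>u \<bullet> x\<bar> \<le> 1" if "norm u = 1" "norm x = 1" for u x :: "real ^ 'd"
    using Cauchy_Schwarz_ineq2[of u x] that by simp
  have "K \<subseteq> spherical_cap w (pi / 2)"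
  proof
    fix x assume x: "x \<in> K"
    have "arccos (w \<bullet> x) \<le> pi / 2" using w(2)[OF x] bnd[OF w(1) Ks[OF x]] by (intro arccos_le_pi2) auto
    then show "x \<in> spherical_cap w (pi / 2)" using Ks[OF x] by (simp add: spherical_cap_def)
  qed
  moreover have "w \<in> sphere 0 1" using w by simp
  ultimately have half: "pi / 2 \<in> \<Phi>" unfolding \<Phi>_def mem_Collect_eq by (intro conjI bexI) simp_all
  have pos: "0 \<le> \<phi>" if "\<phi> \<in> \<Phi>" for \<phi> using that unfolding \<Phi>_def by blast
  then have bb: "bdd_below \<Phi>" by (rule bdd_belowI[of _ 0])
  show "\<rho> \<le> pi / 2" unfolding \<rho> by (rule cInf_lower[OF half bb])
  show "0 \<le> \<rho>" unfolding \<rho> using half pos by (intro cInf_greatest) auto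
  have "\<exists>u. norm u = 1 \<and> K \<subseteq> spherical_cap u (\<rho> + 1 / real (Suc m))" for m
  proof -
    have "Inf \<Phi> < \<rho> + 1 / real (Suc m)" by (simp add: \<rho>)
    then obtain \<phi> where \<phi>: "\<phi> \<in> \<Phi>" "\<phi> < \<rho> + 1 / real (Suc m)" using cInf_lessD[of \<Phi>] half by blast
    then obtain u where u: "u \<in> sphere 0 1" "K \<subseteq> spherical_cap u \<phi>" unfolding \<Phi>_def by blast
    have "spherical_cap u \<phi> \<subseteq> spherical_cap u (\<rho> + 1 / real (Suc m))"
      using \<phi>(2) by (auto simp: spherical_cap_def)
    then have "norm u = 1 \<and> K \<subseteq> spherical_cap u (\<rho> + 1 / real (Suc m))" using u by simp
    then show ?thesis ..
  qed
  then obtain u where u: "\<And>m. norm (u m) = 1" "\<And>m. K \<subseteq> spherical_cap (u m) (\<rho> + 1 / real (Suc m))" by metis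
  have "compact (sphere (0 :: real ^ 'd) 1)" by (rule compact_sphere)
  then obtain c r where c: "c \<in> sphere 0 1" "strict_mono r" "(u \<circ> r) \<longlonglongrightarrow> c"
    using u(1) unfolding compact_def by (metis mem_sphere_0)
  have "K \<subseteq> spherical_cap c \<rho>"
  proof
    fix x assume x: "x \<in> K"
    have "(\<lambda>m. u (r m) \<bullet> x) \<longlonglongrightarrow> c \<bullet> x" using c(3) unfolding comp_def by (intro tendsto_intros)
    then have "(\<lambda>m. arccos (u (r m) \<bullet> x)) \<longlonglongrightarrow> arccos (c \<bullet> x)"
    proof (rule continuous_on_tendsto_compose[OF continuous_on_arccos'])
      show "c \<bullet> x \<in> {- 1..1}" using bnd[of c x] Ks[OF x] c(1) by (auto simp: abs_le_iff)
      show "\<forall>\<^sub>F m in sequentially. u (r m) \<bullet> x \<in> {- 1..1}"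
        using bnd[OF u(1) Ks[OF x]] by (intro always_eventually) (auto simp: abs_le_iff)
    qed
    moreover have "(\<lambda>m. \<rho> + 1 / real (Suc (r m))) \<longlonglongrightarrow> \<rho> + 0"
      by (intro tendsto_intros LIMSEQ_subseq_LIMSEQ[OF LIMSEQ_Suc[OF lim_1_over_n] c(2), unfolded comp_def])
    moreover have "arccos (u (r m) \<bullet> x) \<le> \<rho> + 1 / real (Suc (r m))" for m
      using u(2)[of "r m"] x by (auto simp: spherical_cap_def)
    ultimately have "arccos (c \<bullet> x) \<le> \<rho> + 0" by (intro LIMSEQ_le) auto
    then show "x \<in> spherical_cap c \<rho>" using Ks[OF x] by (simp add: spherical_cap_def)
  qed
  then show "\<exists>c. norm c = 1 \<and> K \<subseteq> spherical_cap c \<rho>" using c(1) by auto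
qed

text \<open>If a cap of radius \<open>\<delta>\<close> lies in \<open>K\<close>, it contains no pair of opposite points, and its point farthest
from \<open>c\<close> has distance at least \<open>\<delta>\<close> from \<open>c\<close>.\<close>

lemma inner_body_radius:
  fixes K :: "(real ^ 'd) set"
  assumes K: "spherically_convex K" and c: "norm c = 1" "K \<subseteq> spherical_cap c \<rho>" "\<rho> \<le> pi / 2"
    and ne: "inner_parallel_body K \<delta> \<noteq> {}" and \<delta>: "0 < \<delta>" and d: "2 \<le> CARD('d)"
  shows "\<delta> < pi / 2" "\<delta> \<le> \<rho>"
proof -
  obtain u where u: "u \<in> K" "spherical_cap u \<delta> \<subseteq> K" using ne by (auto simp: inner_parallel_body_def)
  have nu: "norm u = 1" using u(1) spherically_convex_subset_sphere[OF K] by auto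
  obtain w where w: "\<And>x. x \<in> K \<Longrightarrow> 0 < w \<bullet> x"
    using open_hemisphere[OF K(1)] by blast
  show d2: "\<delta> < pi / 2"
  proof (rule ccontr)
    assume "\<not> \<delta> < pi / 2"
    obtain y where y: "y \<noteq> 0" "orthogonal u y" using orthogonal_to_vector_exists[of u] d by auto
    define v where "v = y /\<^sub>R norm y"
    have v: "norm v = 1" "u \<bullet> v = 0" using y by (auto simp: v_def orthogonal_def)
    have "v \<in> K" "- v \<in> K"
      using v u(2) \<open>\<not> \<delta> < pi / 2\<close> by (auto simp: spherical_cap_def subset_iff)
    then show False using w[of v] w[of "- v"] by simp
  qed
  obtain p where p: "norm p = 1" "u \<bullet> p = cos \<delta>" "c \<bullet> p = sin (latitude c u - \<delta>)"
    using tilt_point[OF nu c(1), of \<delta>] d by auto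
  have "arccos (u \<bullet> p) = \<delta>" unfolding p(2) using \<delta> d2 by (intro arccos_cos) auto
  then have "p \<in> K" using p(1) u(2) by (auto simp: spherical_cap_def subset_iff)
  then have "arccos (c \<bullet> p) \<le> \<rho>" "arccos (c \<bullet> u) \<le> \<rho>" using c(2) u(1) by (auto simp: spherical_cap_def)
  then have lat: "pi / 2 - \<rho> \<le> latitude c p" "pi / 2 - \<rho> \<le> latitude c u"
    using unit_latitude[OF c(1)] p(1) nu by auto
  have "latitude c p = arcsin (sin (latitude c u - \<delta>))" using p by (simp add: latitude_def)
  also have "\<dots> = latitude c u - \<delta>"
    using lat c(3) d2 \<delta> latitude_bounds[OF c(1), of u] by (intro arcsin_sin) auto
  finally show "\<delta> \<le> \<rho>" using lat latitude_bounds(2)[OF c(1), of u] by linarith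
qed

text \<open>The point of the ray through \<open>v\<close> nearest to \<open>u\<close> has distance \<open>sin\<close> of the angle between \<open>u\<close> and \<open>v\<close> from \<open>u\<close>.\<close>

lemma deep_point_cap:
  fixes K :: "(real ^ 'd) set"
  assumes K: "spherically_convex K" and u: "norm u = 1" and \<delta>: "0 < \<delta>" "\<delta> < pi / 2"
    and deep: "\<delta> < angular_depth (interior (cone_over K)) u"
  shows "spherical_cap u \<delta> \<subseteq> K"
proof
  let ?V = "interior (cone_over K)"
  note V = interior_cone_over[OF K]
  fix v assume v: "v \<in> spherical_cap u \<delta>"
  then have nv: "norm v = 1" and a: "arccos (u \<bullet> v) \<le> \<delta>" by (auto simp: spherical_cap_def)
  have b: "\<bar>u \<bullet> v\<bar> \<le> 1" using Cauchy_Schwarz_ineq2[of u v] u nv by simp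
  have "cos \<delta> \<le> cos (arccos (u \<bullet> v))"
    using a \<delta> b arccos_lbound[of "u \<bullet> v"] by (intro cos_monotone_0_pi_le) (auto simp: abs_le_iff)
  then have cd: "cos \<delta> \<le> u \<bullet> v" using b by (simp add: cos_arccos_abs)
  have c0: "0 < cos \<delta>" using \<delta> by (intro cos_gt_zero_pi) auto
  have s0: "0 < sin \<delta>" using \<delta> by (intro sin_gt_zero) auto
  have "(norm (u - (u \<bullet> v) *\<^sub>R v))\<^sup>2 = 1 - (u \<bullet> v)\<^sup>2"
  proof -
    have "u \<bullet> u = 1" "v \<bullet> v = 1" using u nv by (auto simp: norm_eq_1)
    then show ?thesis unfolding power2_norm_eq_inner
      by (simp add: inner_diff_left inner_diff_right inner_commute[of v u] power2_eq_square)
  qed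
  also have "\<dots> \<le> 1 - (cos \<delta>)\<^sup>2" using cd c0 by (intro diff_left_mono power_mono) auto
  also have "\<dots> = (sin \<delta>)\<^sup>2" by (rule sin_squared_eq[symmetric])
  finally have "norm (u - (u \<bullet> v) *\<^sub>R v) \<le> sin \<delta>" by (rule power2_le_imp_le[OF _ less_imp_le[OF s0]])
  also have "sin \<delta> < infdist u (- ?V)" using deep \<delta> u depth_less_iff[OF V, of \<delta> u] by simp
  finally have "(u \<bullet> v) *\<^sub>R v \<in> ball u (infdist u (- ?V))" by (simp add: dist_norm)
  then have "(u \<bullet> v) *\<^sub>R v \<in> ?V" using ball_infdist[OF V] by blast
  moreover have uv: "0 < u \<bullet> v" using cd c0 by linarith
  ultimately have "inverse (u \<bullet> v) *\<^sub>R ((u \<bullet> v) *\<^sub>R v) \<in> ?V" by (rule cone_scale[OF V _ positive_imp_inverse_positive])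
  moreover have "inverse (u \<bullet> v) *\<^sub>R ((u \<bullet> v) *\<^sub>R v) = v" using uv by simp
  ultimately have "v \<in> cone_over K" using interior_subset[of "cone_over K"] by auto
  then show "v \<in> K" by (rule cone_over_unit[OF spherically_convex_subset_sphere[OF K] _ nv])
qed

lemma depth_direction:
  assumes "blunt_convex_cone V" "open V" "0 \<notin> V" "x \<noteq> 0"
  shows "angular_depth V (x /\<^sub>R norm x) = angular_depth V x"
  using infdist_scale[OF assms(1-3), of "inverse (norm x)" x] assms(4)
  by (simp add: angular_depth_def divide_inverse mult.commute)

text \<open>Moving away from the centre \<open>c\<close> through an angle slightly larger than \<open>s\<close> stays in \<open>V\<close>, and there the latitude is
still at least \<open>lo\<close>.\<close>

lemma depth_le_latitude:
  fixes V :: "'a::euclidean_space set"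
  assumes V: "blunt_convex_cone V" "open V" "0 \<notin> V" and c: "norm c = 1" and d: "2 \<le> DIM('a)"
    and lo: "0 \<le> lo" and sub: "\<And>x. x \<in> V \<Longrightarrow> lo \<le> latitude c x"
    and s: "0 < s" "s < pi / 2" "s < angular_depth V x"
  shows "s < latitude c x - lo"
proof -
  have x: "x \<noteq> 0" using depth_less_iff[OF V, of s x] s by simp
  define u where "u = x /\<^sub>R norm x"
  have u: "norm u = 1" using x by (simp add: u_def)
  have du: "angular_depth V u = angular_depth V x" unfolding u_def by (rule depth_direction[OF V x])
  define t where "t = (s + angular_depth V x) / 2"
  have t: "s < t" "t < angular_depth V u" "0 < t" "t < pi / 2"
    using s depth_bounds(2)[OF V, of x] by (auto simp: t_def du)
  have "x \<in> V" using depth_pos_iff[OF V, of x] s by linarith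
  then have uV: "u \<in> V" unfolding u_def using x by (intro cone_scale[OF V]) auto
  obtain p where p: "norm p = 1" "u \<bullet> p = cos t" "c \<bullet> p = sin (latitude c u - t)"
    using tilt_point[OF u c d, of t] by blast
  have ct: "0 < cos t" using t by (intro cos_gt_zero_pi) auto
  have st: "0 \<le> sin t" using t by (intro sin_ge_zero) auto
  have "(norm (u - cos t *\<^sub>R p))\<^sup>2 = (sin t)\<^sup>2"
  proof -
    have "u \<bullet> u = 1" "p \<bullet> p = 1" using u p by (auto simp: norm_eq_1)
    then show ?thesis unfolding power2_norm_eq_inner
      by (simp add: inner_diff_left inner_diff_right inner_commute[of p u] p(2) sin_squared_eq) (simp add: power2_eq_square)
  qed
  then have "norm (u - cos t *\<^sub>R p) = sin t" using st by (simp add: power2_eq_iff_nonneg)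
  also have "sin t < infdist u (- V)" using depth_less_iff[OF V, of t u] t u by simp
  finally have "cos t *\<^sub>R p \<in> ball u (infdist u (- V))" by (simp add: dist_norm)
  then have "cos t *\<^sub>R p \<in> V" using ball_infdist[OF V] by blast
  from sub[OF this] have "lo \<le> latitude c p" using ct by (simp add: latitude_scale)
  also have "latitude c p = arcsin (sin (latitude c u - t))" using p by (simp add: latitude_def)
  also have "\<dots> = latitude c u - t"
    using sub[OF uV] lo t latitude_bounds[OF c, of u] by (intro arcsin_sin) auto
  also have "latitude c u = latitude c x"
    using latitude_scale[of "inverse (norm x)" c x] x by (simp add: u_def)
  finally show ?thesis using t by linarith
qed

section \<open>Inner parallel bodies and the covering bound\<close>

text \<open>The frontier of a blunt convex cone is again invariant under positive scaling, which makes its measure on the sphere computable from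
its volume.\<close>

lemma frontier_cone_scale:
  fixes C :: "'a::real_normed_vector set"
  assumes C: "blunt_convex_cone C" and a: "0 < a" and x: "x \<in> frontier C"
  shows "a *\<^sub>R x \<in> frontier C"
proof -
  have "(*\<^sub>R) a ` C \<subseteq> C" using C a by (auto simp: blunt_convex_cone_def)
  have "a *\<^sub>R x \<in> (*\<^sub>R) a ` closure C" using x by (auto simp: frontier_def)
  then have "a *\<^sub>R x \<in> closure ((*\<^sub>R) a ` C)" by (simp add: closure_scaleR)
  then have "a *\<^sub>R x \<in> closure C" using closure_mono[OF \<open>(*\<^sub>R) a ` C \<subseteq> C\<close>] by blast
  moreover have "a *\<^sub>R x \<notin> interior C"
  proof
    assume "a *\<^sub>R x \<in> interior C"
    then have "inverse a *\<^sub>R (a *\<^sub>R x) \<in> interior C"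
      using interior_blunt_convex_cone[OF C] a unfolding blunt_convex_cone_def by (meson positive_imp_inverse_positive)
    then show False using x a by (simp add: frontier_def)
  qed
  ultimately show ?thesis by (simp add: frontier_def)
qed

context sphere_haar
begin

lemma prob_frontier_cone:
  assumes C: "blunt_convex_cone C" shows "prob (frontier C) = 0"
proof (rule prob_negligible_cone)
  show "negligible (frontier C)" by (rule negligible_convex_frontier[OF blunt_convex_cone_convex[OF C]])
  fix x :: "real ^ 'd" assume x: "x \<noteq> 0"
  show "x /\<^sub>R norm x \<in> frontier C \<longleftrightarrow> x \<in> frontier C"
    using frontier_cone_scale[OF C, of "inverse (norm x)" x] frontier_cone_scale[OF C, of "norm x" "x /\<^sub>R norm x"] x by auto
qed (simp add: borel_closed)

text \<open>The layers of \<open>layer_comparison\<close>, for the angular depth in \<open>V\<close> and in the cone over the cap, are differences of level sets;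
\<open>prob_layer_le\<close> passes from their masses to their spherical measures.\<close>

lemma prob_depth_lower:
  fixes V :: "(real ^ 'd) set"
  assumes V: "blunt_convex_cone V" "open V" "0 \<notin> V" and c: "norm c = 1"
    and lo: "0 \<le> lo" "0 < \<delta>" "lo + \<delta> < pi / 2" and sub: "\<And>x. x \<in> V \<Longrightarrow> lo \<le> latitude c x"
  shows "prob V - prob {x. \<delta> < angular_depth V x} \<le> prob {x. lo < latitude c x} - prob {x. lo + \<delta> < latitude c x}"
proof -
  let ?F = "angular_depth V"
  have d: "2 \<le> DIM(real ^ 'd)" using dim_ge_2 by simp
  have Fm[measurable]: "?F \<in> borel_measurable borel" by (rule depth_measurable[OF V])
  have [measurable]: "latitude c \<in> borel_measurable borel" by (rule latitude_measurable[OF c])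
  let ?A = "{x. 0 < ?F x \<and> ?F x \<le> \<delta>}" and ?B = "{x. 0 < latitude c x - lo \<and> latitude c x - lo \<le> \<delta>}"
  have "prob ?A \<le> prob ?B"
  proof (rule prob_layer_le)
    show "drift_mass ?A
      \<le> drift_mass ?B"
    proof (rule layer_comparison[OF Fm c lo dim_ge_2])
      fix s assume s: "0 < s" "s < \<delta>"
      then have s': "s < pi / 2" using lo by linarith
      show "blunt_convex_cone {x. s < ?F x}" using s s' by (intro depth_level_cone[OF V]) auto
      fix x assume "s < ?F x"
      then show "s < latitude c x - lo" using s s' by (intro depth_le_latitude[OF V c d lo(1) sub]) auto
    next
      fix x assume "0 < ?F x"
      then have "x \<in> V" by (simp add: depth_pos_iff[OF V])
      then show "\<exists>b. norm b = 1 \<and> ?F x = latitude b x \<and> (\<forall>y. ?F y \<le> max 0 (latitude b y))"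
        by (rule depth_support[OF V])
    qed
  qed (auto simp: depth_direction[OF V] latitude_direction)
  moreover have "?A = V - {x. \<delta> < ?F x}" using depth_pos_iff[OF V] by auto
  moreover have "?B = {x. lo < latitude c x} - {x. lo + \<delta> < latitude c x}" by auto
  moreover have "prob (V - {x. \<delta> < ?F x}) = prob V - prob {x. \<delta> < ?F x}"
  proof (rule finite_measure_Diff)
    show "{x. \<delta> < ?F x} \<subseteq> V"
    proof
      fix x assume "x \<in> {x. \<delta> < ?F x}"
      then have "0 < ?F x" using lo by simp
      then show "x \<in> V" by (simp add: depth_pos_iff[OF V])
    qed
  qed (use V(2) in auto)
  moreover have "prob ({x. lo < latitude c x} - {x. lo + \<delta> < latitude c x}) = prob {x. lo < latitude c x} - prob {x. lo + \<delta> < latitude c x}"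
    using lo by (intro finite_measure_Diff) auto
  ultimately show ?thesis by simp
qed

text \<open>With \<open>\<Omega>\<close> the lower bound for the measure of a cap of radius \<open>\<delta>\<close>, the number \<open>N\<close> of greedy steps is the least integer above
\<open>ln (1 / \<Omega>) / p\<close>, which makes \<open>(1 - p)^N \<le> exp (- p N) < \<Omega>\<close>. A point \<open>x\<close> outside all copies of
\<open>K\<close> would have a neighbourhood of radius \<open>\<delta>\<close> outside all copies of the inner body. The copies of \<open>K\<close> are taken under the
inverses of the greedy rotations.\<close>

lemma economical_covering:
  fixes K :: "(real ^ 'd) set" and n :: nat
  assumes K: "spherically_convex K" and \<delta>: "0 < \<delta>" "\<delta> < pi / 2" and n: "CARD('d) = n + 1" "1 \<le> n"
  defines "p \<equiv> prob {x. \<delta> < angular_depth (interior (cone_over K)) x}"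
  assumes p: "0 < p"
  shows "\<exists>R. covering_by_rotated_copies K R \<and> finite R \<and> real (card R) * p \<le> 2 * real n + real n * ln (1 / \<delta>)"
proof -
  let ?V = "interior (cone_over K)"
  note V = interior_cone_over[OF K]
  have Fm[measurable]: "angular_depth ?V \<in> borel_measurable borel" by (rule depth_measurable[OF V])
  define L where "L = {x. \<delta> < angular_depth ?V x}"
  have L[measurable]: "L \<in> sets borel" unfolding L_def by measurable
  obtain w where w: "norm w = 1" "\<And>x. x \<in> K \<Longrightarrow> 0 < w \<bullet> x" using open_hemisphere[OF K] by blast
  have p_half: "p \<le> 1 / 2"
  proof -
    have "L \<subseteq> {x. 0 < w \<bullet> x}"
    proof
      fix x assume "x \<in> L"
      then have "0 < angular_depth ?V x" using \<delta> by (simp add: L_def)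
      then have "x \<in> ?V" by (simp add: depth_pos_iff[OF V])
      then have "x \<in> cone_over K" using interior_subset by blast
      then show "x \<in> {x. 0 < w \<bullet> x}" using w(2) by (auto simp: cone_over_def)
    qed
    moreover have "{x. 0 < w \<bullet> x} \<in> sets borel" by (intro borel_open open_halfspace_gt)
    ultimately have "prob L \<le> prob {x. 0 < w \<bullet> x}" by (intro finite_measure_mono) auto
    then show ?thesis using prob_hemisphere[OF w(1)] by (simp add: p_def L_def)
  qed
  define \<Omega> where "\<Omega> = (2 * \<delta> / pi) ^ n / 2"
  have \<Omega>: "0 < \<Omega>" "\<Omega> \<le> 1 / 2" using \<delta> by (auto simp: \<Omega>_def power_le_one)
  define t where "t = ln (1 / \<Omega>) / p"
  have t0: "0 \<le> t" using \<Omega> p by (auto simp: t_def)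
  define N where "N = nat \<lfloor>t\<rfloor> + 1"
  have N: "t < real N" "real N \<le> t + 1" using t0 by (auto simp: N_def) linarith+
  have small: "(1 - p) ^ N < \<Omega>"
  proof -
    have "(1 - p) ^ N \<le> exp (- p) ^ N" using p_half exp_ge_add_one_self[of "- p"] by (intro power_mono) auto
    also have "\<dots> = exp (- (real N * p))" by (simp add: exp_of_nat_mult[symmetric])
    also have "\<dots> < exp (- (t * p))" using N p by simp
    also have "t * p = ln (1 / \<Omega>)" using p by (simp add: t_def)
    also have "exp (- ln (1 / \<Omega>)) = \<Omega>" using \<Omega> by (simp add: ln_div)
    finally show ?thesis .
  qed
  obtain R where R: "finite R" "card R \<le> N" "\<And>T. T \<in> R \<Longrightarrow> rotation_matrix T"
    "{x. \<forall>T\<in>R. T *v x \<notin> L} \<in> sets borel" "prob {x. \<forall>T\<in>R. T *v x \<notin> L} \<le> (1 - p) ^ N"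
    using greedy_rotations[OF L, of N] by (auto simp: p_def L_def)
  have cover: "\<exists>T\<in>R. T *v x \<in> K" if x: "norm x = 1" for x
  proof (rule ccontr)
    assume "\<not> ?thesis"
    then have un: "T *v x \<notin> K" if "T \<in> R" for T using that by blast
    have "T *v y \<notin> L" if y: "norm y = 1" "pi / 2 - \<delta> < latitude x y" and T: "T \<in> R" for y T
    proof
      assume Ty: "T *v y \<in> L"
      have ot: "orthogonal_transformation ((*v) T)" using R(3)[OF T] by (rule orthogonal_transformation_mult_vec)
      have nn: "norm (T *v y) = 1" "norm (T *v x) = 1" using x y by (simp_all add: orthogonal_transformation_norm[OF ot])
      have "(T *v y) \<bullet> (T *v x) = x \<bullet> y" using ot by (simp add: orthogonal_transformation_def inner_commute)
      moreover have "arccos (x \<bullet> y) \<le> \<delta>" using y(2) unit_latitude[OF x y(1)] by simp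
      ultimately have "T *v x \<in> spherical_cap (T *v y) \<delta>" using nn by (simp add: spherical_cap_def)
      then have "T *v x \<in> K" using deep_point_cap[OF K nn(1) \<delta>] Ty by (auto simp: L_def)
      then show False using un[OF T] by simp
    qed
    then have "prob {y. pi / 2 - \<delta> < latitude x y} \<le> prob {x. \<forall>T\<in>R. T *v x \<notin> L}"
      using AE_sphere R(4) by (intro finite_measure_mono_AE) (auto elim!: AE_mp)
    moreover have "\<Omega> \<le> prob {y. pi / 2 - \<delta> < latitude x y}"
      using prob_cap_lower[OF x \<delta>(1)] \<delta> n by (simp add: \<Omega>_def)
    ultimately show False using R(5) small by linarith
  qed
  have "covering_by_rotated_copies K (transpose ` R)"
    unfolding covering_by_rotated_copies_def
  proof (intro conjI ballI subsetI)
    fix A assume "A \<in> transpose ` R"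
    then show "rotation_matrix A" using R(3) rotation_matrix_transpose by auto
  next
    fix x :: "real ^ 'd" assume "x \<in> sphere 0 1"
    then obtain T where T: "T \<in> R" "T *v x \<in> K" using cover by auto
    have "transpose T ** T = mat 1" using R(3)[OF T(1)] by (simp add: rotation_matrix_def orthogonal_matrix)
    then have "x = transpose T *v (T *v x)" by (simp add: matrix_vector_mul_assoc)
    then show "x \<in> (\<Union>A\<in>transpose ` R. (*v) A ` K)" using T by blast
  qed
  moreover have "finite (transpose ` R)" using R(1) by simp
  moreover have "real (card (transpose ` R)) * p \<le> 2 * real n + real n * ln (1 / \<delta>)"
  proof -
    have "card (transpose ` R) \<le> N" using card_image_le[OF R(1), of transpose] R(2) by linarith
    then have "real (card (transpose ` R)) * p \<le> real N * p" using p by (intro mult_right_mono) auto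
    also have "\<dots> \<le> (t + 1) * p" using N p by (intro mult_right_mono) auto
    also have "\<dots> = ln (1 / \<Omega>) + p" using p by (simp add: t_def algebra_simps)
    also have "\<dots> \<le> ln (1 / \<Omega>) + 1 / 2" using p_half by simp
    also have "ln (1 / \<Omega>) = ln 2 + real n * ln (pi / 2) + real n * ln (1 / \<delta>)"
      using \<delta> by (simp add: \<Omega>_def ln_div ln_mult ln_realpow algebra_simps)
    also have "ln 2 + real n * ln (pi / 2) + real n * ln (1 / \<delta>) + 1 / 2 \<le> 2 * real n + real n * ln (1 / \<delta>)"
    proof -
      have l2: "ln (2 :: real) \<le> 25 / 36" by (rule ln2_le_25_over_36)
      have "ln (pi / 2) \<le> ln 2" using pi_half_less_two pi_gt_zero by (intro ln_mono) auto
      then have "ln (pi / 2) \<le> 25 / 36" using l2 by linarith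
      then have "real n * ln (pi / 2) \<le> real n * (25 / 36)" by (intro mult_left_mono) simp_all
      moreover have "1 \<le> real n" using n(2) by simp
      ultimately show ?thesis using l2 by linarith
    qed
    finally show ?thesis .
  qed
  ultimately show ?thesis by blast
qed

end

theorem corollary1p5:
  fixes \<sigma> :: "(real ^ 'd) measure" and K :: "(real ^ 'd) set" and n :: nat and \<rho> :: real
  assumes "n \<ge> 1" and "CARD('d) = n + 1"
    and "spherical_haar \<sigma>"
    and "K \<noteq> {}" and "spherically_convex K"
    and "\<rho> = spherical_circumradius K"
  shows "\<exists>R. covering_by_rotated_copies K R \<and>
           covering_density \<sigma> K R
             \<le> (INF \<kappa> \<in> {\<kappa>. 0 < \<kappa> \<and> inner_parallel_body K (\<kappa> * \<rho>) \<noteq> {}}. density_bound \<sigma> n K \<rho> \<kappa>)"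
proof -
  note n = assms(1,2) and \<sigma> = assms(3) and K = assms(5)
  have d: "2 \<le> CARD('d)" using n by simp
  define \<mu> where "\<mu> = distr \<sigma> borel (\<lambda>x. x)"
  interpret sphere_haar \<mu> unfolding \<mu>_def by (rule sphere_haar_of_spherical_haar[OF \<sigma> d])
  have sect: "E \<inter> sphere 0 1 \<in> sets \<sigma>" "measure \<sigma> (E \<inter> sphere 0 1) = prob E" if "E \<in> sets borel" for E
    using sphere_haar_of_spherical_haar(2)[OF \<sigma> d that] by (simp_all add: \<mu>_def)
  interpret S: prob_space \<sigma> using \<sigma> by (simp add: spherical_haar_def)
  interpret C: prob_space "completion \<sigma>" by (rule S.prob_space_completion)
  have \<rho>: "0 \<le> \<rho>" "\<rho> \<le> pi / 2" and "\<exists>c. norm c = 1 \<and> K \<subseteq> spherical_cap c \<rho>"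
    using circumcentre_exists[OF K assms(4)] by (simp_all add: assms(6))
  then obtain c where c: "norm c = 1" "K \<subseteq> spherical_cap c \<rho>" by blast
  have Ks: "K \<subseteq> sphere 0 1" by (rule spherically_convex_subset_sphere[OF K])
  let ?C = "cone_over K" and ?V = "interior (cone_over K)"
  note V = interior_cone_over[OF K]
  have KC: "K \<subseteq> ?C"
  proof
    fix x assume "x \<in> K"
    then show "x \<in> ?C" unfolding cone_over_def by (intro CollectI exI[of _ 1] exI[of _ x]) auto
  qed
  have VK: "?V \<inter> sphere 0 1 \<subseteq> K"
    using cone_over_unit[OF Ks] interior_subset[of ?C] by auto
  (* K differs from the interior of its cone only inside the frontier of the cone, which is a null set. *)
  have K_sets: "K \<in> sets (completion \<sigma>)" and K_prob: "sph_measure \<sigma> K = prob ?V"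
  proof -
    have VS: "?V \<inter> sphere 0 1 \<in> sets \<sigma>" by (rule sect) simp
    have "frontier ?C \<inter> sphere 0 1 \<in> null_sets \<sigma>"
      using sect[of "frontier ?C"] prob_frontier_cone[OF cone_over_convex[OF K]]
      by (simp add: null_sets_def S.emeasure_eq_measure)
    then have nullC: "frontier ?C \<inter> sphere 0 1 \<in> null_sets (completion \<sigma>)" by (rule null_sets_completionI)
    have "K - ?V \<subseteq> frontier ?C \<inter> sphere 0 1"
      using KC Ks closure_subset[of ?C] by (auto simp: frontier_def)
    then have null: "K - ?V \<in> null_sets (completion \<sigma>)" using nullC by (rule null_sets_completion_subset)
    have eq: "K = (?V \<inter> sphere 0 1) \<union> (K - ?V)" using VK Ks by auto
    have VS': "?V \<inter> sphere 0 1 \<in> sets (completion \<sigma>)" using VS by (rule sets_completionI_sets)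
    show "K \<in> sets (completion \<sigma>)" using VS' null by (subst eq) auto
    have "sph_measure \<sigma> K = sph_measure \<sigma> (?V \<inter> sphere 0 1)"
      by (subst eq) (rule measure_Un_null_set[OF VS' null])
    then show "sph_measure \<sigma> K = prob ?V" using VS sect(2)[of ?V] by simp
  qed
  have Cap: "spherical_cap c \<rho> \<in> sets \<sigma>" using c by (intro spherical_cap_sets[OF \<sigma>]) simp
  have cap: "cap_measure \<sigma> \<rho> = measure \<sigma> (spherical_cap c \<rho>)"
    using cap_measure_eq[OF \<sigma> d, of c] c Cap by simp
  have K_le_cap: "sph_measure \<sigma> K \<le> cap_measure \<sigma> \<rho>"
  proof -
    have "sph_measure \<sigma> K \<le> sph_measure \<sigma> (spherical_cap c \<rho>)"
       using Cap c by (intro C.finite_measure_mono) auto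
    then show ?thesis using cap Cap by simp
  qed
  have open_cap: "prob {x. pi / 2 - \<rho> < latitude c x} \<le> cap_measure \<sigma> \<rho>"
  proof -
    have "{x. pi / 2 - \<rho> < latitude c x} \<inter> sphere 0 1 \<subseteq> spherical_cap c \<rho>"
      using unit_latitude[OF c(1)] by (auto simp: spherical_cap_def)
    then have "measure \<sigma> ({x. pi / 2 - \<rho> < latitude c x} \<inter> sphere 0 1) \<le> measure \<sigma> (spherical_cap c \<rho>)"
      using Cap by (intro S.finite_measure_mono) auto
    then show ?thesis using sect(2)[OF cap_sets(1)[OF c(1)]] cap by simp
  qed
  define D where "D \<kappa> = sph_measure \<sigma> K - cap_measure \<sigma> \<rho> * (1 - (1 - \<kappa>) ^ n)" for \<kappa>
  have key: "\<exists>R. covering_by_rotated_copies K R \<and> finite R \<and> covering_density \<sigma> K R \<le> density_bound \<sigma> n K \<rho> \<kappa>"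
    if \<kappa>: "0 < \<kappa>" "inner_parallel_body K (\<kappa> * \<rho>) \<noteq> {}" and D: "0 < D \<kappa>" for \<kappa>
  proof -
    (* If \<rho> = 0, the cap is a single point, hence a null set, and D vanishes. *)
    have \<rho>0: "0 < \<rho>"
    proof (rule ccontr)
      assume "\<not> 0 < \<rho>"
      then have "\<rho> = 0" using \<rho> by simp
      obtain e where e: "e \<noteq> 0" "orthogonal c e" using orthogonal_to_vector_exists[of c] d by auto
      have "spherical_cap c \<rho> \<subseteq> {x. (e /\<^sub>R norm e) \<bullet> x = 0} \<inter> sphere 0 1"
      proof
        fix v assume "v \<in> spherical_cap c \<rho>"
        then have v: "norm v = 1" "arccos (c \<bullet> v) \<le> 0" by (auto simp: spherical_cap_def \<open>\<rho> = 0\<close>)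
        have b: "\<bar>c \<bullet> v\<bar> \<le> 1" using Cauchy_Schwarz_ineq2[of c v] c v by simp
        then have "arccos (c \<bullet> v) = 0" using v arccos_lbound[of "c \<bullet> v"] by (auto simp: abs_le_iff)
        then have "c \<bullet> v = 1" using cos_arccos_abs[OF b] by simp
        then have "norm (c - v) = 0"
          using c v by (simp add: norm_eq_sqrt_inner inner_diff_left inner_diff_right inner_commute norm_eq_1)
        then have "v = c" by simp
        then show "v \<in> {x. (e /\<^sub>R norm e) \<bullet> x = 0} \<inter> sphere 0 1" using e c by (simp add: orthogonal_def inner_commute)
      qed
      moreover have hp: "{x. (e /\<^sub>R norm e) \<bullet> x = 0} \<in> sets borel" by (intro borel_closed closed_hyperplane)
      ultimately have "measure \<sigma> (spherical_cap c \<rho>) \<le> prob {x. (e /\<^sub>R norm e) \<bullet> x = 0}"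
        unfolding sect(2)[OF hp, symmetric] using sect(1)[OF hp] by (intro S.finite_measure_mono)
      then have "cap_measure \<sigma> \<rho> = 0"
        using prob_hyperplane[of "e /\<^sub>R norm e"] e cap by (simp add: measure_le_0_iff)
      then show False using D K_le_cap by (simp add: D_def)
    qed
    define \<delta> where "\<delta> = \<kappa> * \<rho>"
    have \<delta>: "0 < \<delta>" using \<kappa> \<rho>0 by (simp add: \<delta>_def)
    have rad: "\<delta> < pi / 2" "\<delta> \<le> \<rho>"
      using inner_body_radius[OF K c \<rho>(2) _ \<delta> d] \<kappa> by (auto simp: \<delta>_def)
    have "\<kappa> \<le> 1" using rad(2) \<rho>0 by (simp add: \<delta>_def)
    (* For \<kappa> = 1 the denominator is \<sigma>(K) - \<Omega>(\<rho>), which is not positive. *)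
    moreover have "\<kappa> \<noteq> 1" using D K_le_cap n by (auto simp: D_def power_0_left)
    ultimately have \<kappa>1: "\<kappa> < 1" by simp
    define lo where "lo = pi / 2 - \<rho>"
    have lo: "0 \<le> lo" "lo + \<delta> < pi / 2" using \<rho> \<rho>0 \<kappa>1 by (auto simp: lo_def \<delta>_def)
    have sub: "lo \<le> latitude c x" if x: "x \<in> ?V" for x
    proof -
      obtain t k where t: "x = t *\<^sub>R k" "0 < t" "k \<in> K" using x interior_subset by (force simp: cone_over_def)
      have "arccos (c \<bullet> k) \<le> \<rho>" "norm k = 1" using t c by (auto simp: spherical_cap_def)
      then show ?thesis using t unit_latitude[OF c(1), of k] by (simp add: latitude_scale lo_def)
    qed
    define p where "p = prob {x. \<delta> < angular_depth ?V x}"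
    have "prob ?V - p \<le> prob {x. lo < latitude c x} - prob {x. lo + \<delta> < latitude c x}"
      unfolding p_def by (rule prob_depth_lower[OF V c(1) lo(1) \<delta> lo(2) sub])
    moreover have "(1 - \<kappa>) ^ n * prob {x. lo < latitude c x} \<le> prob {x. lo + \<delta> < latitude c x}"
    proof -
      have "lo + \<delta> = pi / 2 - (1 - \<kappa>) * \<rho>" by (simp add: lo_def \<delta>_def algebra_simps)
      moreover have "CARD('d) - 1 = n" using n by simp
      ultimately show ?thesis
        using prob_cap_scale[OF c(1), of "1 - \<kappa>" \<rho>] \<kappa> \<kappa>1 \<rho>0 \<rho> by (simp only: lo_def)
    qed
    ultimately have "prob ?V - (1 - (1 - \<kappa>) ^ n) * prob {x. lo < latitude c x} \<le> p" by (simp add: algebra_simps)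
    moreover have "(1 - (1 - \<kappa>) ^ n) * prob {x. lo < latitude c x} \<le> (1 - (1 - \<kappa>) ^ n) * cap_measure \<sigma> \<rho>"
      using open_cap \<kappa> \<kappa>1 by (intro mult_left_mono) (auto simp: lo_def power_le_one)
    ultimately have Dp: "D \<kappa> \<le> p" by (simp add: D_def K_prob mult.commute)
    then have p: "0 < p" using D by linarith
    obtain R where R: "covering_by_rotated_copies K R" "finite R" "real (card R) * p \<le> 2 * real n + real n * ln (1 / \<delta>)"
      using economical_covering[OF K \<delta> rad(1) n(2,1)] p unfolding p_def by blast
    have "real (card R) * D \<kappa> \<le> 2 * real n + real n * ln (1 / \<delta>)"
      using mult_left_mono[OF Dp, of "real (card R)"] R(3) by simp
    then have "real (card R) \<le> (2 * real n + real n * ln (1 / \<delta>)) / D \<kappa>" using D by (simp add: field_simps)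
    then have "sph_measure \<sigma> K * real (card R) \<le> sph_measure \<sigma> K * ((2 * real n + real n * ln (1 / \<delta>)) / D \<kappa>)"
      by (intro mult_left_mono) auto
    then have "covering_density \<sigma> K R \<le> density_bound \<sigma> n K \<rho> \<kappa>"
      using R(2) D by (simp add: covering_density_def density_bound_def Let_def D_def[symmetric] \<delta>_def mult.commute)
    then show ?thesis using R by blast
  qed
  have trivial: "density_bound \<sigma> n K \<rho> \<kappa> = \<infinity>" if "\<not> 0 < D \<kappa>" for \<kappa>
    using that by (simp add: density_bound_def D_def)
  (* A covering with the least number of copies serves all \<kappa> simultaneously. *)
  show ?thesis
  proof (cases "\<exists>R. covering_by_rotated_copies K R \<and> finite R")
    case True
    then obtain R where R: "covering_by_rotated_copies K R \<and> finite R"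
      "\<And>R'. covering_by_rotated_copies K R' \<and> finite R' \<Longrightarrow> card R \<le> card R'"
      using ex_has_least_nat[of "\<lambda>R. covering_by_rotated_copies K R \<and> finite R" _ card] by blast
    have "covering_density \<sigma> K R \<le> density_bound \<sigma> n K \<rho> \<kappa>"
      if \<kappa>: "0 < \<kappa>" "inner_parallel_body K (\<kappa> * \<rho>) \<noteq> {}" for \<kappa>
    proof (cases "0 < D \<kappa>")
      case True
      obtain R' where R': "covering_by_rotated_copies K R'" "finite R'" "covering_density \<sigma> K R' \<le> density_bound \<sigma> n K \<rho> \<kappa>"
        using key[OF \<kappa> True] by blast
      have "covering_density \<sigma> K R \<le> covering_density \<sigma> K R'"
        using R(1) R(2)[of R'] R' by (auto simp: covering_density_def intro!: mult_right_mono)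
      then show ?thesis using R'(3) by (rule order.trans)
    qed (simp add: trivial)
    then show ?thesis using R(1) by (intro exI[of _ R] conjI INF_greatest) auto
  next
    case False
    have "density_bound \<sigma> n K \<rho> \<kappa> = \<infinity>" if "0 < \<kappa>" "inner_parallel_body K (\<kappa> * \<rho>) \<noteq> {}" for \<kappa>
      using key[OF that] trivial[of \<kappa>] False by blast
    moreover have "covering_by_rotated_copies K {T. rotation_matrix T}"
    proof -
      obtain k where k: "k \<in> K" using assms(4) by blast
      have "x \<in> (\<Union>A\<in>{T. rotation_matrix T}. (*v) A ` K)" if "x \<in> sphere 0 1" for x
      proof -
        have "norm k = norm x" using k Ks that by auto
        then obtain T where "rotation_matrix T" "T *v k = x" using rotation_exists_matrix[OF d] by blast
        then show ?thesis using k by blast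
      qed
      then show ?thesis by (auto simp: covering_by_rotated_copies_def)
    qed
    ultimately show ?thesis by (intro exI[of _ "{T. rotation_matrix T}"] conjI INF_greatest) auto
  qed
qed

end
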